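(* Let $\mu,\nu\in\{-,0,+\}$ and $\tau\in\mathbb{R}$. 1. If $\tau\neq0$, then $B_{\mu\nu}^\tau$ is (equivariantly $^*$-)isomorphic to a right $^*$-coideal of $\mathrm{Pol}_q(\mu)$ if and only if $\nu\leq0$. 2. If $\tau=0$, then $B_{\mu\nu}^\tau$ is (equivariantly $^*$-)isomorphic to a right $^*$-coideal of $\mathrm{Pol}_q(\mu)$ if and only if $\nu=-$.
   Context: Fix a real number $0<q<1$ and put $\lambda=(q-q^{-1})^{-1}<0$. The symbols $-,0,+$ stand for the real numbers $-1,0,1$. For $\mu,\nu\in\mathbb{R}$, $U_q(\mu,\nu)$ is the universal unital algebra over $\mathbb{C}$ generated by $K,K^{-1},E,F$ (subscripted by $\mu\nu$ when needed) with relations $K^{-1}K=1=KK^{-1}$, $KE=qEK$, $KF=q^{-1}FK$, $[E,F]=\lambda(\mu K^2-\nu K^{-2})$, with $^*$-structure determined by $K^*=K$, $E^*=F$. Let $C_{\mu\nu}=EF+\lambda^2(q^{-1}\mu K^2+q\nu K^{-2})$, a central self-adjoint element, and $A_{\mu\nu}^\tau=U_q(\mu,\nu)/(C_{\mu\nu}-\tau q^{-1}\lambda^2 1)$ with quotient map $\pi_\tau$. $B_{\mu\nu}^\tau$ is the unital sub-$^*$-algebra of $A_{\mu\nu}^\tau$ generated by $\pi_\tau(K_{\mu\nu}^2)$ and $\pi_\tau(K_{\mu\nu}E_{\mu\nu})$. Put $X=q^{1/2}(q^{-1}-q)\pi_\tau(F_{\mu\nu}K_{\mu\nu})$ and $Z=\pi_\tau(K_{\mu\nu}^2)$;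 these generate $B_{\mu\nu}^\tau$ as a unital $^*$-algebra. $\mathrm{Pol}(SL_q(2,\mathbb{C}))$ is the unital algebra generated by $a,b,c,d$ with relations $ab=qba$, $ac=qca$, $bd=qdb$, $cd=qdc$, $bc=cb$, $da-q^{-1}cb=1$, $ad-qbc=1$; it is a Hopf algebra with $\Delta(a)=a\otimes a+c\otimes b$, $\Delta(b)=b\otimes a+d\otimes b$, $\Delta(c)=a\otimes c+c\otimes d$, $\Delta(d)=b\otimes c+d\otimes d$. $\mathrm{Pol}_q(+)$ is this Hopf algebra with $^*$-structure $a^*=d$, $b^*=-q^{-1}c$, generators denoted $a_+,b_+$. $\mathrm{Pol}_q(-)$ is this Hopf algebra with $^*$-structure $a^*=d$, $b^*=q^{-1}c$, generators denoted $a_-,b_-$. $\mathrm{Pol}_q(0)$ is the universal unital $^*$-algebra generated by $a_0,b_0$ with $a_0^*a_0=1=a_0a_0^*$, $a_0b_0=qb_0a_0$, $a_0^*b_0=q^{-1}b_0a_0^*$, $b_0b_0^*=b_0^*b_0$, a Hopf $^*$-algebra with $\Delta_0(a_0)=a_0\otimes a_0$, $\Delta_0(b_0)=b_0\otimes a_0+a_0^*\otimes b_0$. Write $\Delta_\mu$ for the comultiplication of $\mathrm{Pol}_q(\mu)$. $\gamma:B_{\mu\nu}^\tau\to B_{\mu\nu}^\tau\otimes\mathrm{Pol}_q(\mu)$ is the right coaction (a unital $^*$-homomorphism that is coassociative and counital; it exists and is unique) determined by \[\gamma(X)=-q\mu X^*\otimes b_\mu^2-q(1+q^2)\mu Z\otimes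 b_\mu a_\mu+X\otimes a_\mu^2+q\tau\,1\otimes b_\mu a_\mu,\] \[\gamma(Z)=X^*\otimes a_\mu^*b_\mu+Z\otimes(1-(1+q^2)\mu b_\mu^*b_\mu)+X\otimes b_\mu^*a_\mu+\tau\,1\otimes b_\mu^*b_\mu.\] A right $^*$-coideal of $\mathrm{Pol}_q(\mu)$ is a unital sub-$^*$-algebra $I\subseteq\mathrm{Pol}_q(\mu)$ with $\Delta_\mu(I)\subseteq I\otimes\mathrm{Pol}_q(\mu)$, regarded with the coaction $\Delta_\mu|_I$. "Equivariantly $^*$-isomorphic" means that there is a unital $^*$-isomorphism $\pi:B_{\mu\nu}^\tau\to I$ with $(\pi\otimes\iota)\gamma=\Delta_\mu\pi$, where $\iota$ is the identity map. *)

theory Defs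
  imports
    Complex_Main
    "HOL-Library.Poly_Mapping"
    "HOL-Algebra.Module"
    "HOL-Algebra.QuotRing"
    "HOL-Algebra.Subrings"
begin

section \<open>Unital *-algebras over the complex numbers\<close>

record 'a star_alg = "(complex, 'a) module" +
  star :: "'a \<Rightarrow> 'a"

definition complex_alg :: "complex star_alg" where
  "complex_alg = \<lparr>carrier = UNIV, mult = (*), one = 1, zero = 0, add = (+),
     smult = (*), star = cnj\<rparr>"

definition star_hom :: "('a, 'x) star_alg_scheme \<Rightarrow> ('b, 'y) star_alg_scheme \<Rightarrow> ('a \<Rightarrow> 'b) \<Rightarrow> bool" where
  "star_hom A B f \<longleftrightarrow> f \<in> ring_hom A B \<and>
     (\<forall>c. \<forall>x\<in>carrier A. f (c \<odot>\<^bsub>A\<^esub> x) = c \<odot>\<^bsub>B\<^esub> f x) \<and>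
     (\<forall>x\<in>carrier A. f (star A x) = star B (f x))"

definition star_subalgebra :: "'a set \<Rightarrow> ('a, 'x) star_alg_scheme \<Rightarrow> bool" where
  "star_subalgebra H A \<longleftrightarrow> subring H A \<and>
     (\<forall>c. \<forall>x\<in>H. c \<odot>\<^bsub>A\<^esub> x \<in> H) \<and> (\<forall>x\<in>H. star A x \<in> H)"

definition generated_star_subalgebra :: "('a, 'x) star_alg_scheme \<Rightarrow> 'a set \<Rightarrow> 'a set" where
  "generated_star_subalgebra A S = \<Inter>{H. star_subalgebra H A \<and> S \<subseteq> H}"

text \<open>The quotient by a two-sided ideal. The last two fields descend the operations to cosets in
  the same style as \<^const>\<open>rcoset_mult\<close>; the *-operation is meaningful for *-stable ideals.\<close>

definition quot_alg :: "('a, 'x) star_alg_scheme \<Rightarrow> 'a set \<Rightarrow> 'a set star_alg" where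
  "quot_alg A I =
     \<lparr>carrier = carrier (A Quot I), mult = mult (A Quot I), one = one (A Quot I),
      zero = zero (A Quot I), add = add (A Quot I),
      smult = (\<lambda>c X. \<Union>x\<in>X. I +>\<^bsub>A\<^esub> (c \<odot>\<^bsub>A\<^esub> x)),
      star = (\<lambda>X. \<Union>x\<in>X. I +>\<^bsub>A\<^esub> star A x)\<rparr>"

section \<open>Monoid algebras and free algebras\<close>

text \<open>The monoid algebra of \<open>M\<close>, with the conjugate-linear operation that sends the basis
  element \<open>m\<close> to \<open>s m\<close>.\<close>

definition monoid_alg ::
  "('m, 'x) monoid_scheme \<Rightarrow> ('m \<Rightarrow> 'm \<Rightarrow>\<^sub>0 complex) \<Rightarrow> ('m \<Rightarrow>\<^sub>0 complex) star_alg" where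
  "monoid_alg M s =
     \<lparr>carrier = {p. Poly_Mapping.keys p \<subseteq> carrier M},
      mult = (\<lambda>p r. \<Sum>x\<in>Poly_Mapping.keys p. \<Sum>y\<in>Poly_Mapping.keys r.
        Poly_Mapping.single (x \<otimes>\<^bsub>M\<^esub> y) (Poly_Mapping.lookup p x * Poly_Mapping.lookup r y)),
      one = Poly_Mapping.single \<one>\<^bsub>M\<^esub> 1,
      zero = 0, add = (+),
      smult = (\<lambda>c. Poly_Mapping.map ((*) c)),
      star = (\<lambda>p. \<Sum>x\<in>Poly_Mapping.keys p.
        Poly_Mapping.map ((*) (cnj (Poly_Mapping.lookup p x))) (s x))\<rparr>"

definition word_monoid :: "'g list monoid" where
  "word_monoid = \<lparr>carrier = UNIV, mult = (@), one = []\<rparr>"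

text \<open>The free unital algebra on the type \<open>'g\<close>, with the antimultiplicative conjugate-linear
  operation given on generators by \<open>g\<^sup>* = fst (s g) \<cdot> snd (s g)\<close>.\<close>

definition free_alg :: "('g \<Rightarrow> complex \<times> 'g) \<Rightarrow> ('g list \<Rightarrow>\<^sub>0 complex) star_alg" where
  "free_alg s = monoid_alg word_monoid
     (\<lambda>w. Poly_Mapping.single (rev (map (snd \<circ> s) w)) (prod_list (map (fst \<circ> s) w)))"

definition presented_alg ::
  "('g \<Rightarrow> complex \<times> 'g) \<Rightarrow> ('g list \<Rightarrow>\<^sub>0 complex) set \<Rightarrow> ('g list \<Rightarrow>\<^sub>0 complex) set star_alg" where
  "presented_alg s R = quot_alg (free_alg s) (Idl\<^bsub>free_alg s\<^esub> R)"

definition presented_gen ::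
  "('g \<Rightarrow> complex \<times> 'g) \<Rightarrow> ('g list \<Rightarrow>\<^sub>0 complex) set \<Rightarrow> 'g \<Rightarrow> ('g list \<Rightarrow>\<^sub>0 complex) set" where
  "presented_gen s R g = (Idl\<^bsub>free_alg s\<^esub> R) +>\<^bsub>free_alg s\<^esub> Poly_Mapping.single [g] 1"

text \<open>The linear map into \<open>A\<close> with value \<open>f m\<close> at the basis element \<open>m\<close>, and the map that it
  induces on cosets of an ideal contained in its kernel.\<close>

definition lin_ext :: "('a, 'x) star_alg_scheme \<Rightarrow> ('m \<Rightarrow> 'a) \<Rightarrow> ('m \<Rightarrow>\<^sub>0 complex) \<Rightarrow> 'a" where
  "lin_ext A f p = (\<Oplus>\<^bsub>A\<^esub>m\<in>Poly_Mapping.keys p. Poly_Mapping.lookup p m \<odot>\<^bsub>A\<^esub> f m)"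

definition coset_ext :: "('a, 'x) star_alg_scheme \<Rightarrow> ('m \<Rightarrow> 'a) \<Rightarrow> ('m \<Rightarrow>\<^sub>0 complex) set \<Rightarrow> 'a" where
  "coset_ext A f X = the_elem (lin_ext A f ` X)"

text \<open>The unital algebra homomorphism from a presented algebra to \<open>A\<close> with value \<open>f g\<close> at the
  generator \<open>g\<close>.\<close>

definition alg_hom_ext :: "('a, 'x) star_alg_scheme \<Rightarrow> ('g \<Rightarrow> 'a) \<Rightarrow> ('g list \<Rightarrow>\<^sub>0 complex) set \<Rightarrow> 'a" where
  "alg_hom_ext A f = coset_ext A (\<lambda>w. foldr (\<lambda>g y. f g \<otimes>\<^bsub>A\<^esub> y) w \<one>\<^bsub>A\<^esub>)"

section \<open>Tensor products\<close>

text \<open>The tensor product is the vector space with basis \<open>A \<times> B\<close> modulo the bilinearity relations.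
  With the multiplication \<open>(x, y) (x', y') = (x x', y y')\<close> on that vector space, the span of
  the bilinearity relations is closed under multiplication by basis elements on either side, so it
  coincides with the ideal that they generate.\<close>

definition pretensor ::
  "('a, 'x) star_alg_scheme \<Rightarrow> ('b, 'y) star_alg_scheme \<Rightarrow> (('a \<times> 'b) \<Rightarrow>\<^sub>0 complex) star_alg" where
  "pretensor A B = monoid_alg (A \<times>\<times> B) (\<lambda>(x, y). Poly_Mapping.single (star A x, star B y) 1)"

definition bilinear_rels ::
  "('a, 'x) star_alg_scheme \<Rightarrow> ('b, 'y) star_alg_scheme \<Rightarrow> (('a \<times> 'b) \<Rightarrow>\<^sub>0 complex) set" where
  "bilinear_rels A B =
     {Poly_Mapping.single (x \<oplus>\<^bsub>A\<^esub> x', y) 1 - Poly_Mapping.single (x, y) 1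
        - Poly_Mapping.single (x', y) 1 | x x' y.
        x \<in> carrier A \<and> x' \<in> carrier A \<and> y \<in> carrier B}
   \<union> {Poly_Mapping.single (x, y \<oplus>\<^bsub>B\<^esub> y') 1 - Poly_Mapping.single (x, y) 1
        - Poly_Mapping.single (x, y') 1 | x y y'.
        x \<in> carrier A \<and> y \<in> carrier B \<and> y' \<in> carrier B}
   \<union> {Poly_Mapping.single (c \<odot>\<^bsub>A\<^esub> x, y) 1 - Poly_Mapping.single (x, y) c | c x y.
        x \<in> carrier A \<and> y \<in> carrier B}
   \<union> {Poly_Mapping.single (x, c \<odot>\<^bsub>B\<^esub> y) 1 - Poly_Mapping.single (x, y) c | c x y.
        x \<in> carrier A \<and> y \<in> carrier B}"

definition tensor_ideal ::
  "('a, 'x) star_alg_scheme \<Rightarrow> ('b, 'y) star_alg_scheme \<Rightarrow> (('a \<times> 'b) \<Rightarrow>\<^sub>0 complex) set" where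
  "tensor_ideal A B = Idl\<^bsub>pretensor A B\<^esub> (bilinear_rels A B)"

definition tensor ::
  "('a, 'x) star_alg_scheme \<Rightarrow> ('b, 'y) star_alg_scheme \<Rightarrow> (('a \<times> 'b) \<Rightarrow>\<^sub>0 complex) set star_alg" where
  "tensor A B = quot_alg (pretensor A B) (tensor_ideal A B)"

definition pure_tensor ::
  "('a, 'x) star_alg_scheme \<Rightarrow> ('b, 'y) star_alg_scheme \<Rightarrow> 'a \<Rightarrow> 'b \<Rightarrow> (('a \<times> 'b) \<Rightarrow>\<^sub>0 complex) set" where
  "pure_tensor A B x y = tensor_ideal A B +>\<^bsub>pretensor A B\<^esub> Poly_Mapping.single (x, y) 1"

text \<open>\<open>f \<otimes> g\<close> with values in the tensor product of \<open>C\<close> and \<open>D\<close>.\<close>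

definition tensor_map ::
  "('c, 'x) star_alg_scheme \<Rightarrow> ('d, 'y) star_alg_scheme \<Rightarrow> ('a \<Rightarrow> 'c) \<Rightarrow> ('b \<Rightarrow> 'd) \<Rightarrow>
   (('a \<times> 'b) \<Rightarrow>\<^sub>0 complex) set \<Rightarrow> (('c \<times> 'd) \<Rightarrow>\<^sub>0 complex) set" where
  "tensor_map C D f g = coset_ext (tensor C D) (\<lambda>(x, y). pure_tensor C D (f x) (g y))"

text \<open>The canonical map \<open>(A \<otimes> B) \<otimes> C \<rightarrow> A \<otimes> (B \<otimes> C)\<close>.\<close>

definition tensor_assoc ::
  "('a, 'x) star_alg_scheme \<Rightarrow> ('b, 'y) star_alg_scheme \<Rightarrow> ('c, 'z) star_alg_scheme \<Rightarrow>
   (((('a \<times> 'b) \<Rightarrow>\<^sub>0 complex) set \<times> 'c) \<Rightarrow>\<^sub>0 complex) set \<Rightarrow>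
   (('a \<times> (('b \<times> 'c) \<Rightarrow>\<^sub>0 complex) set) \<Rightarrow>\<^sub>0 complex) set" where
  "tensor_assoc A B C =
     coset_ext (tensor A (tensor B C))
       (\<lambda>(t, z). coset_ext (tensor A (tensor B C))
          (\<lambda>(x, y). pure_tensor A (tensor B C) x (pure_tensor B C y z)) t)"

section \<open>Coactions and coideals\<close>

text \<open>A right coaction, compatible with the *-structures, of the bialgebra \<open>P\<close> with
  comultiplication \<open>D\<close> and counit \<open>e\<close>.\<close>

definition right_coaction ::
  "('b, 'x) star_alg_scheme \<Rightarrow> ('p, 'y) star_alg_scheme \<Rightarrow>
   ('p \<Rightarrow> (('p \<times> 'p) \<Rightarrow>\<^sub>0 complex) set) \<Rightarrow> ('p \<Rightarrow> complex) \<Rightarrow>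
   ('b \<Rightarrow> (('b \<times> 'p) \<Rightarrow>\<^sub>0 complex) set) \<Rightarrow> bool" where
  "right_coaction B P D e \<gamma> \<longleftrightarrow>
     star_hom B (tensor B P) \<gamma> \<and>
     (\<forall>x\<in>carrier B. tensor_assoc B P P (tensor_map (tensor B P) P \<gamma> id (\<gamma> x)) =
        tensor_map B (tensor P P) id D (\<gamma> x)) \<and>
     (\<forall>x\<in>carrier B. coset_ext B (\<lambda>(y, p). e p \<odot>\<^bsub>B\<^esub> y) (\<gamma> x) = x)"

text \<open>Here \<open>I \<otimes> P\<close> is regarded as a subspace of \<open>P \<otimes> P\<close>.\<close>

definition right_star_coideal ::
  "('p, 'y) star_alg_scheme \<Rightarrow> ('p \<Rightarrow> (('p \<times> 'p) \<Rightarrow>\<^sub>0 complex) set) \<Rightarrow> 'p set \<Rightarrow> bool" where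
  "right_star_coideal P D I \<longleftrightarrow> star_subalgebra I P \<and>
     D ` I \<subseteq> tensor_map P P id id ` carrier (tensor (P\<lparr>carrier := I\<rparr>) P)"

definition equivariantly_star_iso_to_coideal ::
  "('b, 'x) star_alg_scheme \<Rightarrow> ('p, 'y) star_alg_scheme \<Rightarrow>
   ('p \<Rightarrow> (('p \<times> 'p) \<Rightarrow>\<^sub>0 complex) set) \<Rightarrow> ('b \<Rightarrow> (('b \<times> 'p) \<Rightarrow>\<^sub>0 complex) set) \<Rightarrow> 'p set \<Rightarrow> bool" where
  "equivariantly_star_iso_to_coideal B P D \<gamma> I \<longleftrightarrow>
     (\<exists>\<pi>. star_hom B (P\<lparr>carrier := I\<rparr>) \<pi> \<and> bij_betw \<pi> (carrier B) I \<and>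
        (\<forall>x\<in>carrier B. tensor_map P P \<pi> id (\<gamma> x) = D (\<pi> x)))"

section \<open>The algebras \<open>U\<^sub>q(\<mu>,\<nu>)\<close>, \<open>A\<^sub>\<mu>\<^sub>\<nu>\<^sup>\<tau>\<close> and \<open>B\<^sub>\<mu>\<^sub>\<nu>\<^sup>\<tau>\<close>\<close>

datatype ugen = UK | UKinv | UE | UF

fun u_star :: "ugen \<Rightarrow> complex \<times> ugen" where
  "u_star UK = (1, UK)"
| "u_star UKinv = (1, UKinv)"
| "u_star UE = (1, UF)"
| "u_star UF = (1, UE)"

definition qlam :: "real \<Rightarrow> real" where
  "qlam q = inverse (q - inverse q)"

definition u_rels :: "real \<Rightarrow> real \<Rightarrow> real \<Rightarrow> (ugen list \<Rightarrow>\<^sub>0 complex) set" where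
  "u_rels q \<mu> \<nu> = (let m = (\<lambda>c w. Poly_Mapping.single w (complex_of_real c)) in
     {m 1 [UKinv, UK] - m 1 [], m 1 [UK, UKinv] - m 1 [],
      m 1 [UK, UE] - m q [UE, UK],
      m 1 [UK, UF] - m (inverse q) [UF, UK],
      m 1 [UE, UF] - m 1 [UF, UE]
        - (m (qlam q * \<mu>) [UK, UK] - m (qlam q * \<nu>) [UKinv, UKinv])})"

definition U_alg :: "real \<Rightarrow> real \<Rightarrow> real \<Rightarrow> (ugen list \<Rightarrow>\<^sub>0 complex) set star_alg" where
  "U_alg q \<mu> \<nu> = presented_alg u_star (u_rels q \<mu> \<nu>)"

definition u_gen :: "real \<Rightarrow> real \<Rightarrow> real \<Rightarrow> ugen \<Rightarrow> (ugen list \<Rightarrow>\<^sub>0 complex) set" where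
  "u_gen q \<mu> \<nu> = presented_gen u_star (u_rels q \<mu> \<nu>)"

definition Casimir :: "real \<Rightarrow> real \<Rightarrow> real \<Rightarrow> (ugen list \<Rightarrow>\<^sub>0 complex) set" where
  "Casimir q \<mu> \<nu> = (let U = U_alg q \<mu> \<nu>; K = u_gen q \<mu> \<nu> UK; K' = u_gen q \<mu> \<nu> UKinv;
       E = u_gen q \<mu> \<nu> UE; F = u_gen q \<mu> \<nu> UF in
     E \<otimes>\<^bsub>U\<^esub> F \<oplus>\<^bsub>U\<^esub>
       complex_of_real ((qlam q)\<^sup>2) \<odot>\<^bsub>U\<^esub>
         (complex_of_real (inverse q * \<mu>) \<odot>\<^bsub>U\<^esub> (K \<otimes>\<^bsub>U\<^esub> K) \<oplus>\<^bsub>U\<^esub>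
          complex_of_real (q * \<nu>) \<odot>\<^bsub>U\<^esub> (K' \<otimes>\<^bsub>U\<^esub> K')))"

definition A_ideal :: "real \<Rightarrow> real \<Rightarrow> real \<Rightarrow> real \<Rightarrow> (ugen list \<Rightarrow>\<^sub>0 complex) set set" where
  "A_ideal q \<mu> \<nu> \<tau> = (let U = U_alg q \<mu> \<nu> in
     Idl\<^bsub>U\<^esub> {Casimir q \<mu> \<nu> \<ominus>\<^bsub>U\<^esub> complex_of_real (\<tau> * inverse q * (qlam q)\<^sup>2) \<odot>\<^bsub>U\<^esub> \<one>\<^bsub>U\<^esub>})"

definition A_alg :: "real \<Rightarrow> real \<Rightarrow> real \<Rightarrow> real \<Rightarrow> (ugen list \<Rightarrow>\<^sub>0 complex) set set star_alg" where
  "A_alg q \<mu> \<nu> \<tau> = quot_alg (U_alg q \<mu> \<nu>) (A_ideal q \<mu> \<nu> \<tau>)"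

definition A_proj ::
  "real \<Rightarrow> real \<Rightarrow> real \<Rightarrow> real \<Rightarrow> (ugen list \<Rightarrow>\<^sub>0 complex) set \<Rightarrow> (ugen list \<Rightarrow>\<^sub>0 complex) set set" where
  "A_proj q \<mu> \<nu> \<tau> x = A_ideal q \<mu> \<nu> \<tau> +>\<^bsub>U_alg q \<mu> \<nu>\<^esub> x"

definition B_X :: "real \<Rightarrow> real \<Rightarrow> real \<Rightarrow> real \<Rightarrow> (ugen list \<Rightarrow>\<^sub>0 complex) set set" where
  "B_X q \<mu> \<nu> \<tau> = complex_of_real (sqrt q * (inverse q - q)) \<odot>\<^bsub>A_alg q \<mu> \<nu> \<tau>\<^esub>
     A_proj q \<mu> \<nu> \<tau> (u_gen q \<mu> \<nu> UF \<otimes>\<^bsub>U_alg q \<mu> \<nu>\<^esub> u_gen q \<mu> \<nu> UK)"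

definition B_Z :: "real \<Rightarrow> real \<Rightarrow> real \<Rightarrow> real \<Rightarrow> (ugen list \<Rightarrow>\<^sub>0 complex) set set" where
  "B_Z q \<mu> \<nu> \<tau> = A_proj q \<mu> \<nu> \<tau> (u_gen q \<mu> \<nu> UK \<otimes>\<^bsub>U_alg q \<mu> \<nu>\<^esub> u_gen q \<mu> \<nu> UK)"

definition B_alg :: "real \<Rightarrow> real \<Rightarrow> real \<Rightarrow> real \<Rightarrow> (ugen list \<Rightarrow>\<^sub>0 complex) set set star_alg" where
  "B_alg q \<mu> \<nu> \<tau> = (A_alg q \<mu> \<nu> \<tau>)\<lparr>carrier := generated_star_subalgebra (A_alg q \<mu> \<nu> \<tau>)
     {A_proj q \<mu> \<nu> \<tau> (u_gen q \<mu> \<nu> UK \<otimes>\<^bsub>U_alg q \<mu> \<nu>\<^esub> u_gen q \<mu> \<nu> UK),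
      A_proj q \<mu> \<nu> \<tau> (u_gen q \<mu> \<nu> UK \<otimes>\<^bsub>U_alg q \<mu> \<nu>\<^esub> u_gen q \<mu> \<nu> UE)}\<rparr>"

section \<open>The Hopf *-algebras \<open>Pol\<^sub>q(\<mu>)\<close>\<close>

text \<open>In \<open>Pol\<^sub>q(0)\<close> the generators \<open>Pc\<close> and \<open>Pd\<close> stand for \<open>b\<^sub>0\<^sup>*\<close> and \<open>a\<^sub>0\<^sup>*\<close>.\<close>

datatype pgen = Pa | Pb | Pc | Pd

text \<open>For \<open>\<mu> = \<plusminus>1\<close> one has \<open>b\<^sup>* = - \<mu> q\<^sup>-\<^sup>1 c\<close>, which forces \<open>c\<^sup>* = - \<mu> q b\<close>.\<close>

fun sl_star :: "real \<Rightarrow> real \<Rightarrow> pgen \<Rightarrow> complex \<times> pgen" where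
  "sl_star q \<mu> Pa = (1, Pd)"
| "sl_star q \<mu> Pb = (complex_of_real (- \<mu> * inverse q), Pc)"
| "sl_star q \<mu> Pc = (complex_of_real (- \<mu> * q), Pb)"
| "sl_star q \<mu> Pd = (1, Pa)"

fun zero_star :: "pgen \<Rightarrow> complex \<times> pgen" where
  "zero_star Pa = (1, Pd)"
| "zero_star Pb = (1, Pc)"
| "zero_star Pc = (1, Pb)"
| "zero_star Pd = (1, Pa)"

definition sl_rels :: "real \<Rightarrow> (pgen list \<Rightarrow>\<^sub>0 complex) set" where
  "sl_rels q = (let m = (\<lambda>c w. Poly_Mapping.single w (complex_of_real c)) in
     {m 1 [Pa, Pb] - m q [Pb, Pa], m 1 [Pa, Pc] - m q [Pc, Pa],
      m 1 [Pb, Pd] - m q [Pd, Pb], m 1 [Pc, Pd] - m q [Pd, Pc],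
      m 1 [Pb, Pc] - m 1 [Pc, Pb],
      m 1 [Pd, Pa] - m (inverse q) [Pc, Pb] - m 1 [],
      m 1 [Pa, Pd] - m q [Pb, Pc] - m 1 []})"

text \<open>The universal unital *-algebra is the universal unital algebra on the generators and their
  adjoints, subject to the relations and the adjoints of the relations.\<close>

definition zero_rels :: "real \<Rightarrow> (pgen list \<Rightarrow>\<^sub>0 complex) set" where
  "zero_rels q = (let m = (\<lambda>c w. Poly_Mapping.single w (complex_of_real c));
       R = {m 1 [Pd, Pa] - m 1 [], m 1 [Pa, Pd] - m 1 [],
            m 1 [Pa, Pb] - m q [Pb, Pa],
            m 1 [Pd, Pb] - m (inverse q) [Pb, Pd],
            m 1 [Pb, Pc] - m 1 [Pc, Pb]}
     in R \<union> star (free_alg zero_star) ` R)"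

definition pol_star :: "real \<Rightarrow> real \<Rightarrow> pgen \<Rightarrow> complex \<times> pgen" where
  "pol_star q \<mu> = (if \<mu> = 0 then zero_star else sl_star q \<mu>)"

definition pol_rels :: "real \<Rightarrow> real \<Rightarrow> (pgen list \<Rightarrow>\<^sub>0 complex) set" where
  "pol_rels q \<mu> = (if \<mu> = 0 then zero_rels q else sl_rels q)"

definition Pol :: "real \<Rightarrow> real \<Rightarrow> (pgen list \<Rightarrow>\<^sub>0 complex) set star_alg" where
  "Pol q \<mu> = presented_alg (pol_star q \<mu>) (pol_rels q \<mu>)"

definition pol_gen :: "real \<Rightarrow> real \<Rightarrow> pgen \<Rightarrow> (pgen list \<Rightarrow>\<^sub>0 complex) set" where
  "pol_gen q \<mu> = presented_gen (pol_star q \<mu>) (pol_rels q \<mu>)"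

definition Pol_comult_gen ::
  "real \<Rightarrow> real \<Rightarrow> pgen \<Rightarrow>
   (((pgen list \<Rightarrow>\<^sub>0 complex) set \<times> (pgen list \<Rightarrow>\<^sub>0 complex) set) \<Rightarrow>\<^sub>0 complex) set" where
  "Pol_comult_gen q \<mu> g = (let P = Pol q \<mu>; T = tensor P P;
       t = (\<lambda>x y. pure_tensor P P (pol_gen q \<mu> x) (pol_gen q \<mu> y)) in
     if \<mu> = 0 then
       (case g of
          Pa \<Rightarrow> t Pa Pa
        | Pb \<Rightarrow> t Pb Pa \<oplus>\<^bsub>T\<^esub> t Pd Pb
        | Pc \<Rightarrow> t Pc Pd \<oplus>\<^bsub>T\<^esub> t Pa Pc
        | Pd \<Rightarrow> t Pd Pd)
     else
       (case g of
          Pa \<Rightarrow> t Pa Pa \<oplus>\<^bsub>T\<^esub> t Pc Pb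
        | Pb \<Rightarrow> t Pb Pa \<oplus>\<^bsub>T\<^esub> t Pd Pb
        | Pc \<Rightarrow> t Pa Pc \<oplus>\<^bsub>T\<^esub> t Pc Pd
        | Pd \<Rightarrow> t Pb Pc \<oplus>\<^bsub>T\<^esub> t Pd Pd))"

definition Pol_comult ::
  "real \<Rightarrow> real \<Rightarrow> (pgen list \<Rightarrow>\<^sub>0 complex) set \<Rightarrow>
   (((pgen list \<Rightarrow>\<^sub>0 complex) set \<times> (pgen list \<Rightarrow>\<^sub>0 complex) set) \<Rightarrow>\<^sub>0 complex) set" where
  "Pol_comult q \<mu> = alg_hom_ext (tensor (Pol q \<mu>) (Pol q \<mu>)) (Pol_comult_gen q \<mu>)"

definition Pol_counit :: "(pgen list \<Rightarrow>\<^sub>0 complex) set \<Rightarrow> complex" where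
  "Pol_counit = alg_hom_ext complex_alg (\<lambda>g. if g \<in> {Pa, Pd} then 1 else 0)"

section \<open>The coaction on \<open>B\<^sub>\<mu>\<^sub>\<nu>\<^sup>\<tau>\<close>\<close>

definition gamma_X_value ::
  "real \<Rightarrow> real \<Rightarrow> real \<Rightarrow> real \<Rightarrow>
   (((ugen list \<Rightarrow>\<^sub>0 complex) set set \<times> (pgen list \<Rightarrow>\<^sub>0 complex) set) \<Rightarrow>\<^sub>0 complex) set" where
  "gamma_X_value q \<mu> \<nu> \<tau> = (let B = B_alg q \<mu> \<nu> \<tau>; P = Pol q \<mu>; T = tensor B P;
       X = B_X q \<mu> \<nu> \<tau>; Z = B_Z q \<mu> \<nu> \<tau>; a = pol_gen q \<mu> Pa; b = pol_gen q \<mu> Pb in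
     complex_of_real (- q * \<mu>) \<odot>\<^bsub>T\<^esub> pure_tensor B P (star B X) (b \<otimes>\<^bsub>P\<^esub> b) \<oplus>\<^bsub>T\<^esub>
     complex_of_real (- q * (1 + q\<^sup>2) * \<mu>) \<odot>\<^bsub>T\<^esub> pure_tensor B P Z (b \<otimes>\<^bsub>P\<^esub> a) \<oplus>\<^bsub>T\<^esub>
     pure_tensor B P X (a \<otimes>\<^bsub>P\<^esub> a) \<oplus>\<^bsub>T\<^esub>
     complex_of_real (q * \<tau>) \<odot>\<^bsub>T\<^esub> pure_tensor B P \<one>\<^bsub>B\<^esub> (b \<otimes>\<^bsub>P\<^esub> a))"

definition gamma_Z_value ::
  "real \<Rightarrow> real \<Rightarrow> real \<Rightarrow> real \<Rightarrow>
   (((ugen list \<Rightarrow>\<^sub>0 complex) set set \<times> (pgen list \<Rightarrow>\<^sub>0 complex) set) \<Rightarrow>\<^sub>0 complex) set" where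
  "gamma_Z_value q \<mu> \<nu> \<tau> = (let B = B_alg q \<mu> \<nu> \<tau>; P = Pol q \<mu>; T = tensor B P;
       X = B_X q \<mu> \<nu> \<tau>; Z = B_Z q \<mu> \<nu> \<tau>; a = pol_gen q \<mu> Pa; b = pol_gen q \<mu> Pb in
     pure_tensor B P (star B X) (star P a \<otimes>\<^bsub>P\<^esub> b) \<oplus>\<^bsub>T\<^esub>
     pure_tensor B P Z
       (\<one>\<^bsub>P\<^esub> \<ominus>\<^bsub>P\<^esub> complex_of_real ((1 + q\<^sup>2) * \<mu>) \<odot>\<^bsub>P\<^esub> (star P b \<otimes>\<^bsub>P\<^esub> b)) \<oplus>\<^bsub>T\<^esub>
     pure_tensor B P X (star P b \<otimes>\<^bsub>P\<^esub> a) \<oplus>\<^bsub>T\<^esub>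
     complex_of_real \<tau> \<odot>\<^bsub>T\<^esub> pure_tensor B P \<one>\<^bsub>B\<^esub> (star P b \<otimes>\<^bsub>P\<^esub> b))"

text \<open>On the carrier of \<^term>\<open>B_alg q \<mu> \<nu> \<tau>\<close> there is exactly one such \<open>\<gamma>\<close>.\<close>

definition is_gamma ::
  "real \<Rightarrow> real \<Rightarrow> real \<Rightarrow> real \<Rightarrow> ((ugen list \<Rightarrow>\<^sub>0 complex) set set \<Rightarrow>
     (((ugen list \<Rightarrow>\<^sub>0 complex) set set \<times> (pgen list \<Rightarrow>\<^sub>0 complex) set) \<Rightarrow>\<^sub>0 complex) set) \<Rightarrow> bool" where
  "is_gamma q \<mu> \<nu> \<tau> \<gamma> \<longleftrightarrow>
     right_coaction (B_alg q \<mu> \<nu> \<tau>) (Pol q \<mu>) (Pol_comult q \<mu>) Pol_counit \<gamma> \<and>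
     \<gamma> (B_X q \<mu> \<nu> \<tau>) = gamma_X_value q \<mu> \<nu> \<tau> \<and>
     \<gamma> (B_Z q \<mu> \<nu> \<tau>) = gamma_Z_value q \<mu> \<nu> \<tau>"

end

theory Submission
  imports Defs
begin

text \<open>An equivariant isomorphism \<open>\<pi>\<close> from \<open>B\<close> onto a coideal is determined by the *-character
  \<open>\<chi> = \<epsilon>\<pi>\<close>, because \<open>\<pi> = (\<chi> \<otimes> \<iota>)\<gamma>\<close>. From \<open>XZ = q\<^sup>2ZX\<close>, \<open>XX\<^sup>* = - q\<^sup>2\<nu> + q\<^sup>2\<tau>Z - q\<^sup>4\<mu>Z\<^sup>2\<close> and
  \<open>X\<^sup>*X = - q\<^sup>2\<nu> + \<tau>Z - \<mu>Z\<^sup>2\<close> it follows that either \<open>\<chi>(Z) = 0\<close> and \<open>|\<chi>(X)|\<^sup>2 = - q\<^sup>2\<nu>\<close>, or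
  \<open>\<chi>(X) = 0\<close> and \<open>\<tau> = (1 + q\<^sup>2)\<mu>\<chi>(Z)\<close>. In the second case, and in the first one if \<open>\<nu> = \<tau> = 0\<close>, the
  element \<open>(\<chi> \<otimes> \<iota>)\<gamma>(X)\<close> vanishes, while \<open>X \<noteq> 0\<close> in \<open>B\<close>.

  Conversely, for \<open>\<nu> \<le> 0\<close> a character with \<open>\<chi>(Z) = 0\<close> arises as a limit of matrix coefficients of a
  weighted shift representation of \<open>A\<close>, and \<open>(\<chi> \<otimes> \<iota>)\<gamma>\<close> is equivariant by coassociativity.
  Unless \<open>\<nu> = \<tau> = 0\<close>, it is injective because the monomials \<open>X\<^sup>kZ\<^sup>l\<close> and \<open>(X\<^sup>*)\<^sup>kZ\<^sup>l\<close> span \<open>B\<close>, and in a representation of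
  \<open>Pol\<^sub>q(\<mu>)\<close> on Laurent series in \<open>a\<close> and \<open>b\<close> their images have terms of lowest order in \<open>b\<close> at pairwise
  different places.\<close>

section \<open>Complex algebras\<close>

text \<open>No basis of \<open>B\<close> or of \<open>Pol q \<mu>\<close> is established. The
  monomials are shown only to span \<open>B\<close>; if their images are independent, then an
  element of the kernel has all coefficients zero, so one computation with operators replaces a
  basis theorem on either side. The coaction is given, so sufficiency reduces to producing a
  character. The obstacle in producing it is the star. In a *-representation with \<open>K\<close>
  diagonal, EF would be positive, but the Casimir relation dictates its diagonal entries, and these
  are negative at some places for some parameters; for \<nu> = 0 and \<tau> < 0 this happens exactly
  where \<open>Z\<close> tends to 0. Therefore \<open>A\<close> is represented on all two-sided
  sequences with weights for \<open>E\<close> chosen at will and compensating weights for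
  \<open>F\<close>, without regard to the star. The star is recovered in the limit, where the
  weights of \<open>X\<close> and of its adjoint are made to converge to the same real number.
  Cosets and carriers obstruct noncommutative calculation; this is the reason for the detour through
  a type class of real algebras.\<close>

locale complex_algebra = ring A for A :: "'a star_alg" (structure) +
  assumes smult_closed [simp, intro]: "x \<in> carrier A \<Longrightarrow> c \<odot> x \<in> carrier A"
    and smult_l_distr: "x \<in> carrier A \<Longrightarrow> (c + d) \<odot> x = c \<odot> x \<oplus> d \<odot> x"
    and smult_r_distr: "x \<in> carrier A \<Longrightarrow> y \<in> carrier A \<Longrightarrow> c \<odot> (x \<oplus> y) = c \<odot> x \<oplus> c \<odot> y"
    and smult_assoc: "x \<in> carrier A \<Longrightarrow> (c * d) \<odot> x = c \<odot> (d \<odot> x)"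
    and smult_one [simp]: "x \<in> carrier A \<Longrightarrow> 1 \<odot> x = x"
    and smult_mult_left: "x \<in> carrier A \<Longrightarrow> y \<in> carrier A \<Longrightarrow> (c \<odot> x) \<otimes> y = c \<odot> (x \<otimes> y)"
    and smult_mult_right: "x \<in> carrier A \<Longrightarrow> y \<in> carrier A \<Longrightarrow> x \<otimes> (c \<odot> y) = c \<odot> (x \<otimes> y)"
begin

lemma smult_zero_left [simp]: "x \<in> carrier A \<Longrightarrow> 0 \<odot> x = \<zero>"
  using smult_l_distr[of x 0 0] by simp

lemma smult_zero_right [simp]: "c \<odot> \<zero> = \<zero>"
  using smult_r_distr[of \<zero> \<zero> c] by simp

lemma smult_minus_left: "x \<in> carrier A \<Longrightarrow> (- c) \<odot> x = \<ominus> (c \<odot> x)"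
  using smult_l_distr[of x "- c" c] by (simp add: minus_equality)

lemma minus_eq_smult: "x \<in> carrier A \<Longrightarrow> \<ominus> x = (- 1) \<odot> x"
  by (simp add: smult_minus_left)

lemma smult_as_mult: "x \<in> carrier A \<Longrightarrow> c \<odot> x = (c \<odot> \<one>) \<otimes> x"
  by (simp add: smult_mult_left)

end

locale complex_star_algebra = complex_algebra A for A :: "'a star_alg" (structure) +
  assumes star_closed [simp, intro]: "x \<in> carrier A \<Longrightarrow> star A x \<in> carrier A"
    and star_add: "x \<in> carrier A \<Longrightarrow> y \<in> carrier A \<Longrightarrow> star A (x \<oplus> y) = star A x \<oplus> star A y"
    and star_smult: "x \<in> carrier A \<Longrightarrow> star A (c \<odot> x) = cnj c \<odot> star A x"
    and star_mult: "x \<in> carrier A \<Longrightarrow> y \<in> carrier A \<Longrightarrow> star A (x \<otimes> y) = star A y \<otimes> star A x"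
    and star_star [simp]: "x \<in> carrier A \<Longrightarrow> star A (star A x) = x"
begin

lemma star_zero [simp]: "star A \<zero> = \<zero>"
  using star_smult[of \<zero> 0] by simp

lemma star_one [simp]: "star A \<one> = \<one>"
proof -
  have "star A \<one> = star A (star A \<one>) \<otimes> star A \<one>"
    by simp
  also have "\<dots> = star A (\<one> \<otimes> star A \<one>)"
    by (subst star_mult) simp_all
  also have "\<dots> = \<one>"
    by simp
  finally show ?thesis .
qed

lemma star_a_minus: "x \<in> carrier A \<Longrightarrow> y \<in> carrier A \<Longrightarrow> star A (x \<ominus> y) = star A x \<ominus> star A y"
  by (simp add: a_minus_def minus_eq_smult star_add star_smult)

end

definition alg_hom :: "'a star_alg \<Rightarrow> 'b star_alg \<Rightarrow> ('a \<Rightarrow> 'b) \<Rightarrow> bool" where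
  "alg_hom A B f \<longleftrightarrow> f \<in> ring_hom A B \<and> (\<forall>c. \<forall>x\<in>carrier A. f (c \<odot>\<^bsub>A\<^esub> x) = c \<odot>\<^bsub>B\<^esub> f x)"

lemma star_hom_iff_alg_hom:
  "star_hom A B f \<longleftrightarrow> alg_hom A B f \<and> (\<forall>x\<in>carrier A. f (star A x) = star B (f x))"
  by (auto simp: star_hom_def alg_hom_def)

lemma alg_homI:
  assumes "\<And>x. x \<in> carrier A \<Longrightarrow> f x \<in> carrier B"
    and "\<And>x y. x \<in> carrier A \<Longrightarrow> y \<in> carrier A \<Longrightarrow> f (x \<otimes>\<^bsub>A\<^esub> y) = f x \<otimes>\<^bsub>B\<^esub> f y"
    and "\<And>x y. x \<in> carrier A \<Longrightarrow> y \<in> carrier A \<Longrightarrow> f (x \<oplus>\<^bsub>A\<^esub> y) = f x \<oplus>\<^bsub>B\<^esub> f y"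
    and "f \<one>\<^bsub>A\<^esub> = \<one>\<^bsub>B\<^esub>"
    and "\<And>c x. x \<in> carrier A \<Longrightarrow> f (c \<odot>\<^bsub>A\<^esub> x) = c \<odot>\<^bsub>B\<^esub> f x"
  shows "alg_hom A B f"
  using assms by (auto simp: alg_hom_def ring_hom_def)

lemma alg_homD:
  assumes "alg_hom A B f"
  shows "x \<in> carrier A \<Longrightarrow> f x \<in> carrier B"
    and "x \<in> carrier A \<Longrightarrow> y \<in> carrier A \<Longrightarrow> f (x \<otimes>\<^bsub>A\<^esub> y) = f x \<otimes>\<^bsub>B\<^esub> f y"
    and "x \<in> carrier A \<Longrightarrow> y \<in> carrier A \<Longrightarrow> f (x \<oplus>\<^bsub>A\<^esub> y) = f x \<oplus>\<^bsub>B\<^esub> f y"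
    and "f \<one>\<^bsub>A\<^esub> = \<one>\<^bsub>B\<^esub>"
    and "x \<in> carrier A \<Longrightarrow> f (c \<odot>\<^bsub>A\<^esub> x) = c \<odot>\<^bsub>B\<^esub> f x"
  using assms by (auto simp: alg_hom_def ring_hom_def)

lemma alg_hom_more:
  assumes "alg_hom A B f" "complex_algebra A" "complex_algebra B"
  shows "f \<zero>\<^bsub>A\<^esub> = \<zero>\<^bsub>B\<^esub>"
    and "x \<in> carrier A \<Longrightarrow> f (\<ominus>\<^bsub>A\<^esub> x) = \<ominus>\<^bsub>B\<^esub> f x"
    and "x \<in> carrier A \<Longrightarrow> y \<in> carrier A \<Longrightarrow> f (x \<ominus>\<^bsub>A\<^esub> y) = f x \<ominus>\<^bsub>B\<^esub> f y"
proof -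
  interpret A: complex_algebra A by fact
  interpret B: complex_algebra B by fact
  note hom = alg_homD[OF assms(1)]
  show z: "f \<zero>\<^bsub>A\<^esub> = \<zero>\<^bsub>B\<^esub>"
    using hom(5)[of "\<zero>\<^bsub>A\<^esub>" 0] hom(1)[of "\<zero>\<^bsub>A\<^esub>"] by simp
  show m: "f (\<ominus>\<^bsub>A\<^esub> x) = \<ominus>\<^bsub>B\<^esub> f x" if "x \<in> carrier A" for x
    using that hom by (simp add: A.minus_eq_smult B.minus_eq_smult)
  show "f (x \<ominus>\<^bsub>A\<^esub> y) = f x \<ominus>\<^bsub>B\<^esub> f y" if "x \<in> carrier A" "y \<in> carrier A"
    using that hom by (simp add: a_minus_def m)
qed

lemma alg_hom_comp:
  "alg_hom A B f \<Longrightarrow> alg_hom B C g \<Longrightarrow> alg_hom A C (\<lambda>x. g (f x))"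
  by (intro alg_homI) (simp_all add: alg_homD)

lemma alg_hom_id: "alg_hom A A (\<lambda>x. x)"
  by (intro alg_homI) simp_all

text \<open>Every axiom is an identity or, for negatives, an existence statement, and both pass to
  surjective images; quotients by ideals are the application. The zero is a separate hypothesis
  because it follows from \<open>alg_hom\<close> only once \<open>B\<close> is known to be an
  algebra.\<close>

lemma complex_algebra_surj_image:
  fixes A :: "'a star_alg" and B :: "'b star_alg"
  assumes "complex_algebra A" and f: "alg_hom A B f" and surj: "carrier B = f ` carrier A"
    and zero: "\<zero>\<^bsub>B\<^esub> = f \<zero>\<^bsub>A\<^esub>"
  shows "complex_algebra B"
proof -
  interpret A: complex_algebra A by fact
  note h = alg_homD(2,3,5)[OF f, symmetric] alg_homD(4)[OF f, symmetric]
  have "ring B"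
  proof (rule ringI)
    show "abelian_group B"
    proof (rule abelian_groupI)
      fix x assume "x \<in> carrier B"
      then obtain y where y: "y \<in> carrier A" "x = f y" by (auto simp: surj)
      then show "\<exists>z\<in>carrier B. z \<oplus>\<^bsub>B\<^esub> x = \<zero>\<^bsub>B\<^esub>"
        by (intro bexI[of _ "f (\<ominus>\<^bsub>A\<^esub> y)"]) (auto simp: surj h zero A.l_neg)
    qed (auto simp: surj h zero A.a_ac)
    show "Group.monoid B"
      by (rule Group.monoidI) (auto simp: surj h A.m_assoc)
  qed (auto simp: surj h A.l_distr A.r_distr)
  then show ?thesis
    unfolding complex_algebra_def complex_algebra_axioms_def
    by (auto simp: surj h A.smult_l_distr A.smult_r_distr A.smult_assoc A.smult_mult_left
        A.smult_mult_right)
qed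

lemma complex_star_algebra_surj_image:
  assumes "complex_star_algebra A" and "complex_algebra B" and f: "alg_hom A B f"
    and surj: "carrier B = f ` carrier A"
    and star: "\<And>x. x \<in> carrier A \<Longrightarrow> star B (f x) = f (star A x)"
  shows "complex_star_algebra B"
proof -
  interpret A: complex_star_algebra A by fact
  note h = alg_homD(2,3,5)[OF f, symmetric] alg_homD(4)[OF f, symmetric]
  show ?thesis
    using assms(2) unfolding complex_star_algebra_def complex_star_algebra_axioms_def
    by (auto simp: surj h star A.star_add A.star_smult A.star_mult)
qed

lemma complex_star_algebra_subalgebra:
  assumes "complex_star_algebra A" and "star_subalgebra H A"
  shows "complex_star_algebra (A\<lparr>carrier := H\<rparr>)"
proof -
  interpret A: complex_star_algebra A by fact
  have H: "subring H A" "\<And>c x. x \<in> H \<Longrightarrow> c \<odot>\<^bsub>A\<^esub> x \<in> H" "\<And>x. x \<in> H \<Longrightarrow> star A x \<in> H"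
    using assms(2) by (auto simp: star_subalgebra_def)
  then have sub: "x \<in> carrier A" if "x \<in> H" for x
    using that subringE(1) by blast
  show ?thesis
    using A.subring_is_ring[OF H(1)]
    unfolding complex_star_algebra_def complex_star_algebra_axioms_def complex_algebra_def
      complex_algebra_axioms_def
    by (auto simp: H(2,3) sub A.smult_l_distr A.smult_r_distr A.smult_assoc A.smult_mult_left
        A.smult_mult_right A.star_add A.star_smult A.star_mult)
qed

lemma star_subalgebra_generated:
  assumes "complex_star_algebra A" and "S \<subseteq> carrier A"
  shows "star_subalgebra (generated_star_subalgebra A S) A"
    and "S \<subseteq> generated_star_subalgebra A S"
proof -
  interpret A: complex_star_algebra A by fact
  have "star_subalgebra (carrier A) A"
    by (auto simp: star_subalgebra_def A.carrier_is_subring)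
  then have ne: "{H. star_subalgebra H A \<and> S \<subseteq> H} \<noteq> {}"
    using assms(2) by blast
  show "star_subalgebra (generated_star_subalgebra A S) A"
    unfolding star_subalgebra_def
  proof (intro conjI)
    show "subring (generated_star_subalgebra A S) A"
      unfolding generated_star_subalgebra_def
      by (rule A.subring_Inter[OF _ ne]) (simp add: star_subalgebra_def)
  qed (auto simp: generated_star_subalgebra_def star_subalgebra_def)
  show "S \<subseteq> generated_star_subalgebra A S"
    by (auto simp: generated_star_subalgebra_def)
qed

lemma complex_star_algebra_complex_alg: "complex_star_algebra complex_alg"
proof -
  have "ring complex_alg"
    by (rule ringI, rule abelian_groupI, rule_tac [7] Group.monoidI)
      (auto simp: complex_alg_def algebra_simps intro: exI[of _ "- x" for x])
  then show ?thesis
    unfolding complex_star_algebra_def complex_star_algebra_axioms_def complex_algebra_def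
      complex_algebra_axioms_def
    by (auto simp: complex_alg_def algebra_simps)
qed

section \<open>Noncommutative computations in the type class of real algebras\<close>

text \<open>The product of all complex algebras on a given type is a type with a real algebra structure,
  into which each algebra embeds as a factor. This makes the simplifier's normalisation for type
  classes available for identities in an algebra given by a carrier. The embedding maps the unit to a
  central idempotent.\<close>

typedef (overloaded) 'a algebra_family =
  "{f :: 'a star_alg \<Rightarrow> 'a. \<forall>A. if complex_algebra A then f A \<in> carrier A else f A = undefined}"
proof
  show "(\<lambda>A. if complex_algebra A then \<zero>\<^bsub>A\<^esub> else undefined) \<in>
    {f :: 'a star_alg \<Rightarrow> 'a. \<forall>A. if complex_algebra A then f A \<in> carrier A else f A = undefined}"
    by (auto simp: complex_algebra_def ring.ring_simprules)
qed

setup_lifting type_definition_algebra_family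

lemma algebra_family_eqI:
  assumes "\<forall>A. if complex_algebra A then f A \<in> carrier A else f A = undefined"
    and "\<forall>A. if complex_algebra A then g A \<in> carrier A else g A = undefined"
    and "\<And>A. complex_algebra A \<Longrightarrow> f A = g A"
  shows "f = g"
  using assms by (intro ext) metis

instantiation algebra_family :: (type) real_algebra
begin

lift_definition zero_algebra_family :: "'a algebra_family" is
  "\<lambda>A. if complex_algebra A then \<zero>\<^bsub>A\<^esub> else undefined"
  by (auto simp: complex_algebra_def ring.ring_simprules)

lift_definition plus_algebra_family :: "'a algebra_family \<Rightarrow> 'a algebra_family \<Rightarrow> 'a algebra_family"
  is "\<lambda>f g A. if complex_algebra A then f A \<oplus>\<^bsub>A\<^esub> g A else undefined"
  by (auto simp: complex_algebra_def ring.ring_simprules)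

lift_definition minus_algebra_family :: "'a algebra_family \<Rightarrow> 'a algebra_family \<Rightarrow> 'a algebra_family"
  is "\<lambda>f g A. if complex_algebra A then f A \<ominus>\<^bsub>A\<^esub> g A else undefined"
  by (auto simp: complex_algebra_def ring.ring_simprules)

lift_definition uminus_algebra_family :: "'a algebra_family \<Rightarrow> 'a algebra_family"
  is "\<lambda>f A. if complex_algebra A then \<ominus>\<^bsub>A\<^esub> f A else undefined"
  by (auto simp: complex_algebra_def ring.ring_simprules)

lift_definition times_algebra_family :: "'a algebra_family \<Rightarrow> 'a algebra_family \<Rightarrow> 'a algebra_family"
  is "\<lambda>f g A. if complex_algebra A then f A \<otimes>\<^bsub>A\<^esub> g A else undefined"
  by (auto simp: complex_algebra_def ring.ring_simprules)

lift_definition scaleR_algebra_family :: "real \<Rightarrow> 'a algebra_family \<Rightarrow> 'a algebra_family"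
  is "\<lambda>r f A. if complex_algebra A then complex_of_real r \<odot>\<^bsub>A\<^esub> f A else undefined"
  by (auto simp: complex_algebra.smult_closed)

instance
proof
  fix f g h :: "'a algebra_family" and r s :: real
  note ring = complex_algebra.axioms(1)
  note closed = complex_algebra.smult_closed ring.ring_simprules(1-6)[OF ring]
  show "f + g + h = f + (g + h)"
    by transfer (rule algebra_family_eqI; simp add: closed ring.ring_simprules(7)[OF ring])
  show "f + g = g + f"
    by transfer (rule algebra_family_eqI; simp add: closed ring.ring_simprules(10)[OF ring])
  show "0 + f = f"
    by transfer (rule algebra_family_eqI; simp add: closed ring.ring_simprules(8)[OF ring])
  show "- f + f = 0"
    by transfer (rule algebra_family_eqI; simp add: closed ring.ring_simprules(9)[OF ring])
  show "f - g = f + - g"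
    by transfer (rule algebra_family_eqI; simp add: closed a_minus_def)
  show "f * g * h = f * (g * h)"
    by transfer (rule algebra_family_eqI; simp add: closed ring.ring_simprules(11)[OF ring])
  show "(f + g) * h = f * h + g * h"
    by transfer (rule algebra_family_eqI; simp add: closed ring.ring_simprules(13)[OF ring])
  show "f * (g + h) = f * g + f * h"
    by transfer (rule algebra_family_eqI; simp add: closed ring.ring_simprules(23)[OF ring])
  show "r *\<^sub>R (f + g) = r *\<^sub>R f + r *\<^sub>R g"
    by transfer (rule algebra_family_eqI; simp add: closed complex_algebra.smult_r_distr)
  show "(r + s) *\<^sub>R f = r *\<^sub>R f + s *\<^sub>R f"
    by transfer (rule algebra_family_eqI; simp add: closed complex_algebra.smult_l_distr)
  show "r *\<^sub>R s *\<^sub>R f = (r * s) *\<^sub>R f"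
    by transfer (rule algebra_family_eqI; simp add: closed complex_algebra.smult_assoc)
  show "1 *\<^sub>R f = f"
    by transfer (rule algebra_family_eqI; simp add: closed complex_algebra.smult_one)
  show "r *\<^sub>R f * g = r *\<^sub>R (f * g)"
    by transfer (rule algebra_family_eqI; simp add: closed complex_algebra.smult_mult_left)
  show "f * r *\<^sub>R g = r *\<^sub>R (f * g)"
    by transfer (rule algebra_family_eqI; simp add: closed complex_algebra.smult_mult_right)
qed

end

text \<open>Being zero in all other factors makes the map respect sums, products and real scalars.
  Since the unit of \<open>A\<close> does not become a unit of the whole type, identities proved
  there name its image explicitly (\<open>i\<close> or \<open>e\<close>) and assume its unit
  laws.\<close>

lift_definition in_family :: "'a star_alg \<Rightarrow> 'a \<Rightarrow> 'a algebra_family" is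
  "\<lambda>A x A'. if complex_algebra A' then if A' = A \<and> x \<in> carrier A then x else \<zero>\<^bsub>A'\<^esub> else undefined"
  by (auto simp: complex_algebra_def ring.ring_simprules)

context complex_algebra
begin

lemma in_family_inject:
  assumes "x \<in> carrier A" "y \<in> carrier A" "in_family A x = in_family A y"
  shows "x = y"
proof -
  have "Rep_algebra_family (in_family A x) A = Rep_algebra_family (in_family A y) A"
    using assms(3) by simp
  then show ?thesis
    using assms(1,2) complex_algebra_axioms by (simp add: in_family.rep_eq)
qed

lemma in_family_hom:
  assumes "x \<in> carrier A"
  shows "y \<in> carrier A \<Longrightarrow> in_family A (x \<oplus> y) = in_family A x + in_family A y"
    and "y \<in> carrier A \<Longrightarrow> in_family A (x \<ominus> y) = in_family A x - in_family A y"
    and "y \<in> carrier A \<Longrightarrow> in_family A (x \<otimes> y) = in_family A x * in_family A y"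
    and "in_family A (complex_of_real r \<odot> x) = r *\<^sub>R in_family A x"
    and "in_family A (\<ominus> x) = - in_family A x"
proof -
  note ring = complex_algebra.axioms(1)
  note simps = complex_algebra.smult_closed ring.ring_simprules(1-6,8)[OF ring]
    ring.ring_simprules(21,24,25)[OF ring] complex_algebra.smult_zero_right a_minus_def
  note ax = complex_algebra_axioms
  show "y \<in> carrier A \<Longrightarrow> in_family A (x \<oplus> y) = in_family A x + in_family A y"
    using assms ax by (transfer; intro ext) (auto simp: simps)
  show "y \<in> carrier A \<Longrightarrow> in_family A (x \<ominus> y) = in_family A x - in_family A y"
    using assms ax by (transfer; intro ext) (auto simp: simps)
  show "y \<in> carrier A \<Longrightarrow> in_family A (x \<otimes> y) = in_family A x * in_family A y"
    using assms ax by (transfer; intro ext) (auto simp: simps)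
  show "in_family A (complex_of_real r \<odot> x) = r *\<^sub>R in_family A x"
    using assms ax by (transfer; intro ext) (auto simp: simps)
  show "in_family A (\<ominus> x) = - in_family A x"
    using assms ax by (transfer; intro ext) (auto simp: simps)
qed

lemma in_family_eq_iff:
  "x \<in> carrier A \<Longrightarrow> y \<in> carrier A \<Longrightarrow> in_family A x = in_family A y \<longleftrightarrow> x = y"
  using in_family_inject by blast

lemma in_family_zero: "in_family A \<zero> = 0"
  by (transfer; intro ext) auto

lemmas in_family_simps = in_family_hom in_family_zero

end

section \<open>Monoid algebras\<close>

abbreviation "keys \<equiv> Poly_Mapping.keys"
abbreviation "lookup \<equiv> Poly_Mapping.lookup"
abbreviation "single \<equiv> Poly_Mapping.single"
abbreviation scale :: "complex \<Rightarrow> ('m \<Rightarrow>\<^sub>0 complex) \<Rightarrow> 'm \<Rightarrow>\<^sub>0 complex" where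
  "scale c \<equiv> Poly_Mapping.map ((*) c)"

lemma lookup_map_times [simp]:
  "lookup (scale c p) k = c * lookup p k"
  for c :: complex
  by (simp add: Poly_Mapping.map.rep_eq when_def)

lemma map_times_single [simp]:
  "scale c (single m d) = single m (c * d)"
  for c :: complex
  by (rule poly_mapping_eqI) (simp add: lookup_single when_def)

lemma map_times_add:
  "scale c (p + r) = scale c p + scale c r"
  for c :: complex
  by (rule poly_mapping_eqI) (simp add: lookup_add algebra_simps)

lemma map_times_zero [simp]: "scale c 0 = 0" for c :: complex
  by (rule poly_mapping_eqI) simp

text \<open>Reduces linear and multilinear identities to basis elements. Zero is a separate case
  because \<open>S\<close> may be empty; the support bounds in the case of sums are needed because
  carriers are given by conditions on supports.\<close>

lemma poly_mapping_span_induct [consumes 1, case_names zero single add]: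
  fixes p :: "'m \<Rightarrow>\<^sub>0 complex"
  assumes "keys p \<subseteq> S" and "P 0" and single: "\<And>m c. m \<in> S \<Longrightarrow> P (single m c)"
    and add: "\<And>p r. keys p \<subseteq> S \<Longrightarrow> keys r \<subseteq> S \<Longrightarrow> P p \<Longrightarrow> P r \<Longrightarrow> P (p + r)"
  shows "P p"
proof -
  define f where "f = (\<lambda>m. single m (lookup p m))"
  have p: "p = sum f (keys p)"
    by (rule poly_mapping_eqI) (simp add: f_def lookup_sum lookup_single when_def in_keys_iff)
  have "finite T \<Longrightarrow> T \<subseteq> S \<Longrightarrow> P (sum f T) \<and> keys (sum f T) \<subseteq> S" for T
  proof (induction T rule: finite_induct)
    case (insert m T)
    moreover have "keys (f m) \<subseteq> S"
      using insert.prems by (auto simp: f_def)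
    ultimately show ?case
      using keys_add[of "f m" "sum f T"] single[of m] add[of "f m" "sum f T"] by (auto simp: f_def)
  qed (simp add: \<open>P 0\<close>)
  from this[OF finite_keys assms(1)] show ?thesis
    using p by simp
qed

lemma monoid_alg_simps:
  "carrier (monoid_alg M s) = {p. keys p \<subseteq> carrier M}"
  "\<one>\<^bsub>monoid_alg M s\<^esub> = single \<one>\<^bsub>M\<^esub> 1"
  "\<zero>\<^bsub>monoid_alg M s\<^esub> = 0"
  "p \<oplus>\<^bsub>monoid_alg M s\<^esub> r = p + r"
  "c \<odot>\<^bsub>monoid_alg M s\<^esub> p = scale c p"
  by (simp_all add: monoid_alg_def)

text \<open>The defining double sum runs over the supports, which change under addition. Over fixed
  larger finite sets, additivity and homogeneity hold term by term.\<close>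

lemma monoid_alg_mult_superset:
  assumes "finite S" "keys p \<subseteq> S" "finite T" "keys r \<subseteq> T"
  shows "p \<otimes>\<^bsub>monoid_alg M s\<^esub> r = (\<Sum>x\<in>S. \<Sum>y\<in>T.
    single (x \<otimes>\<^bsub>M\<^esub> y) (lookup p x * lookup r y))"
proof -
  have "p \<otimes>\<^bsub>monoid_alg M s\<^esub> r = (\<Sum>x\<in>keys p. \<Sum>y\<in>T.
    single (x \<otimes>\<^bsub>M\<^esub> y) (lookup p x * lookup r y))"
    unfolding monoid_alg_def
    by (simp, intro sum.cong[OF refl] sum.mono_neutral_left) (auto simp: assms in_keys_iff)
  also have "\<dots> = (\<Sum>x\<in>S. \<Sum>y\<in>T.
    single (x \<otimes>\<^bsub>M\<^esub> y) (lookup p x * lookup r y))"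
    by (auto intro!: sum.mono_neutral_left assms simp: in_keys_iff)
  finally show ?thesis .
qed

lemma monoid_alg_mult_single [simp]:
  "single x c \<otimes>\<^bsub>monoid_alg M s\<^esub> single y d =
    single (x \<otimes>\<^bsub>M\<^esub> y) (c * d)"
  by (simp add: monoid_alg_mult_superset[of "{x}" _ "{y}"])

lemma monoid_alg_mult_zero [simp]:
  "0 \<otimes>\<^bsub>monoid_alg M s\<^esub> p = 0" "p \<otimes>\<^bsub>monoid_alg M s\<^esub> 0 = 0"
  by (simp_all add: monoid_alg_def)

lemma monoid_alg_mult_add_left:
  "(p + p') \<otimes>\<^bsub>monoid_alg M s\<^esub> r = p \<otimes>\<^bsub>monoid_alg M s\<^esub> r + p' \<otimes>\<^bsub>monoid_alg M s\<^esub> r"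
proof -
  note eq = monoid_alg_mult_superset[of "keys p \<union> keys p'" _
    "keys r"]
  show ?thesis
    using keys_add[of p p']
    by (simp add: eq lookup_add distrib_right single_add sum.distrib)
qed

lemma monoid_alg_mult_add_right:
  "r \<otimes>\<^bsub>monoid_alg M s\<^esub> (p + p') = r \<otimes>\<^bsub>monoid_alg M s\<^esub> p + r \<otimes>\<^bsub>monoid_alg M s\<^esub> p'"
proof -
  note eq = monoid_alg_mult_superset[of "keys r" _
    "keys p \<union> keys p'"]
  show ?thesis
    using keys_add[of p p']
    by (simp add: eq lookup_add distrib_left single_add sum.distrib)
qed

lemmas monoid_alg_mult_add = monoid_alg_mult_add_left monoid_alg_mult_add_right

lemma complex_algebra_monoid_alg:
  fixes M :: "('m, 'x) monoid_scheme"
  assumes "Group.monoid M"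
  shows "complex_algebra (monoid_alg M s)"
proof -
  interpret M: Group.monoid M by fact
  let ?A = "monoid_alg M s"
  have closed: "keys (p \<otimes>\<^bsub>?A\<^esub> r) \<subseteq> carrier M"
    if "keys p \<subseteq> carrier M" "keys r \<subseteq> carrier M" for p r
    using that
  proof (induction p rule: poly_mapping_span_induct)
    case (single x c)
    from single(2) show ?case
      by (induction r rule: poly_mapping_span_induct)
        (use single(1) in \<open>auto simp: monoid_alg_mult_add dest!: subsetD[OF keys_add]\<close>)
  qed (auto simp: monoid_alg_mult_add dest!: subsetD[OF keys_add])
  have assoc: "p \<otimes>\<^bsub>?A\<^esub> r \<otimes>\<^bsub>?A\<^esub> t = p \<otimes>\<^bsub>?A\<^esub> (r \<otimes>\<^bsub>?A\<^esub> t)"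
    if "keys p \<subseteq> carrier M" "keys r \<subseteq> carrier M"
      "keys t \<subseteq> carrier M" for p r t
    using that
  proof (induction p rule: poly_mapping_span_induct)
    case (single x c)
    from single(2,3,1) show ?case
    proof (induction r rule: poly_mapping_span_induct)
      case (single y d)
      from single(2,1,3) show ?case
        by (induction t rule: poly_mapping_span_induct) (auto simp: monoid_alg_mult_add M.m_assoc mult.assoc)
    qed (auto simp: monoid_alg_mult_add)
  qed (auto simp: monoid_alg_mult_add)
  have one: "single \<one>\<^bsub>M\<^esub> 1 \<otimes>\<^bsub>?A\<^esub> p = p" "p \<otimes>\<^bsub>?A\<^esub> single \<one>\<^bsub>M\<^esub> 1 = p"
    if "keys p \<subseteq> carrier M" for p
    using that by (induction p rule: poly_mapping_span_induct) (auto simp: monoid_alg_mult_add)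
  have smult: "scale c p \<otimes>\<^bsub>?A\<^esub> r = scale c (p \<otimes>\<^bsub>?A\<^esub> r)"
    "p \<otimes>\<^bsub>?A\<^esub> scale c r = scale c (p \<otimes>\<^bsub>?A\<^esub> r)"
    for c p r
  proof -
    have keys: "keys (scale c t) \<subseteq> keys t" for t :: "'m \<Rightarrow>\<^sub>0 complex"
      by (auto simp: in_keys_iff)
    have sum: "scale c (sum f S) = (\<Sum>i\<in>S. scale c (f i))"
      for f :: "'m \<Rightarrow> 'm \<Rightarrow>\<^sub>0 complex" and S
      by (rule poly_mapping_eqI) (simp add: lookup_sum sum_distrib_left)
    note eq = monoid_alg_mult_superset[of "keys p" _ "keys r"]
    show "scale c p \<otimes>\<^bsub>?A\<^esub> r = scale c (p \<otimes>\<^bsub>?A\<^esub> r)"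
      using keys[of p] by (simp add: eq sum mult_ac)
    show "p \<otimes>\<^bsub>?A\<^esub> scale c r = scale c (p \<otimes>\<^bsub>?A\<^esub> r)"
      using keys[of r] by (simp add: eq sum mult_ac)
  qed
  have neg: "\<exists>r. keys r \<subseteq> carrier M \<and> p + r = 0"
    if "keys p \<subseteq> carrier M" for p :: "'m \<Rightarrow>\<^sub>0 complex"
    using that by (intro exI[of _ "- p"]) simp
  have "ring ?A"
  proof (rule ringI)
    show "abelian_group ?A"
      by (rule abelian_groupI)
        (auto simp: monoid_alg_simps add_ac neg dest!: subsetD[OF keys_add])
    show "Group.monoid ?A"
      by (rule Group.monoidI) (simp_all add: monoid_alg_simps assoc one closed)
  qed (auto simp: monoid_alg_simps monoid_alg_mult_add)
  then show ?thesis
    unfolding complex_algebra_def complex_algebra_axioms_def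
    by (auto simp: monoid_alg_simps smult in_keys_iff intro!: poly_mapping_eqI)
      (auto simp: lookup_add algebra_simps)
qed

lemma monoid_alg_minus:
  assumes "Group.monoid M" "keys r \<subseteq> carrier M"
  shows "p \<ominus>\<^bsub>monoid_alg M s\<^esub> r = p - r"
proof -
  interpret complex_algebra "monoid_alg M s"
    by (rule complex_algebra_monoid_alg) fact
  have "r \<in> carrier (monoid_alg M s)"
    using assms(2) by (simp add: monoid_alg_simps)
  then show ?thesis
    by (auto simp: a_minus_def minus_eq_smult)
      (auto simp: monoid_alg_simps lookup_add lookup_minus intro!: poly_mapping_eqI)
qed

lemma monoid_alg_star_superset:
  assumes "finite S" "keys p \<subseteq> S"
  shows "star (monoid_alg M s) p =
    (\<Sum>x\<in>S. scale (cnj (lookup p x)) (s x))"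
  unfolding monoid_alg_def
  by (simp, intro sum.mono_neutral_left)
    (auto simp: assms in_keys_iff intro: poly_mapping_eqI)

lemma monoid_alg_star_simps [simp]:
  "star (monoid_alg M s) 0 = 0"
  "star (monoid_alg M s) (single x c) = scale (cnj c) (s x)"
  by (simp_all add: monoid_alg_star_superset[of "{}"] monoid_alg_star_superset[of "{x}"])

lemma monoid_alg_star_add:
  "star (monoid_alg M s) (p + r) = star (monoid_alg M s) p + star (monoid_alg M s) r"
proof -
  have "scale (c + d) t = scale c t + scale d t"
    for c d :: complex and t :: "'a \<Rightarrow>\<^sub>0 complex"
    by (rule poly_mapping_eqI) (simp add: lookup_add algebra_simps)
  then show ?thesis
    using keys_add[of p r]
    by (simp add: monoid_alg_star_superset[of "keys p \<union> keys r"]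
        lookup_add sum.distrib)
qed

lemma monoid_alg_star_diff:
  "star (monoid_alg M s) (p - r) = star (monoid_alg M s) p - star (monoid_alg M s) r"
  using monoid_alg_star_add[of M s "p - r" r] by (simp add: algebra_simps)

text \<open>The operation sends the basis element \<open>m\<close> to \<open>\<kappa> m\<close>
  times \<open>\<sigma> m\<close>. Being conjugate linear, it returns \<open>m\<close> with the
  factor \<open>cnj (\<kappa> m) * \<kappa> (\<sigma> m)\<close> when applied twice, which explains
  the last condition.\<close>

lemma complex_star_algebra_monoid_alg:
  fixes M :: "('m, 'x) monoid_scheme"
  assumes "Group.monoid M" and s: "s = (\<lambda>m. single (\<sigma> m) (\<kappa> m))"
    and \<sigma>: "\<And>x. x \<in> carrier M \<Longrightarrow> \<sigma> x \<in> carrier M"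
    "\<And>x y. x \<in> carrier M \<Longrightarrow> y \<in> carrier M \<Longrightarrow> \<sigma> (x \<otimes>\<^bsub>M\<^esub> y) = \<sigma> y \<otimes>\<^bsub>M\<^esub> \<sigma> x"
    "\<And>x. x \<in> carrier M \<Longrightarrow> \<sigma> (\<sigma> x) = x"
    and \<kappa>: "\<And>x y. x \<in> carrier M \<Longrightarrow> y \<in> carrier M \<Longrightarrow> \<kappa> (x \<otimes>\<^bsub>M\<^esub> y) = \<kappa> y * \<kappa> x"
    "\<And>x. x \<in> carrier M \<Longrightarrow> cnj (\<kappa> x) * \<kappa> (\<sigma> x) = 1"
  shows "complex_star_algebra (monoid_alg M s)"
proof -
  let ?A = "monoid_alg M s"
  interpret complex_algebra ?A
    by (rule complex_algebra_monoid_alg) fact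
  note mem = monoid_alg_simps(1)
  have closed: "star ?A p \<in> carrier ?A" if "p \<in> carrier ?A" for p
    using that unfolding mem mem_Collect_eq
    by (induction p rule: poly_mapping_span_induct)
      (auto simp: s monoid_alg_star_add \<sigma> split: if_splits dest!: subsetD[OF keys_add])
  have smult: "star ?A (c \<odot>\<^bsub>?A\<^esub> p) = cnj c \<odot>\<^bsub>?A\<^esub> star ?A p" if "p \<in> carrier ?A" for c p
    using that unfolding mem mem_Collect_eq
    by (induction p rule: poly_mapping_span_induct)
      (auto simp: s monoid_alg_star_add monoid_alg_simps map_times_add mult_ac)
  have star: "star ?A (star ?A p) = p" if "p \<in> carrier ?A" for p
    using that unfolding mem mem_Collect_eq
  proof (induction p rule: poly_mapping_span_induct)
    case (single m c)
    then show ?case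
      using \<kappa>(2)[of m] by (simp add: s \<sigma> mult.assoc)
  qed (simp_all add: monoid_alg_star_add)
  have mult: "star ?A (p \<otimes>\<^bsub>?A\<^esub> r) = star ?A r \<otimes>\<^bsub>?A\<^esub> star ?A p"
    if "p \<in> carrier ?A" "r \<in> carrier ?A" for p r
    using that unfolding mem mem_Collect_eq
  proof (induction p rule: poly_mapping_span_induct)
    case (single x c)
    from single(2,1) show ?case
      by (induction r rule: poly_mapping_span_induct)
        (auto simp: s monoid_alg_mult_add monoid_alg_star_add \<sigma> \<kappa> mult_ac)
  qed (simp_all add: monoid_alg_mult_add monoid_alg_star_add)
  show ?thesis
    by unfold_locales
      (simp_all add: closed smult star mult monoid_alg_simps(4) monoid_alg_star_add)
qed

subsection \<open>Linear extensions\<close>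

context complex_algebra
begin

lemma lin_ext_superset:
  assumes "finite T" "keys p \<subseteq> T" "f \<in> T \<rightarrow> carrier A"
  shows "lin_ext A f p = (\<Oplus>m\<in>T. lookup p m \<odot> f m)"
  unfolding lin_ext_def
  by (rule add.finprod_mono_neutral_cong_left) (use assms in \<open>auto simp: in_keys_iff Pi_iff\<close>)

lemma lin_ext_closed:
  "keys p \<subseteq> S \<Longrightarrow> f \<in> S \<rightarrow> carrier A \<Longrightarrow> lin_ext A f p \<in> carrier A"
  unfolding lin_ext_def by (rule finsum_closed) auto

lemma lin_ext_zero [simp]: "lin_ext A f 0 = \<zero>"
  by (simp add: lin_ext_def)

lemma lin_ext_single: "f m \<in> carrier A \<Longrightarrow> lin_ext A f (single m c) = c \<odot> f m"
  by (simp add: lin_ext_superset[of "{m}"])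

lemma lin_ext_add:
  assumes "keys p \<subseteq> S" "keys r \<subseteq> S" "f \<in> S \<rightarrow> carrier A"
  shows "lin_ext A f (p + r) = lin_ext A f p \<oplus> lin_ext A f r"
proof -
  let ?T = "keys p \<union> keys r"
  have f: "f \<in> ?T \<rightarrow> carrier A"
    using assms by auto
  then have f': "f m \<in> carrier A" if "m \<in> keys p \<or> m \<in> keys r" for m
    using that by auto
  note eq = lin_ext_superset[of ?T, OF _ _ f]
  have "lin_ext A f (p + r) = (\<Oplus>m\<in>?T. lookup (p + r) m \<odot> f m)"
    by (rule eq) (simp_all add: keys_add)
  also have "\<dots> =
      (\<Oplus>m\<in>?T. lookup p m \<odot> f m \<oplus> lookup r m \<odot> f m)"
    by (rule finsum_cong') (use f' in \<open>auto simp: lookup_add smult_l_distr\<close>)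
  also have "\<dots> = (\<Oplus>m\<in>?T. lookup p m \<odot> f m) \<oplus> (\<Oplus>m\<in>?T. lookup r m \<odot> f m)"
    by (rule finsum_addf) (use f' in auto)
  finally show ?thesis
    by (simp add: eq)
qed

lemma lin_ext_smult:
  assumes "keys p \<subseteq> S" "f \<in> S \<rightarrow> carrier A"
  shows "lin_ext A f (scale c p) = c \<odot> lin_ext A f p"
  using assms(1)
proof (induction p rule: poly_mapping_span_induct)
  case (add p r)
  moreover have "keys (scale c p) \<subseteq> S"
    "keys (scale c r) \<subseteq> S"
    using add(1,2) by (auto simp: in_keys_iff)
  ultimately show ?case
    using assms(2) by (simp add: map_times_add lin_ext_add[of _ S] smult_r_distr lin_ext_closed)
qed (use assms(2) in \<open>auto simp: lin_ext_single Pi_iff smult_assoc\<close>)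

lemma alg_hom_lin_ext:
  assumes "Group.monoid M" and f: "f \<in> carrier M \<rightarrow> carrier A" "f \<one>\<^bsub>M\<^esub> = \<one>"
    "\<And>x y. x \<in> carrier M \<Longrightarrow> y \<in> carrier M \<Longrightarrow> f (x \<otimes>\<^bsub>M\<^esub> y) = f x \<otimes> f y"
  shows "alg_hom (monoid_alg M s) A (lin_ext A f)"
proof -
  interpret M: Group.monoid M by fact
  interpret MA: complex_algebra "monoid_alg M s"
    by (rule complex_algebra_monoid_alg) fact
  let ?h = "lin_ext A f"
  note closed = lin_ext_closed[OF _ f(1)]
  have f': "f x \<in> carrier A" if "x \<in> carrier M" for x
    using that f(1) by auto
  have keys: "keys (p \<otimes>\<^bsub>monoid_alg M s\<^esub> r) \<subseteq> carrier M"
    if "keys p \<subseteq> carrier M" "keys r \<subseteq> carrier M" for p r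
    using MA.m_closed[of p r] that by (simp add: monoid_alg_simps)
  have mult: "?h (p \<otimes>\<^bsub>monoid_alg M s\<^esub> r) = ?h p \<otimes> ?h r"
    if "keys p \<subseteq> carrier M" "keys r \<subseteq> carrier M" for p r
    using that
  proof (induction p rule: poly_mapping_span_induct)
    case (single x c)
    from single(2,1) show ?case
      by (induction r rule: poly_mapping_span_induct)
        (simp_all add: monoid_alg_mult_add lin_ext_add[of _ "carrier M"] keys f f' closed
          lin_ext_single smult_mult_left smult_mult_right smult_assoc[symmetric] mult.commute r_distr)
  qed (simp_all add: monoid_alg_mult_add lin_ext_add[of _ "carrier M"] keys f f' closed l_distr)
  show ?thesis
    by (rule alg_homI) (auto simp: monoid_alg_simps mult closed lin_ext_single f f' smult_one
        lin_ext_add[of _ "carrier M"] lin_ext_smult[of _ "carrier M"])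
qed

end

section \<open>Quotient algebras\<close>

context complex_algebra
begin

lemma ideal_smult_closed:
  assumes "ideal I A" "x \<in> I"
  shows "c \<odot> x \<in> I"
proof -
  interpret I: ideal I A by fact
  have "x \<in> carrier A"
    using I.a_Hcarr assms(2) by simp
  then have "c \<odot> x = (c \<odot> \<one>) \<otimes> x"
    by (rule smult_as_mult)
  then show ?thesis
    using I.I_l_closed[OF assms(2), of "c \<odot> \<one>"] by simp
qed

text \<open>\<open>quot_alg\<close> defines scalar multiplication and star as unions over all
  representatives. An additive map that preserves the ideal sends congruent elements to congruent
  ones, so all members of the union are the same coset.\<close>

lemma coset_UN_eq:
  assumes "ideal I A" and x: "x \<in> carrier A" and f: "\<And>y. y \<in> carrier A \<Longrightarrow> f y \<in> carrier A"
    "\<And>y z. y \<in> carrier A \<Longrightarrow> z \<in> carrier A \<Longrightarrow> f (y \<oplus> z) = f y \<oplus> f z"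
    "\<And>y. y \<in> I \<Longrightarrow> f y \<in> I"
  shows "(\<Union>y\<in>I +> x. I +> f y) = I +> f x"
proof -
  interpret I: ideal I A by fact
  have "I +> f y = I +> f x" if y: "y \<in> I +> x" for y
  proof -
    obtain i where i: "i \<in> I" "y = i \<oplus> x"
      using y by (auto simp: a_r_coset_def')
    then have "f y = f i \<oplus> f x"
      using f(2) x I.a_Hcarr by simp
    then have "f y \<in> I +> f x"
      using f(3)[OF i(1)] by (auto simp: a_r_coset_def')
    then show ?thesis
      using I.a_repr_independence' f(1)[OF x] by simp
  qed
  then have "(\<Union>y\<in>I +> x. I +> f y) = (\<Union>y\<in>I +> x. I +> f x)"
    by (rule SUP_cong[OF refl])
  also have "\<dots> = I +> f x"
    using I.a_rcos_self[OF x] by auto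
  finally show ?thesis .
qed

lemma alg_hom_quot_alg:
  assumes "ideal I A"
  shows "alg_hom A (quot_alg A I) (\<lambda>x. I +> x)"
    and "carrier (quot_alg A I) = (\<lambda>x. I +> x) ` carrier A"
    and "\<zero>\<^bsub>quot_alg A I\<^esub> = I +> \<zero>"
proof -
  interpret I: ideal I A by fact
  show "\<zero>\<^bsub>quot_alg A I\<^esub> = I +> \<zero>"
    by (simp add: quot_alg_def FactRing_def I.a_rcos_const)
  show "carrier (quot_alg A I) = (\<lambda>x. I +> x) ` carrier A"
    by (auto simp: quot_alg_def FactRing_simps)
  have smult: "(\<Union>y\<in>I +> x. I +> (c \<odot> y)) = I +> (c \<odot> x)" if "x \<in> carrier A" for c x
    by (rule coset_UN_eq) (simp_all add: assms that smult_r_distr ideal_smult_closed)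
  show "alg_hom A (quot_alg A I) (\<lambda>x. I +> x)"
    by (rule alg_homI)
      (auto simp: quot_alg_def FactRing_simps I.rcoset_mult_add I.a_rcos_sum smult)
qed

lemma complex_algebra_quot_alg:
  assumes "ideal I A"
  shows "complex_algebra (quot_alg A I)"
  by (rule complex_algebra_surj_image[OF complex_algebra_axioms alg_hom_quot_alg[OF assms]])

lemma quot_alg_coset_simps:
  assumes "ideal I A" "x \<in> carrier A"
  shows "y \<in> carrier A \<Longrightarrow> (I +> x) \<otimes>\<^bsub>quot_alg A I\<^esub> (I +> y) = I +> (x \<otimes> y)"
    and "y \<in> carrier A \<Longrightarrow> (I +> x) \<oplus>\<^bsub>quot_alg A I\<^esub> (I +> y) = I +> (x \<oplus> y)"
    and "y \<in> carrier A \<Longrightarrow> (I +> x) \<ominus>\<^bsub>quot_alg A I\<^esub> (I +> y) = I +> (x \<ominus> y)"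
    and "c \<odot>\<^bsub>quot_alg A I\<^esub> (I +> x) = I +> (c \<odot> x)"
  using alg_homD[OF alg_hom_quot_alg(1)[OF assms(1)]] assms(2)
    alg_hom_more(3)[OF alg_hom_quot_alg(1)[OF assms(1)] complex_algebra_axioms
      complex_algebra_quot_alg[OF assms(1)]]
  by simp_all

lemma ideal_kernel:
  assumes "complex_algebra B" and f: "alg_hom A B f"
  shows "ideal {x \<in> carrier A. f x = \<zero>\<^bsub>B\<^esub>} A"
proof -
  have "ring_hom_ring A B f"
    using f by (intro ring_hom_ringI2 ring_axioms complex_algebra.axioms(1)[OF assms(1)])
      (simp add: alg_hom_def)
  from ring_hom_ring.kernel_is_ideal[OF this] show ?thesis
    unfolding a_kernel_def' .
qed

text \<open>\<open>coset_ext\<close> evaluates a map on a coset by \<open>the_elem\<close> of the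
  image; that this image is a singleton is what gives the value a meaning.\<close>

lemma hom_coset_image:
  assumes "complex_algebra B" and f: "alg_hom A B f" and I: "ideal I A" "\<And>x. x \<in> I \<Longrightarrow> f x = \<zero>\<^bsub>B\<^esub>"
    and x: "x \<in> carrier A"
  shows "f ` (I +> x) = {f x}"
proof -
  interpret B: complex_algebra B by fact
  interpret I: ideal I A by fact
  have "f y = f x" if y: "y \<in> I +> x" for y
  proof -
    obtain i where i: "i \<in> I" "y = i \<oplus> x"
      using y by (auto simp: a_r_coset_def')
    then have "f y = f i \<oplus>\<^bsub>B\<^esub> f x"
      using alg_homD(3)[OF f I.a_Hcarr[OF i(1)] x] by simp
    then show ?thesis
      using I(2)[OF i(1)] alg_homD(1)[OF f x] by simp
  qed
  then have "f ` (I +> x) = (\<lambda>_. f x) ` (I +> x)"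
    by (rule image_cong[OF refl])
  also have "\<dots> = {f x}"
    using I.a_rcos_self[OF x] by auto
  finally show ?thesis .
qed

lemma the_elem_hom_coset:
  assumes "complex_algebra B" "alg_hom A B f" "ideal I A" "\<And>x. x \<in> I \<Longrightarrow> f x = \<zero>\<^bsub>B\<^esub>"
    and "x \<in> carrier A"
  shows "the_elem (f ` (I +> x)) = f x"
  by (simp add: hom_coset_image[OF assms])

lemma alg_hom_the_elem_quot:
  assumes B: "complex_algebra B" and f: "alg_hom A B f"
    and I: "ideal I A" "\<And>x. x \<in> I \<Longrightarrow> f x = \<zero>\<^bsub>B\<^esub>"
  shows "alg_hom (quot_alg A I) B (\<lambda>X. the_elem (f ` X))"
proof -
  note el = the_elem_hom_coset[OF B f I]
  have one: "\<one>\<^bsub>quot_alg A I\<^esub> = I +> \<one>"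
    by (rule alg_homD(4)[OF alg_hom_quot_alg(1)[OF I(1)], symmetric])
  show ?thesis
    by (rule alg_homI)
      (auto simp: alg_hom_quot_alg(2)[OF I(1)] quot_alg_coset_simps[OF I(1)] one el
        alg_homD[OF f])
qed

lemma alg_hom_zero_on_Idl:
  assumes "complex_algebra B" "alg_hom A B f" "S \<subseteq> carrier A" "\<And>x. x \<in> S \<Longrightarrow> f x = \<zero>\<^bsub>B\<^esub>"
    and "x \<in> Idl S"
  shows "f x = \<zero>\<^bsub>B\<^esub>"
  using genideal_minimal[OF ideal_kernel[OF assms(1,2)], of S] assms(3-5) by auto

lemma quot_alg_eqI:
  assumes "S \<subseteq> carrier A" "x \<ominus> y \<in> S" "x \<in> carrier A" "y \<in> carrier A"
  shows "Idl S +> x = Idl S +> y"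
  using quotient_eq_iff_same_a_r_cos[OF genideal_ideal[OF assms(1)] assms(3,4)]
    genideal_self[OF assms(1)] assms(2) by auto

end

context complex_star_algebra
begin

text \<open>The elements whose star lies in the ideal form an ideal themselves: the star reverses
  products, so absorption on the left and on the right change places. This ideal contains
  \<open>S\<close>.\<close>

lemma star_stable_Idl:
  assumes "S \<subseteq> carrier A" "\<And>x. x \<in> S \<Longrightarrow> star A x \<in> Idl S" and x: "x \<in> Idl S"
  shows "star A x \<in> Idl S"
proof -
  interpret I: ideal "Idl S" A
    by (rule genideal_ideal) fact
  have inv: "star A (\<ominus> y) = \<ominus> star A y" if "y \<in> carrier A" for y
    using that by (simp add: minus_eq_smult star_smult)
  have "ideal {y \<in> carrier A. star A y \<in> Idl S} A"
  proof (rule idealI)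
    show "subgroup {y \<in> carrier A. star A y \<in> Idl S} (add_monoid A)"
      by (rule add.subgroupI) (auto simp: star_add inv intro: exI[of _ \<zero>])
  qed (auto simp: ring_axioms star_mult I.I_l_closed I.I_r_closed)
  from genideal_minimal[OF this, of S] show ?thesis
    using assms by auto
qed

lemma complex_star_algebra_quot_alg:
  assumes I: "ideal I A" and star: "\<And>x. x \<in> I \<Longrightarrow> star A x \<in> I"
  shows "complex_star_algebra (quot_alg A I)"
    and "x \<in> carrier A \<Longrightarrow> star (quot_alg A I) (I +> x) = I +> star A x"
proof -
  show *: "star (quot_alg A I) (I +> x) = I +> star A x" if "x \<in> carrier A" for x
    unfolding quot_alg_def using that
    by (simp add: coset_UN_eq[of I x "star A"] I star star_add)
  show "complex_star_algebra (quot_alg A I)"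
    by (rule complex_star_algebra_surj_image[OF complex_star_algebra_axioms
          complex_algebra_quot_alg[OF I] alg_hom_quot_alg(1,2)[OF I]]) (simp add: *)
qed

end

section \<open>Presented algebras\<close>

definition word_value :: "'a star_alg \<Rightarrow> ('g \<Rightarrow> 'a) \<Rightarrow> 'g list \<Rightarrow> 'a" where
  "word_value A f w = foldr (\<lambda>g y. f g \<otimes>\<^bsub>A\<^esub> y) w \<one>\<^bsub>A\<^esub>"

lemma word_value_simps [simp]:
  "word_value A f [] = \<one>\<^bsub>A\<^esub>" "word_value A f (g # w) = f g \<otimes>\<^bsub>A\<^esub> word_value A f w"
  by (simp_all add: word_value_def)

lemma word_monoid_simps [simp]:
  "carrier word_monoid = UNIV" "\<one>\<^bsub>word_monoid\<^esub> = []" "v \<otimes>\<^bsub>word_monoid\<^esub> w = v @ w"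
  by (simp_all add: word_monoid_def)

lemma monoid_word_monoid: "Group.monoid word_monoid"
  by (rule Group.monoidI) auto

lemma free_alg_simps:
  "carrier (free_alg s) = UNIV"
  "\<one>\<^bsub>free_alg s\<^esub> = single [] 1"
  "\<zero>\<^bsub>free_alg s\<^esub> = 0"
  "p \<oplus>\<^bsub>free_alg s\<^esub> r = p + r"
  "p \<ominus>\<^bsub>free_alg s\<^esub> r = p - r"
  "c \<odot>\<^bsub>free_alg s\<^esub> p = scale c p"
  "single v a \<otimes>\<^bsub>free_alg s\<^esub> single w b = single (v @ w) (a * b)"
  by (simp_all add: free_alg_def monoid_alg_simps monoid_alg_minus monoid_word_monoid)

lemma free_alg_star_simps:
  "star (free_alg s) (p + r) = star (free_alg s) p + star (free_alg s) r"
  "star (free_alg s) (p - r) = star (free_alg s) p - star (free_alg s) r"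
  "star (free_alg s) (single w c) =
    single (rev (map (snd \<circ> s) w)) (cnj c * prod_list (map (fst \<circ> s) w))"
  by (simp_all add: free_alg_def monoid_alg_star_add monoid_alg_star_diff)

lemma complex_algebra_free_alg: "complex_algebra (free_alg s)"
  by (simp add: free_alg_def complex_algebra_monoid_alg monoid_word_monoid)

lemma complex_star_algebra_free_alg:
  assumes "\<And>g. snd (s (snd (s g))) = g" "\<And>g. cnj (fst (s g)) * fst (s (snd (s g))) = 1"
  shows "complex_star_algebra (free_alg s)"
proof -
  have [simp]: "prod_list (rev xs) = prod_list xs" for xs :: "complex list"
    by (induction xs) simp_all
  have "cnj (prod_list (map (fst \<circ> s) w)) * prod_list (map (fst \<circ> s) (map (snd \<circ> s) w)) = 1" for w
  proof (induction w)
    case (Cons g w)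
    then show ?case
      using assms(2)[of g] by (simp add: algebra_simps)
  qed simp
  then show ?thesis
    unfolding free_alg_def
    by (intro complex_star_algebra_monoid_alg[OF monoid_word_monoid refl])
      (auto simp: rev_map[symmetric] assms(1) o_def)
qed

locale presentation =
  fixes s :: "'g \<Rightarrow> complex \<times> 'g" and R :: "('g list \<Rightarrow>\<^sub>0 complex) set"
begin

sublocale free: complex_algebra "free_alg s"
  by (rule complex_algebra_free_alg)

abbreviation "Q \<equiv> presented_alg s R"
abbreviation "gen \<equiv> presented_gen s R"

lemma ideal_relations: "ideal (Idl\<^bsub>free_alg s\<^esub> R) (free_alg s)"
  by (rule free.genideal_ideal) (simp add: free_alg_simps)

sublocale complex_algebra Q
  unfolding presented_alg_def by (rule free.complex_algebra_quot_alg[OF ideal_relations])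

definition coset :: "('g list \<Rightarrow>\<^sub>0 complex) \<Rightarrow> ('g list \<Rightarrow>\<^sub>0 complex) set" where
  "coset p = Idl\<^bsub>free_alg s\<^esub> R +>\<^bsub>free_alg s\<^esub> p"

lemma alg_hom_coset: "alg_hom (free_alg s) Q coset"
  and carrier_Q: "carrier Q = range coset"
  using free.alg_hom_quot_alg[OF ideal_relations]
  by (simp_all add: presented_alg_def coset_def[abs_def] free_alg_simps)

lemma gen_eq: "gen g = coset (single [g] 1)"
  by (simp add: presented_gen_def coset_def)

lemma gen_closed [simp, intro]: "gen g \<in> carrier Q"
  by (simp add: gen_eq carrier_Q)

lemma coset_word: "coset (single w c) = c \<odot>\<^bsub>Q\<^esub> word_value Q gen w"
proof -
  have "word_value Q gen w = coset (single w 1)"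
  proof (induction w)
    case Nil
    then show ?case
      using alg_homD(4)[OF alg_hom_coset] by (simp add: free_alg_simps)
  next
    case (Cons g w)
    then show ?case
      using alg_homD(2)[OF alg_hom_coset, of "single [g] 1" "single w 1"]
      by (simp add: free_alg_simps gen_eq)
  qed
  then show ?thesis
    using alg_homD(5)[OF alg_hom_coset, of "single w 1" c] by (simp add: free_alg_simps)
qed

lemma coset_add: "coset (p + r) = coset p \<oplus>\<^bsub>Q\<^esub> coset r"
  and coset_diff: "coset (p - r) = coset p \<ominus>\<^bsub>Q\<^esub> coset r"
  using alg_homD(3)[OF alg_hom_coset, of p r]
    alg_hom_more(3)[OF alg_hom_coset complex_algebra_free_alg complex_algebra_axioms, of p r]
  by (simp_all add: free_alg_simps)

lemma coset_relation:
  assumes "r \<in> R"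
  shows "coset r = \<zero>\<^bsub>Q\<^esub>"
proof -
  have "r \<in> Idl\<^bsub>free_alg s\<^esub> R"
    using free.genideal_self[of R] assms by (auto simp: free_alg_simps)
  then show ?thesis
    using abelian_subgroup.a_rcos_const[OF abelian_subgroupI3[OF ideal.axioms(1)[OF ideal_relations]]]
    by (simp add: coset_def presented_alg_def quot_alg_def FactRing_def free.abelian_group_axioms)
qed

lemma presented_induct [consumes 1, case_names gen one add mult smult]:
  assumes "x \<in> carrier Q" and gen: "\<And>g. P (gen g)" and one: "P \<one>\<^bsub>Q\<^esub>"
    and add: "\<And>x y. x \<in> carrier Q \<Longrightarrow> y \<in> carrier Q \<Longrightarrow> P x \<Longrightarrow> P y \<Longrightarrow> P (x \<oplus>\<^bsub>Q\<^esub> y)"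
    and mult: "\<And>x y. x \<in> carrier Q \<Longrightarrow> y \<in> carrier Q \<Longrightarrow> P x \<Longrightarrow> P y \<Longrightarrow> P (x \<otimes>\<^bsub>Q\<^esub> y)"
    and smult: "\<And>c x. x \<in> carrier Q \<Longrightarrow> P x \<Longrightarrow> P (c \<odot>\<^bsub>Q\<^esub> x)"
  shows "P x"
proof -
  obtain p where p: "x = coset p"
    using assms(1) by (auto simp: carrier_Q)
  have word: "word_value Q gen w \<in> carrier Q \<and> P (word_value Q gen w)" for w
    by (induction w) (auto simp: one intro: gen mult)
  have "P (coset p)"
    using subset_UNIV
  proof (induction p rule: poly_mapping_span_induct)
    case zero
    then show ?case
      using smult[OF one_closed one, of 0] coset_word[of "[]" 0] by simp
  qed (auto simp: coset_word coset_add word intro!: add smult rangeI[of coset, folded carrier_Q])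
  then show ?thesis
    by (simp add: p)
qed

text \<open>The universal property of the presentation, for the very map \<open>alg_hom_ext\<close>
  through which comultiplication and counit are defined.\<close>

lemma alg_hom_alg_hom_ext:
  assumes B: "complex_algebra B" and f: "\<And>g. f g \<in> carrier B"
    and R: "\<And>r. r \<in> R \<Longrightarrow> lin_ext B (word_value B f) r = \<zero>\<^bsub>B\<^esub>"
  shows "alg_hom Q B (alg_hom_ext B f)" and "alg_hom_ext B f (gen g) = f g"
proof -
  interpret B: complex_algebra B by fact
  have closed: "word_value B f w \<in> carrier B" for w
    by (induction w) (simp_all add: f)
  have "word_value B f (v @ w) = word_value B f v \<otimes>\<^bsub>B\<^esub> word_value B f w" for v w
    by (induction v) (simp_all add: B.m_assoc closed f)
  then have hom: "alg_hom (free_alg s) B (lin_ext B (word_value B f))"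
    unfolding free_alg_def
    by (intro B.alg_hom_lin_ext[OF monoid_word_monoid]) (auto simp: closed)
  have zero: "lin_ext B (word_value B f) x = \<zero>\<^bsub>B\<^esub>" if "x \<in> Idl\<^bsub>free_alg s\<^esub> R" for x
    by (rule free.alg_hom_zero_on_Idl[OF B hom _ R that]) (simp_all add: free_alg_simps)
  have eq: "alg_hom_ext B f = (\<lambda>X. the_elem (lin_ext B (word_value B f) ` X))"
    by (simp add: alg_hom_ext_def coset_ext_def word_value_def[abs_def] fun_eq_iff)
  show "alg_hom Q B (alg_hom_ext B f)"
    using free.alg_hom_the_elem_quot[OF B hom ideal_relations zero]
    by (simp add: eq presented_alg_def)
  show "alg_hom_ext B f (gen g) = f g"
    using free.the_elem_hom_coset[OF B hom ideal_relations zero, of "single [g] 1"]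
      B.lin_ext_single[of "word_value B f" "[g]" 1]
    by (simp add: eq gen_eq coset_def free_alg_simps closed f del: word_value_simps)
      (simp add: f)
qed

lemma star_presented:
  assumes "\<And>g. snd (s (snd (s g))) = g" "\<And>g. cnj (fst (s g)) * fst (s (snd (s g))) = 1"
    and R: "\<And>r. r \<in> R \<Longrightarrow> coset (star (free_alg s) r) = \<zero>\<^bsub>Q\<^esub>"
  shows "complex_star_algebra Q" and "star Q (gen g) = fst (s g) \<odot>\<^bsub>Q\<^esub> gen (snd (s g))"
proof -
  note sfree = complex_star_algebra_free_alg[OF assms(1,2)]
  have gens: "star (free_alg s) r \<in> Idl\<^bsub>free_alg s\<^esub> R" if "r \<in> R" for r
  proof (rule ideal.rcos_const_imp_mem[OF ideal_relations])
    show "Idl\<^bsub>free_alg s\<^esub> R +>\<^bsub>free_alg s\<^esub> star (free_alg s) r = Idl\<^bsub>free_alg s\<^esub> R"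
      using R[OF that] by (simp add: coset_def presented_alg_def quot_alg_def FactRing_def)
  qed (simp add: free_alg_simps)
  have "star (free_alg s) r \<in> Idl\<^bsub>free_alg s\<^esub> R" if "r \<in> Idl\<^bsub>free_alg s\<^esub> R" for r
    by (rule complex_star_algebra.star_stable_Idl[OF sfree _ gens that]) (simp_all add: free_alg_simps)
  note star = complex_star_algebra.complex_star_algebra_quot_alg[OF sfree ideal_relations this]
  show "complex_star_algebra Q"
    unfolding presented_alg_def by (rule star(1))
  have "star Q (gen g) = coset (single [snd (s g)] (fst (s g)))"
    using star(2)[of "single [g] 1"]
    by (simp add: gen_eq coset_def presented_alg_def free_alg_simps free_alg_star_simps)
  then show "star Q (gen g) = fst (s g) \<odot>\<^bsub>Q\<^esub> gen (snd (s g))"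
    by (simp add: coset_word)
qed

end

section \<open>Tensor products\<close>

lemma bilinear_relsI:
  "x \<in> carrier A \<Longrightarrow> x' \<in> carrier A \<Longrightarrow> y \<in> carrier B \<Longrightarrow>
    single (x \<oplus>\<^bsub>A\<^esub> x', y) 1 - single (x, y) 1 - single (x', y) 1
      \<in> bilinear_rels A B"
  "x \<in> carrier A \<Longrightarrow> y \<in> carrier B \<Longrightarrow> y' \<in> carrier B \<Longrightarrow>
    single (x, y \<oplus>\<^bsub>B\<^esub> y') 1 - single (x, y) 1 - single (x, y') 1
      \<in> bilinear_rels A B"
  "x \<in> carrier A \<Longrightarrow> y \<in> carrier B \<Longrightarrow>
    single (c \<odot>\<^bsub>A\<^esub> x, y) 1 - single (x, y) c \<in> bilinear_rels A B"
  "x \<in> carrier A \<Longrightarrow> y \<in> carrier B \<Longrightarrow>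
    single (x, c \<odot>\<^bsub>B\<^esub> y) 1 - single (x, y) c \<in> bilinear_rels A B"
  unfolding bilinear_rels_def by auto

locale tensor_product = A: complex_algebra A + B: complex_algebra B
  for A :: "'a star_alg" and B :: "'b star_alg"
begin

abbreviation "T \<equiv> tensor A B"
abbreviation "PT \<equiv> pretensor A B"
abbreviation "pure \<equiv> pure_tensor A B"

lemma monoid_DirProd: "Group.monoid (A \<times>\<times> B)"
  by (rule DirProd_monoid[OF A.monoid_axioms B.monoid_axioms])

sublocale PT: complex_algebra PT
  unfolding pretensor_def by (rule complex_algebra_monoid_alg[OF monoid_DirProd])

lemma pretensor_simps:
  "carrier PT = {p. keys p \<subseteq> carrier A \<times> carrier B}"
  "\<one>\<^bsub>PT\<^esub> = single (\<one>\<^bsub>A\<^esub>, \<one>\<^bsub>B\<^esub>) 1"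
  "\<zero>\<^bsub>PT\<^esub> = 0"
  "p \<oplus>\<^bsub>PT\<^esub> r = p + r"
  "c \<odot>\<^bsub>PT\<^esub> p = scale c p"
  "single (x, y) a \<otimes>\<^bsub>PT\<^esub> single (x', y') b =
    single (x \<otimes>\<^bsub>A\<^esub> x', y \<otimes>\<^bsub>B\<^esub> y') (a * b)"
  by (simp_all add: pretensor_def monoid_alg_simps)

lemma pretensor_minus:
  "keys r \<subseteq> carrier A \<times> carrier B \<Longrightarrow> p \<ominus>\<^bsub>PT\<^esub> r = p - r"
  unfolding pretensor_def by (rule monoid_alg_minus[OF monoid_DirProd]) simp

lemma bilinear_rels_carrier: "bilinear_rels A B \<subseteq> carrier PT"
  unfolding bilinear_rels_def pretensor_simps
  by (auto dest!: subsetD[OF keys_diff] split: if_splits)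

lemma ideal_tensor_ideal: "ideal (tensor_ideal A B) PT"
  unfolding tensor_ideal_def by (rule PT.genideal_ideal[OF bilinear_rels_carrier])

sublocale complex_algebra T
  unfolding tensor_def by (rule PT.complex_algebra_quot_alg[OF ideal_tensor_ideal])

definition coset :: "('a \<times> 'b \<Rightarrow>\<^sub>0 complex) \<Rightarrow> ('a \<times> 'b \<Rightarrow>\<^sub>0 complex) set" where
  "coset p = tensor_ideal A B +>\<^bsub>PT\<^esub> p"

lemma alg_hom_coset: "alg_hom PT T coset"
  and carrier_T: "carrier T = coset ` carrier PT"
  using PT.alg_hom_quot_alg[OF ideal_tensor_ideal] by (simp_all add: tensor_def coset_def[abs_def])

lemma pure_eq: "pure x y = coset (single (x, y) 1)"
  by (simp add: pure_tensor_def coset_def)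

lemma pure_closed [simp, intro]: "x \<in> carrier A \<Longrightarrow> y \<in> carrier B \<Longrightarrow> pure x y \<in> carrier T"
  by (simp add: pure_eq carrier_T pretensor_simps)

lemma coset_single:
  assumes "x \<in> carrier A" "y \<in> carrier B"
  shows "coset (single (x, y) c) = c \<odot>\<^bsub>T\<^esub> pure x y"
  using alg_homD(5)[OF alg_hom_coset, of "single (x, y) 1" c] assms
  by (simp add: pure_eq pretensor_simps)

lemma coset_eqI:
  assumes "p - r \<in> bilinear_rels A B" "keys p \<subseteq> carrier A \<times> carrier B"
    "keys r \<subseteq> carrier A \<times> carrier B"
  shows "coset p = coset r"
  unfolding coset_def tensor_ideal_def
  by (rule PT.quot_alg_eqI[OF bilinear_rels_carrier]) (use assms in \<open>simp_all add: pretensor_minus pretensor_simps\<close>)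

lemma coset_add:
  assumes "keys p \<subseteq> carrier A \<times> carrier B"
    "keys r \<subseteq> carrier A \<times> carrier B"
  shows "coset (p + r) = coset p \<oplus>\<^bsub>T\<^esub> coset r"
  using alg_homD(3)[OF alg_hom_coset, of p r] assms by (simp add: pretensor_simps)

lemma pure_mult:
  assumes "x \<in> carrier A" "y \<in> carrier B" "x' \<in> carrier A" "y' \<in> carrier B"
  shows "pure x y \<otimes>\<^bsub>T\<^esub> pure x' y' = pure (x \<otimes>\<^bsub>A\<^esub> x') (y \<otimes>\<^bsub>B\<^esub> y')"
  using alg_homD(2)[OF alg_hom_coset, of "single (x, y) 1" "single (x', y') 1"]
    assms by (simp add: pure_eq pretensor_simps)

lemma one_eq_pure: "\<one>\<^bsub>T\<^esub> = pure \<one>\<^bsub>A\<^esub> \<one>\<^bsub>B\<^esub>"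
  using alg_homD(4)[OF alg_hom_coset] by (simp add: pure_eq pretensor_simps)

lemma pure_add_left:
  assumes "x \<in> carrier A" "x' \<in> carrier A" "y \<in> carrier B"
  shows "pure (x \<oplus>\<^bsub>A\<^esub> x') y = pure x y \<oplus>\<^bsub>T\<^esub> pure x' y"
proof -
  have "coset (single (x \<oplus>\<^bsub>A\<^esub> x', y) 1) =
      coset (single (x, y) 1 + single (x', y) 1)"
    by (rule coset_eqI)
      (use assms bilinear_relsI(1)[OF assms] in \<open>auto simp: diff_diff_eq dest!: subsetD[OF keys_add]\<close>)
  then show ?thesis
    using assms by (simp add: pure_eq coset_add)
qed

lemma pure_add_right:
  assumes "x \<in> carrier A" "y \<in> carrier B" "y' \<in> carrier B"
  shows "pure x (y \<oplus>\<^bsub>B\<^esub> y') = pure x y \<oplus>\<^bsub>T\<^esub> pure x y'"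
proof -
  have "coset (single (x, y \<oplus>\<^bsub>B\<^esub> y') 1) =
      coset (single (x, y) 1 + single (x, y') 1)"
    by (rule coset_eqI)
      (use assms bilinear_relsI(2)[OF assms] in \<open>auto simp: diff_diff_eq dest!: subsetD[OF keys_add]\<close>)
  then show ?thesis
    using assms by (simp add: pure_eq coset_add)
qed

lemma pure_smult_left:
  assumes "x \<in> carrier A" "y \<in> carrier B"
  shows "pure (c \<odot>\<^bsub>A\<^esub> x) y = c \<odot>\<^bsub>T\<^esub> pure x y"
proof -
  have "coset (single (c \<odot>\<^bsub>A\<^esub> x, y) 1) = coset (single (x, y) c)"
    by (rule coset_eqI[OF bilinear_relsI(3)]) (use assms in auto)
  then show ?thesis
    using assms by (simp only: pure_eq[of "c \<odot>\<^bsub>A\<^esub> x"] coset_single[of x y])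
qed

lemma pure_smult_right:
  assumes "x \<in> carrier A" "y \<in> carrier B"
  shows "pure x (c \<odot>\<^bsub>B\<^esub> y) = c \<odot>\<^bsub>T\<^esub> pure x y"
proof -
  have "coset (single (x, c \<odot>\<^bsub>B\<^esub> y) 1) = coset (single (x, y) c)"
    by (rule coset_eqI[OF bilinear_relsI(4)]) (use assms in auto)
  then show ?thesis
    using assms by (simp only: pure_eq[of x "c \<odot>\<^bsub>B\<^esub> y"] coset_single[of x y])
qed

lemmas pure_linear = pure_add_left pure_add_right pure_smult_left pure_smult_right

lemma tensor_induct [consumes 1, case_names pure add smult]:
  assumes "t \<in> carrier T"
    and pure: "\<And>x y. x \<in> carrier A \<Longrightarrow> y \<in> carrier B \<Longrightarrow> P (pure x y)"
    and add: "\<And>s t. s \<in> carrier T \<Longrightarrow> t \<in> carrier T \<Longrightarrow> P s \<Longrightarrow> P t \<Longrightarrow> P (s \<oplus>\<^bsub>T\<^esub> t)"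
    and smult: "\<And>c t. t \<in> carrier T \<Longrightarrow> P t \<Longrightarrow> P (c \<odot>\<^bsub>T\<^esub> t)"
  shows "P t"
proof -
  obtain p where p: "t = coset p" "keys p \<subseteq> carrier A \<times> carrier B"
    using assms(1) by (auto simp: carrier_T pretensor_simps)
  have cl: "coset r \<in> carrier T" if "keys r \<subseteq> carrier A \<times> carrier B" for r
    using that by (simp add: carrier_T pretensor_simps)
  from p(2) have "P (coset p)"
  proof (induction p rule: poly_mapping_span_induct)
    case zero
    have "coset 0 = 0 \<odot>\<^bsub>T\<^esub> pure \<one>\<^bsub>A\<^esub> \<one>\<^bsub>B\<^esub>"
      using coset_single[of "\<one>\<^bsub>A\<^esub>" "\<one>\<^bsub>B\<^esub>" 0] by simp
    then show ?case
      using smult[OF pure_closed pure, of "\<one>\<^bsub>A\<^esub>" "\<one>\<^bsub>B\<^esub>" 0] by simp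
    next
    case (single m c)
    then show ?case
      by (cases m) (simp add: coset_single pure smult)
  next
    case (add p r)
    then show ?case
      by (simp add: coset_add cl assms(3))
  qed
  then show ?thesis
    by (simp add: p)
qed

lemma alg_hom_tensor_eqI:
  assumes "alg_hom T C f" "alg_hom T C h"
    and "\<And>x y. x \<in> carrier A \<Longrightarrow> y \<in> carrier B \<Longrightarrow> f (pure x y) = h (pure x y)"
    and "t \<in> carrier T"
  shows "f t = h t"
  using assms(4)
  by (induction t rule: tensor_induct)
    (simp_all add: assms(3) assms(1,2)[THEN alg_homD(3)] assms(1,2)[THEN alg_homD(5)])

end

text \<open>Multiplicativity of \<open>F\<close> turns its linear extension into an algebra
  homomorphism on the pretensor algebra. It therefore kills the whole tensor ideal as soon as it
  kills the bilinearity relations. Tensor products of homomorphisms and slice maps by characters fit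
  directly; rebracketing fits after a detour.\<close>

locale bimultiplicative = tensor_product A B + C: complex_algebra C
  for A :: "'a star_alg" and B :: "'b star_alg" and C :: "'c star_alg" +
  fixes F :: "'a \<Rightarrow> 'b \<Rightarrow> 'c"
  assumes F_closed: "x \<in> carrier A \<Longrightarrow> y \<in> carrier B \<Longrightarrow> F x y \<in> carrier C"
    and F_one: "F \<one>\<^bsub>A\<^esub> \<one>\<^bsub>B\<^esub> = \<one>\<^bsub>C\<^esub>"
    and F_mult: "x \<in> carrier A \<Longrightarrow> y \<in> carrier B \<Longrightarrow> x' \<in> carrier A \<Longrightarrow> y' \<in> carrier B \<Longrightarrow>
      F (x \<otimes>\<^bsub>A\<^esub> x') (y \<otimes>\<^bsub>B\<^esub> y') = F x y \<otimes>\<^bsub>C\<^esub> F x' y'"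
    and F_add_left: "x \<in> carrier A \<Longrightarrow> x' \<in> carrier A \<Longrightarrow> y \<in> carrier B \<Longrightarrow>
      F (x \<oplus>\<^bsub>A\<^esub> x') y = F x y \<oplus>\<^bsub>C\<^esub> F x' y"
    and F_add_right: "x \<in> carrier A \<Longrightarrow> y \<in> carrier B \<Longrightarrow> y' \<in> carrier B \<Longrightarrow>
      F x (y \<oplus>\<^bsub>B\<^esub> y') = F x y \<oplus>\<^bsub>C\<^esub> F x y'"
    and F_smult_left: "x \<in> carrier A \<Longrightarrow> y \<in> carrier B \<Longrightarrow> F (c \<odot>\<^bsub>A\<^esub> x) y = c \<odot>\<^bsub>C\<^esub> F x y"
    and F_smult_right: "x \<in> carrier A \<Longrightarrow> y \<in> carrier B \<Longrightarrow> F x (c \<odot>\<^bsub>B\<^esub> y) = c \<odot>\<^bsub>C\<^esub> F x y"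
begin

lemma alg_hom_pretensor: "alg_hom PT C (lin_ext C (\<lambda>(x, y). F x y))"
  unfolding pretensor_def
  by (rule C.alg_hom_lin_ext[OF monoid_DirProd]) (auto simp: F_closed F_one F_mult)

lemma lin_ext_zero_on_ideal:
  assumes "p \<in> tensor_ideal A B"
  shows "lin_ext C (\<lambda>(x, y). F x y) p = \<zero>\<^bsub>C\<^esub>"
proof -
  let ?h = "lin_ext C (\<lambda>(x, y). F x y)"
  have diff: "?h (p - r) = ?h p \<ominus>\<^bsub>C\<^esub> ?h r"
    if "keys p \<subseteq> carrier A \<times> carrier B" "keys r \<subseteq> carrier A \<times> carrier B"
    for p r
    using alg_hom_more(3)[OF alg_hom_pretensor PT.complex_algebra_axioms C.complex_algebra_axioms, of p r]
      that pretensor_minus[OF that(2)] by (simp add: pretensor_simps)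
  have single: "?h (single (x, y) c) = c \<odot>\<^bsub>C\<^esub> F x y"
    if "x \<in> carrier A" "y \<in> carrier B" for x y c
    using that by (simp add: C.lin_ext_single F_closed)
  have keys: "keys (single (x, y) (1::complex) - single (x', y') 1)
      \<subseteq> carrier A \<times> carrier B"
    if "x \<in> carrier A" "y \<in> carrier B" "x' \<in> carrier A" "y' \<in> carrier B" for x x' y y'
    by (rule order_trans[OF keys_diff]) (use that in auto)
  have cancel: "u \<oplus>\<^bsub>C\<^esub> v \<ominus>\<^bsub>C\<^esub> u \<ominus>\<^bsub>C\<^esub> v = \<zero>\<^bsub>C\<^esub>" "u \<ominus>\<^bsub>C\<^esub> u = \<zero>\<^bsub>C\<^esub>"
    if "u \<in> carrier C" "v \<in> carrier C" for u v
    by (rule C.in_family_inject; simp add: that C.in_family_simps)+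
  have "?h r = \<zero>\<^bsub>C\<^esub>" if "r \<in> bilinear_rels A B" for r
    using that unfolding bilinear_rels_def
    by (elim UnE CollectE exE conjE) (simp_all add: diff keys single F_closed F_add_left F_add_right
        F_smult_left F_smult_right cancel)
  then show ?thesis
    using PT.alg_hom_zero_on_Idl[OF C.complex_algebra_axioms alg_hom_pretensor bilinear_rels_carrier]
      assms by (simp add: tensor_ideal_def)
qed

lemma lin_ext_image_coset:
  assumes "keys p \<subseteq> carrier A \<times> carrier B"
  shows "lin_ext C (\<lambda>(x, y). F x y) ` coset p = {lin_ext C (\<lambda>(x, y). F x y) p}"
  unfolding coset_def
  by (rule PT.hom_coset_image[OF C.complex_algebra_axioms alg_hom_pretensor ideal_tensor_ideal
        lin_ext_zero_on_ideal]) (use assms in \<open>simp_all add: pretensor_simps\<close>)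

lemma coset_ext_coset:
  assumes "keys p \<subseteq> carrier A \<times> carrier B"
  shows "coset_ext C (\<lambda>(x, y). F x y) (coset p) = lin_ext C (\<lambda>(x, y). F x y) p"
  by (simp add: coset_ext_def lin_ext_image_coset[OF assms])

lemma alg_hom_coset_ext: "alg_hom T C (coset_ext C (\<lambda>(x, y). F x y))"
proof -
  have "coset_ext C (\<lambda>(x, y). F x y) = (\<lambda>X. the_elem (lin_ext C (\<lambda>(x, y). F x y) ` X))"
    by (simp add: coset_ext_def fun_eq_iff)
  then show ?thesis
    using PT.alg_hom_the_elem_quot[OF C.complex_algebra_axioms alg_hom_pretensor ideal_tensor_ideal
        lin_ext_zero_on_ideal] by (simp add: tensor_def)
qed

lemma coset_ext_pure:
  "x \<in> carrier A \<Longrightarrow> y \<in> carrier B \<Longrightarrow> coset_ext C (\<lambda>(x, y). F x y) (pure x y) = F x y"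
  using coset_ext_coset[of "single (x, y) 1"]
    C.lin_ext_single[of "\<lambda>(x, y). F x y" "(x, y)" 1] F_closed[of x y]
  by (simp add: pure_eq)

end

section \<open>Tensor products of homomorphisms, slice maps, rebracketing and the star\<close>

lemma alg_hom_tensor_map:
  assumes "complex_algebra A" "complex_algebra B" "complex_algebra C" "complex_algebra D"
    and f: "alg_hom A C f" and g: "alg_hom B D g"
  shows "alg_hom (tensor A B) (tensor C D) (tensor_map C D f g)"
    and "x \<in> carrier A \<Longrightarrow> y \<in> carrier B \<Longrightarrow>
      tensor_map C D f g (pure_tensor A B x y) = pure_tensor C D (f x) (g y)"
proof -
  interpret CD: tensor_product C D
    using assms by (simp add: tensor_product_def)
  interpret bimultiplicative A B "tensor C D" "\<lambda>x y. pure_tensor C D (f x) (g y)"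
    using assms(1,2)
    by (simp add: bimultiplicative_def tensor_product_def bimultiplicative_axioms_def
        CD.complex_algebra_axioms alg_homD[OF f] alg_homD[OF g] CD.one_eq_pure CD.pure_mult
        CD.pure_linear)
  show "alg_hom (tensor A B) (tensor C D) (tensor_map C D f g)"
    unfolding tensor_map_def by (rule alg_hom_coset_ext)
  show "x \<in> carrier A \<Longrightarrow> y \<in> carrier B \<Longrightarrow>
      tensor_map C D f g (pure_tensor A B x y) = pure_tensor C D (f x) (g y)"
    unfolding tensor_map_def by (rule coset_ext_pure)
qed

lemma alg_hom_character_tensor:
  assumes "complex_algebra A" "complex_algebra B" and \<chi>: "alg_hom A complex_alg \<chi>"
  shows "alg_hom (tensor A B) B (coset_ext B (\<lambda>(x, y). \<chi> x \<odot>\<^bsub>B\<^esub> y))"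
    and "x \<in> carrier A \<Longrightarrow> y \<in> carrier B \<Longrightarrow>
      coset_ext B (\<lambda>(x, y). \<chi> x \<odot>\<^bsub>B\<^esub> y) (pure_tensor A B x y) = \<chi> x \<odot>\<^bsub>B\<^esub> y"
proof -
  interpret B: complex_algebra B by fact
  note h = alg_homD[OF \<chi>, simplified complex_alg_def, simplified]
  interpret bimultiplicative A B B "\<lambda>x y. \<chi> x \<odot>\<^bsub>B\<^esub> y"
    using assms(1)
    by (simp add: bimultiplicative_def tensor_product_def bimultiplicative_axioms_def
        B.complex_algebra_axioms h B.smult_l_distr B.smult_r_distr B.smult_assoc[symmetric]
        B.smult_mult_left B.smult_mult_right mult.commute)
  show "alg_hom (tensor A B) B (coset_ext B (\<lambda>(x, y). \<chi> x \<odot>\<^bsub>B\<^esub> y))"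
    by (rule alg_hom_coset_ext)
  show "x \<in> carrier A \<Longrightarrow> y \<in> carrier B \<Longrightarrow>
      coset_ext B (\<lambda>(x, y). \<chi> x \<odot>\<^bsub>B\<^esub> y) (pure_tensor A B x y) = \<chi> x \<odot>\<^bsub>B\<^esub> y"
    by (rule coset_ext_pure)
qed

text \<open>The inner map of \<open>tensor_assoc\<close> depends on a fixed \<open>z\<close> and is
  not multiplicative unless \<open>z\<close> is the unit, so the universal property does not apply
  to it directly. It is split as the multiplicative map for the unit followed by right
  multiplication with \<open>r z\<close>, the image of \<open>z\<close> in the last leg.\<close>

lemma alg_hom_tensor_assoc:
  assumes A: "complex_algebra A" and B: "complex_algebra B" and C: "complex_algebra C"
  shows "alg_hom (tensor (tensor A B) C) (tensor A (tensor B C)) (tensor_assoc A B C)"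
    and "x \<in> carrier A \<Longrightarrow> y \<in> carrier B \<Longrightarrow> z \<in> carrier C \<Longrightarrow>
      tensor_assoc A B C (pure_tensor (tensor A B) C (pure_tensor A B x y) z) =
        pure_tensor A (tensor B C) x (pure_tensor B C y z)"
proof -
  let ?T = "tensor A (tensor B C)"
  interpret A: complex_algebra A by fact
  interpret B: complex_algebra B by fact
  interpret C: complex_algebra C by fact
  interpret BC: tensor_product B C by unfold_locales
  interpret A_BC: tensor_product A "tensor B C" by unfold_locales
  interpret AB: tensor_product A B by unfold_locales
  interpret AB_C: tensor_product "tensor A B" C by unfold_locales
  define F where "F = (\<lambda>z x y. pure_tensor A (tensor B C) x (pure_tensor B C y z))"
  define G where "G = (\<lambda>z. coset_ext (?T) (\<lambda>(x, y). F z x y))"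
  define r where "r = (\<lambda>z. F z \<one>\<^bsub>A\<^esub> \<one>\<^bsub>B\<^esub>)"
  note pure = A_BC.pure_mult A_BC.pure_linear BC.pure_mult BC.pure_linear A_BC.one_eq_pure BC.one_eq_pure
  interpret F: bimultiplicative A B "?T" "F \<one>\<^bsub>C\<^esub>"
    by unfold_locales (simp_all add: F_def pure)
  have FG: "F z x y = F \<one>\<^bsub>C\<^esub> x y \<otimes>\<^bsub>?T\<^esub> r z"
    if "x \<in> carrier A" "y \<in> carrier B" "z \<in> carrier C" for x y z
    using that by (simp add: F_def r_def pure)
  have r_closed: "r z \<in> carrier (?T)" if "z \<in> carrier C" for z
    using that by (simp add: r_def F_def)
  have F_closed: "(\<lambda>(x, y). F z x y) \<in> carrier A \<times> carrier B \<rightarrow> carrier (?T)"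
    if "z \<in> carrier C" for z
    using that by (auto simp: F_def)
  have lin_ext_F: "lin_ext (?T) (\<lambda>(x, y). F z x y) p =
      lin_ext (?T) (\<lambda>(x, y). F \<one>\<^bsub>C\<^esub> x y) p \<otimes>\<^bsub>?T\<^esub> r z"
    if z: "z \<in> carrier C" and p: "keys p \<subseteq> carrier A \<times> carrier B" for z p
    using p
  proof (induction p rule: poly_mapping_span_induct)
    case zero
    then show ?case
      using r_closed[OF z] by simp
  next
    case (single m c)
    then obtain x y where m: "m = (x, y)" "x \<in> carrier A" "y \<in> carrier B"
      by auto
    then show ?case
      using r_closed[OF z] z A_BC.lin_ext_single[of "\<lambda>(x, y). F z x y" m c]
        A_BC.lin_ext_single[of "\<lambda>(x, y). F \<one>\<^bsub>C\<^esub> x y" m c]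
      by (simp add: FG[OF m(2,3) z] A_BC.smult_mult_left) (simp add: F_def A_BC.smult_mult_left)
  next
    case (add p r')
    then show ?case
      using F_closed[OF z] F_closed[OF C.one_closed] r_closed[OF z]
      by (simp add: A_BC.lin_ext_add[OF add(1,2)] A_BC.lin_ext_closed[OF add(1)]
          A_BC.lin_ext_closed[OF add(2)] A_BC.l_distr)
  qed
  have G: "G z t = G \<one>\<^bsub>C\<^esub> t \<otimes>\<^bsub>?T\<^esub> r z"
    if z: "z \<in> carrier C" and t: "t \<in> carrier (tensor A B)" for z t
  proof -
    obtain p where p: "t = AB.coset p" "keys p \<subseteq> carrier A \<times> carrier B"
      using t by (auto simp: AB.carrier_T AB.pretensor_simps)
    let ?l = "\<lambda>z. lin_ext (?T) (\<lambda>(x, y). F z x y)"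
    interpret I: ideal "tensor_ideal A B" "pretensor A B"
      by (rule AB.ideal_tensor_ideal)
    \<comment> \<open>The value is \<open>the_elem\<close> of the image of the coset, so the two
      linear extensions have to be compared on all representatives in \<open>t\<close> and not just
      on \<open>p\<close>.\<close>
    have "t \<subseteq> carrier (pretensor A B)"
      unfolding p(1) AB.coset_def using p(2)
      by (intro AB.PT.a_r_coset_subset_G I.a_subset) (simp add: AB.pretensor_simps)
    then have "?l z ` t = (\<lambda>u. ?l \<one>\<^bsub>C\<^esub> u \<otimes>\<^bsub>?T\<^esub> r z) ` t"
      by (intro image_cong[OF refl] lin_ext_F[OF z]) (auto simp: AB.pretensor_simps)
    also have "\<dots> = (\<lambda>v. v \<otimes>\<^bsub>?T\<^esub> r z) ` (?l \<one>\<^bsub>C\<^esub> ` t)"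
      by (simp add: image_image)
    also have "?l \<one>\<^bsub>C\<^esub> ` t = {?l \<one>\<^bsub>C\<^esub> p}"
      unfolding p(1) by (rule F.lin_ext_image_coset[OF p(2)])
    finally show ?thesis
      using F.lin_ext_image_coset[OF p(2)] by (simp add: G_def coset_ext_def p(1))
  qed
  have homG: "alg_hom (tensor A B) (?T) (G \<one>\<^bsub>C\<^esub>)"
    unfolding G_def by (rule F.alg_hom_coset_ext)
  have G_pure: "G \<one>\<^bsub>C\<^esub> (pure_tensor A B x y) = F \<one>\<^bsub>C\<^esub> x y" if "x \<in> carrier A" "y \<in> carrier B" for x y
    unfolding G_def by (rule F.coset_ext_pure) (use that in auto)
  note homG' = alg_homD[OF homG]
  \<comment> \<open>The last leg commutes with the first two; this is what makes the product of the
    two homomorphisms multiplicative.\<close>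
  have comm: "r z \<otimes>\<^bsub>?T\<^esub> G \<one>\<^bsub>C\<^esub> t = G \<one>\<^bsub>C\<^esub> t \<otimes>\<^bsub>?T\<^esub> r z"
    if "t \<in> carrier (tensor A B)" and z: "z \<in> carrier C" for t z
    using that(1)
  proof (induction t rule: AB.tensor_induct)
    case (pure x y)
    then show ?case
      using z by (simp add: G_pure F_def r_def A_BC.pure_mult BC.pure_mult)
  next
    case (add s t)
    then show ?case
      using r_closed[OF z] by (simp add: homG' A_BC.l_distr A_BC.r_distr)
  next
    case (smult c t)
    then show ?case
      using r_closed[OF z] by (simp add: homG' A_BC.smult_mult_left A_BC.smult_mult_right)
  qed
  have r_hom: "r (z \<otimes>\<^bsub>C\<^esub> z') = r z \<otimes>\<^bsub>?T\<^esub> r z'"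
    "r (z \<oplus>\<^bsub>C\<^esub> z') = r z \<oplus>\<^bsub>?T\<^esub> r z'"
    "r (c \<odot>\<^bsub>C\<^esub> z) = c \<odot>\<^bsub>?T\<^esub> r z"
    if "z \<in> carrier C" "z' \<in> carrier C" for c z z'
    using that by (simp_all add: r_def F_def pure)
  interpret H: bimultiplicative "tensor A B" C "?T" "\<lambda>t z. G z t"
  proof
    show "G \<one>\<^bsub>C\<^esub> \<one>\<^bsub>tensor A B\<^esub> = \<one>\<^bsub>?T\<^esub>"
      by (rule homG'(4))
    fix t z assume t: "t \<in> carrier (tensor A B)" and z: "z \<in> carrier C"
    note tz = homG'(1)[OF t] r_closed[OF z]
    show "G z t \<in> carrier (?T)"
      using tz by (simp add: G[OF z t])
    show "G (c \<odot>\<^bsub>C\<^esub> z) t = c \<odot>\<^bsub>?T\<^esub> G z t" for c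
      using tz by (simp add: G[OF C.smult_closed[OF z] t] G[OF z t] r_hom(3)[OF z z] A_BC.smult_mult_right)
    show "G z (c \<odot>\<^bsub>tensor A B\<^esub> t) = c \<odot>\<^bsub>?T\<^esub> G z t" for c
      using tz by (simp add: G[OF z AB.smult_closed[OF t]] G[OF z t] homG' t A_BC.smult_mult_left)
    show "G z (t \<oplus>\<^bsub>tensor A B\<^esub> t') = G z t \<oplus>\<^bsub>?T\<^esub> G z t'"
      if t': "t' \<in> carrier (tensor A B)" for t'
      using tz homG'(1)[OF t']
      by (simp add: G[OF z AB.a_closed[OF t t']] G[OF z t] G[OF z t'] homG'(3)[OF t t'] A_BC.l_distr)
    fix z' assume z': "z' \<in> carrier C"
    show "G (z \<oplus>\<^bsub>C\<^esub> z') t = G z t \<oplus>\<^bsub>?T\<^esub> G z' t"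
      using tz r_closed[OF z']
      by (simp add: G[OF C.a_closed[OF z z'] t] G[OF z t] G[OF z' t] r_hom(2)[OF z z'] A_BC.r_distr)
    fix t' assume t': "t' \<in> carrier (tensor A B)"
    note closed = tz homG'(1)[OF t'] r_closed[OF z']
    have "G z t \<otimes>\<^bsub>?T\<^esub> G z' t' = G \<one>\<^bsub>C\<^esub> t \<otimes>\<^bsub>?T\<^esub>
        (r z \<otimes>\<^bsub>?T\<^esub> G \<one>\<^bsub>C\<^esub> t') \<otimes>\<^bsub>?T\<^esub> r z'"
      using closed by (simp add: G[OF z t] G[OF z' t'] A_BC.m_assoc)
    also have "\<dots> = G (z \<otimes>\<^bsub>C\<^esub> z') (t \<otimes>\<^bsub>tensor A B\<^esub> t')"
      using closed
      by (simp add: comm[OF t' z] G[OF C.m_closed[OF z z'] AB.m_closed[OF t t']] homG'(2)[OF t t']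
          r_hom(1)[OF z z'] A_BC.m_assoc)
    finally show "G (z \<otimes>\<^bsub>C\<^esub> z') (t \<otimes>\<^bsub>tensor A B\<^esub> t') =
        G z t \<otimes>\<^bsub>?T\<^esub> G z' t'" by simp
  qed
  have assoc: "tensor_assoc A B C = coset_ext (?T) (\<lambda>(t, z). G z t)"
    by (simp add: tensor_assoc_def G_def F_def)
  show "alg_hom (tensor (tensor A B) C) (?T) (tensor_assoc A B C)"
    unfolding assoc by (rule H.alg_hom_coset_ext)
  show "tensor_assoc A B C (pure_tensor (tensor A B) C (pure_tensor A B x y) z) =
        pure_tensor A (tensor B C) x (pure_tensor B C y z)"
    if "x \<in> carrier A" "y \<in> carrier B" "z \<in> carrier C"
    using that H.coset_ext_pure[of "pure_tensor A B x y" z] G[of z "pure_tensor A B x y"]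
    by (simp add: assoc G_pure FG[of x y z, symmetric]) (simp add: F_def)
qed

lemma complex_star_algebra_tensor:
  assumes "complex_star_algebra A" "complex_star_algebra B"
  shows "complex_star_algebra (tensor A B)"
    and "x \<in> carrier A \<Longrightarrow> y \<in> carrier B \<Longrightarrow>
      star (tensor A B) (pure_tensor A B x y) = pure_tensor A B (star A x) (star B y)"
proof -
  interpret A: complex_star_algebra A by fact
  interpret B: complex_star_algebra B by fact
  interpret AB: tensor_product A B by unfold_locales
  have PT: "complex_star_algebra (pretensor A B)"
    unfolding pretensor_def
  proof (rule complex_star_algebra_monoid_alg[OF AB.monoid_DirProd])
    show "(\<lambda>(x, y). single (star A x, star B y) 1) =
        (\<lambda>m. single (star A (fst m), star B (snd m)) 1)"
      by (rule ext) (simp add: case_prod_beta)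
  qed (auto simp: A.star_mult B.star_mult mult_DirProd')
  have star: "star (pretensor A B) (p - r) = star (pretensor A B) p - star (pretensor A B) r"
    "star (pretensor A B) (single (x, y) c) =
      single (star A x, star B y) (cnj c)" for p r x y c
    by (simp_all add: pretensor_def monoid_alg_star_diff)
  \<comment> \<open>The star permutes the bilinearity relations and conjugates the scalar in
    them.\<close>
  have star_rels: "star (pretensor A B) r \<in> bilinear_rels A B" if "r \<in> bilinear_rels A B" for r
    using that[unfolded bilinear_rels_def]
    by (elim UnE CollectE exE conjE)
      (simp_all only: star A.star_add B.star_add A.star_smult B.star_smult complex_cnj_one
        bilinear_relsI A.star_closed B.star_closed)
  have rels: "star (pretensor A B) r \<in> tensor_ideal A B" if "r \<in> bilinear_rels A B" for r
    unfolding tensor_ideal_def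
    by (rule subsetD[OF AB.PT.genideal_self[OF AB.bilinear_rels_carrier] star_rels[OF that]])
  have "star (pretensor A B) p \<in> tensor_ideal A B" if "p \<in> tensor_ideal A B" for p
    unfolding tensor_ideal_def
    by (rule complex_star_algebra.star_stable_Idl[OF PT AB.bilinear_rels_carrier
          rels[unfolded tensor_ideal_def] that[unfolded tensor_ideal_def]])
  note quot = complex_star_algebra.complex_star_algebra_quot_alg[OF PT AB.ideal_tensor_ideal this]
  show "complex_star_algebra (tensor A B)"
    unfolding tensor_def by (rule quot(1))
  show "x \<in> carrier A \<Longrightarrow> y \<in> carrier B \<Longrightarrow>
      star (tensor A B) (pure_tensor A B x y) = pure_tensor A B (star A x) (star B y)"
    using quot(2)[of "single (x, y) 1"]
    by (simp add: tensor_def pure_tensor_def star AB.pretensor_simps)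
qed

section \<open>The algebras \<open>A\<close> and \<open>B\<close>\<close>

text \<open>The points of the presentation with values in \<open>C\<close>: such families correspond
  to algebra homomorphisms from \<open>U_alg q \<mu> \<nu>\<close> to \<open>C\<close>.\<close>

definition u_solution :: "real \<Rightarrow> real \<Rightarrow> real \<Rightarrow> 'a star_alg \<Rightarrow> (ugen \<Rightarrow> 'a) \<Rightarrow> bool" where
  "u_solution q \<mu> \<nu> C f \<longleftrightarrow> (\<forall>g. f g \<in> carrier C) \<and>
     f UKinv \<otimes>\<^bsub>C\<^esub> f UK = \<one>\<^bsub>C\<^esub> \<and> f UK \<otimes>\<^bsub>C\<^esub> f UKinv = \<one>\<^bsub>C\<^esub> \<and>
     f UK \<otimes>\<^bsub>C\<^esub> f UE = complex_of_real q \<odot>\<^bsub>C\<^esub> (f UE \<otimes>\<^bsub>C\<^esub> f UK) \<and>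
     f UK \<otimes>\<^bsub>C\<^esub> f UF = complex_of_real (inverse q) \<odot>\<^bsub>C\<^esub> (f UF \<otimes>\<^bsub>C\<^esub> f UK) \<and>
     f UE \<otimes>\<^bsub>C\<^esub> f UF \<ominus>\<^bsub>C\<^esub> f UF \<otimes>\<^bsub>C\<^esub> f UE =
       complex_of_real (qlam q * \<mu>) \<odot>\<^bsub>C\<^esub> (f UK \<otimes>\<^bsub>C\<^esub> f UK)
         \<ominus>\<^bsub>C\<^esub> complex_of_real (qlam q * \<nu>) \<odot>\<^bsub>C\<^esub> (f UKinv \<otimes>\<^bsub>C\<^esub> f UKinv)"

definition casimir_value :: "real \<Rightarrow> real \<Rightarrow> real \<Rightarrow> 'a star_alg \<Rightarrow> (ugen \<Rightarrow> 'a) \<Rightarrow> 'a" where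
  "casimir_value q \<mu> \<nu> C f = f UE \<otimes>\<^bsub>C\<^esub> f UF \<oplus>\<^bsub>C\<^esub>
     complex_of_real ((qlam q)\<^sup>2) \<odot>\<^bsub>C\<^esub>
       (complex_of_real (inverse q * \<mu>) \<odot>\<^bsub>C\<^esub> (f UK \<otimes>\<^bsub>C\<^esub> f UK) \<oplus>\<^bsub>C\<^esub>
        complex_of_real (q * \<nu>) \<odot>\<^bsub>C\<^esub> (f UKinv \<otimes>\<^bsub>C\<^esub> f UKinv))"

lemma u_solution_closed: "u_solution q \<mu> \<nu> C f \<Longrightarrow> f g \<in> carrier C"
  by (simp add: u_solution_def)

lemma casimir_value_closed:
  assumes "complex_algebra C" "u_solution q \<mu> \<nu> C f"
  shows "casimir_value q \<mu> \<nu> C f \<in> carrier C"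
proof -
  interpret complex_algebra C by fact
  show ?thesis
    using u_solution_closed[OF assms(2)] by (simp add: casimir_value_def)
qed

lemma alg_hom_solution:
  assumes "complex_algebra C" "complex_algebra D" "alg_hom C D h" "u_solution q \<mu> \<nu> C f"
  shows "u_solution q \<mu> \<nu> D (\<lambda>g. h (f g))"
    and "casimir_value q \<mu> \<nu> D (\<lambda>g. h (f g)) = h (casimir_value q \<mu> \<nu> C f)"
proof -
  interpret C: complex_algebra C by fact
  interpret D: complex_algebra D by fact
  note f = u_solution_closed[OF assms(4)]
  note h = alg_homD(2-5)[OF assms(3), symmetric] alg_hom_more(3)[OF assms(3,1,2), symmetric]
  show "u_solution q \<mu> \<nu> D (\<lambda>g. h (f g))"
    using assms(4) alg_homD(1)[OF assms(3)] unfolding u_solution_def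
    by (simp only: h C.m_closed C.smult_closed simp_thms all_simps)
  show "casimir_value q \<mu> \<nu> D (\<lambda>g. h (f g)) = h (casimir_value q \<mu> \<nu> C f)"
    unfolding casimir_value_def
    by (simp only: h f C.m_closed C.smult_closed C.a_closed)
qed

context complex_algebra
begin

lemma lin_ext_word_value:
  assumes "\<And>g. f g \<in> carrier A"
  shows "lin_ext A (word_value A f) (p - r) = lin_ext A (word_value A f) p \<ominus> lin_ext A (word_value A f) r"
    and "lin_ext A (word_value A f) (single w c) = c \<odot> word_value A f w"
proof -
  have closed: "word_value A f w \<in> carrier A" for w
    by (induction w) (simp_all add: assms)
  then show "lin_ext A (word_value A f) (single w c) = c \<odot> word_value A f w"
    by (rule lin_ext_single)
  have *: "word_value A f \<in> UNIV \<rightarrow> carrier A"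
    by (simp add: closed)
  have "lin_ext A (word_value A f) p =
      lin_ext A (word_value A f) (p - r) \<oplus> lin_ext A (word_value A f) r"
    using lin_ext_add[OF subset_UNIV subset_UNIV *, of "p - r" r] by simp
  then show "lin_ext A (word_value A f) (p - r) =
      lin_ext A (word_value A f) p \<ominus> lin_ext A (word_value A f) r"
    using lin_ext_closed[OF subset_UNIV *]
    by (metis a_assoc a_inv_closed minus_eq r_neg r_zero)
qed

end

lemma U_lift:
  assumes C: "complex_algebra C" and f: "u_solution q \<mu> \<nu> C f"
  shows "alg_hom (U_alg q \<mu> \<nu>) C (alg_hom_ext C f)"
    and "alg_hom_ext C f (u_gen q \<mu> \<nu> g) = f g"
proof -
  interpret C: complex_algebra C by fact
  interpret U: presentation u_star "u_rels q \<mu> \<nu>" .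
  note closed = u_solution_closed[OF f]
  have "lin_ext C (word_value C f) r = \<zero>\<^bsub>C\<^esub>" if "r \<in> u_rels q \<mu> \<nu>" for r
    using that f unfolding u_rels_def u_solution_def
    by (auto simp: C.lin_ext_word_value closed Let_def)
  note lift = U.alg_hom_alg_hom_ext[OF C closed this]
  show "alg_hom (U_alg q \<mu> \<nu>) C (alg_hom_ext C f)"
    unfolding U_alg_def by (rule lift)
  show "alg_hom_ext C f (u_gen q \<mu> \<nu> g) = f g"
    unfolding u_gen_def by (rule lift)
qed

lemma complex_star_algebra_U: "complex_star_algebra (U_alg q \<mu> \<nu>)"
  and star_u_gen: "star (U_alg q \<mu> \<nu>) (u_gen q \<mu> \<nu> g) = u_gen q \<mu> \<nu> (snd (u_star g))"
  and u_solution_U: "u_solution q \<mu> \<nu> (U_alg q \<mu> \<nu>) (u_gen q \<mu> \<nu>)"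
  if "q \<noteq> 0"
proof -
  define R where "R = u_rels q \<mu> \<nu>"
  interpret U: presentation u_star R .
  have "\<forall>r\<in>u_rels q \<mu> \<nu>. U.coset r = \<zero>\<^bsub>U.Q\<^esub>"
    using U.coset_relation by (simp add: R_def)
  then have sol: "u_solution q \<mu> \<nu> U.Q U.gen"
    unfolding u_solution_def by (simp add: u_rels_def Let_def U.coset_diff U.coset_word)
  have invol: "snd (u_star (snd (u_star g))) = g" "cnj (fst (u_star g)) * fst (u_star (snd (u_star g))) = 1"
    for g
    by (cases g; simp)+
  \<comment> \<open>The star exchanges the two inverse relations, exchanges the relations for
    \<open>KE\<close> and \<open>KF\<close> up to a nonzero scalar, and fixes the commutator
    relation.\<close>
  have "U.coset (star (free_alg u_star) r) = \<zero>\<^bsub>U.Q\<^esub>" if "r \<in> R" for r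
  proof -
    have "r \<in> u_rels q \<mu> \<nu>"
      using that by (simp add: R_def)
    then show ?thesis
      using sol \<open>q \<noteq> 0\<close> unfolding u_rels_def u_solution_def Let_def
      by (elim insertE emptyE)
        (simp_all add: free_alg_star_simps U.coset_diff U.coset_word U.smult_assoc[symmetric])
  qed
  note star = U.star_presented[OF invol this]
  show "complex_star_algebra (U_alg q \<mu> \<nu>)"
    using star(1) by (simp add: U_alg_def R_def)
  show "star (U_alg q \<mu> \<nu>) (u_gen q \<mu> \<nu> g) = u_gen q \<mu> \<nu> (snd (u_star g))"
    using star(2)[of g] by (cases g) (simp_all add: U_alg_def u_gen_def flip: R_def)
  show "u_solution q \<mu> \<nu> (U_alg q \<mu> \<nu>) (u_gen q \<mu> \<nu>)"
    using sol by (simp add: U_alg_def u_gen_def R_def)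
qed

lemma Casimir_eq: "Casimir q \<mu> \<nu> = casimir_value q \<mu> \<nu> (U_alg q \<mu> \<nu>) (u_gen q \<mu> \<nu>)"
  by (simp add: Casimir_def casimir_value_def Let_def)

section \<open>The Casimir quotient of the quantum algebra\<close>

locale quantum_parameters =
  fixes q \<mu> \<nu> \<tau> :: real
  assumes q_pos: "0 < q" and q_less_1: "q < 1"
begin

lemma q_nonzero [simp]: "q \<noteq> 0"
  using q_pos by simp

abbreviation "UU \<equiv> U_alg q \<mu> \<nu>"
abbreviation "AA \<equiv> A_alg q \<mu> \<nu> \<tau>"
abbreviation "BB \<equiv> B_alg q \<mu> \<nu> \<tau>"
abbreviation A_mult (infixl "\<otimes>\<^sub>A" 70) where "x \<otimes>\<^sub>A y \<equiv> x \<otimes>\<^bsub>AA\<^esub> y"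
abbreviation A_add (infixl "\<oplus>\<^sub>A" 65) where "x \<oplus>\<^sub>A y \<equiv> x \<oplus>\<^bsub>AA\<^esub> y"
abbreviation A_minus (infixl "\<ominus>\<^sub>A" 65) where "x \<ominus>\<^sub>A y \<equiv> x \<ominus>\<^bsub>AA\<^esub> y"
abbreviation A_smult (infixl "\<odot>\<^sub>A" 70) where "c \<odot>\<^sub>A x \<equiv> c \<odot>\<^bsub>AA\<^esub> x"
abbreviation A_one ("\<one>\<^sub>A") where "\<one>\<^sub>A \<equiv> \<one>\<^bsub>AA\<^esub>"
abbreviation "ug \<equiv> u_gen q \<mu> \<nu>"
abbreviation "ag g \<equiv> A_proj q \<mu> \<nu> \<tau> (ug g)"

sublocale U: complex_star_algebra UU
  by (rule complex_star_algebra_U) simp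

lemmas ug_solution = u_solution_U[OF q_nonzero]
lemmas ug_closed [simp, intro] = u_solution_closed[OF ug_solution]
lemmas star_ug = star_u_gen[OF q_nonzero]

abbreviation "central_value \<equiv> complex_of_real (\<tau> * inverse q * (qlam q)\<^sup>2) \<odot>\<^bsub>UU\<^esub> \<one>\<^bsub>UU\<^esub>"

lemma Casimir_closed [simp]: "Casimir q \<mu> \<nu> \<in> carrier UU"
  unfolding Casimir_eq by (rule casimir_value_closed[OF U.complex_algebra_axioms ug_solution])

lemma star_Casimir: "star UU (Casimir q \<mu> \<nu>) = Casimir q \<mu> \<nu>"
  unfolding Casimir_eq casimir_value_def
  by (simp add: U.star_add U.star_smult U.star_mult star_ug)

lemma A_ideal_eq: "A_ideal q \<mu> \<nu> \<tau> = Idl\<^bsub>UU\<^esub> {Casimir q \<mu> \<nu> \<ominus>\<^bsub>UU\<^esub> central_value}"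
  by (simp add: A_ideal_def Let_def)

lemma ideal_A_ideal: "ideal (A_ideal q \<mu> \<nu> \<tau>) UU"
  unfolding A_ideal_eq by (rule U.genideal_ideal) simp

lemma A_ideal_star: "x \<in> A_ideal q \<mu> \<nu> \<tau> \<Longrightarrow> star UU x \<in> A_ideal q \<mu> \<nu> \<tau>"
  unfolding A_ideal_eq
  by (erule U.star_stable_Idl[rotated 2])
    (simp_all add: U.star_a_minus star_Casimir U.star_smult U.genideal_self')

sublocale A: complex_star_algebra AA
  unfolding A_alg_def by (rule U.complex_star_algebra_quot_alg[OF ideal_A_ideal A_ideal_star])

lemma alg_hom_A_proj: "alg_hom UU AA (A_proj q \<mu> \<nu> \<tau>)"
  using U.alg_hom_quot_alg(1)[OF ideal_A_ideal] by (simp add: A_alg_def A_proj_def[abs_def])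

lemma star_A_proj: "x \<in> carrier UU \<Longrightarrow> star AA (A_proj q \<mu> \<nu> \<tau> x) = A_proj q \<mu> \<nu> \<tau> (star UU x)"
  unfolding A_alg_def A_proj_def
  by (rule U.complex_star_algebra_quot_alg(2)[OF ideal_A_ideal A_ideal_star])

lemma star_ag: "star AA (ag g) = ag (snd (u_star g))"
  by (simp add: star_A_proj star_ug)

lemma ag_solution: "u_solution q \<mu> \<nu> AA ag"
  by (rule alg_hom_solution[OF U.complex_algebra_axioms A.complex_algebra_axioms alg_hom_A_proj
        ug_solution])

lemmas ag_closed [simp, intro] = u_solution_closed[OF ag_solution]

lemma ag_casimir:
  "casimir_value q \<mu> \<nu> AA ag = complex_of_real (\<tau> * inverse q * (qlam q)\<^sup>2) \<odot>\<^sub>A \<one>\<^sub>A"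
proof -
  have "casimir_value q \<mu> \<nu> AA ag = A_proj q \<mu> \<nu> \<tau> (Casimir q \<mu> \<nu>)"
    unfolding Casimir_eq
    by (rule alg_hom_solution[OF U.complex_algebra_axioms A.complex_algebra_axioms alg_hom_A_proj
        ug_solution])
  also have "\<dots> = A_proj q \<mu> \<nu> \<tau> central_value"
    unfolding A_proj_def A_ideal_eq by (rule U.quot_alg_eqI) simp_all
  finally show ?thesis
    by (simp add: alg_homD[OF alg_hom_A_proj])
qed

lemma A_lift:
  assumes C: "complex_algebra C" and f: "u_solution q \<mu> \<nu> C f"
    and cas: "casimir_value q \<mu> \<nu> C f = complex_of_real (\<tau> * inverse q * (qlam q)\<^sup>2) \<odot>\<^bsub>C\<^esub> \<one>\<^bsub>C\<^esub>"
  obtains h where "alg_hom AA C h" "\<And>g. h (ag g) = f g"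
proof
  interpret C: complex_algebra C by fact
  note lift = U_lift[OF C f]
  have "alg_hom_ext C f (Casimir q \<mu> \<nu>) = casimir_value q \<mu> \<nu> C f"
    using alg_hom_solution(2)[OF U.complex_algebra_axioms C lift(1) ug_solution]
    by (simp add: Casimir_eq lift(2))
  then have "alg_hom_ext C f (Casimir q \<mu> \<nu> \<ominus>\<^bsub>UU\<^esub> central_value) = \<zero>\<^bsub>C\<^esub>"
    by (simp add: alg_hom_more[OF lift(1) U.complex_algebra_axioms C] alg_homD[OF lift(1)] cas)
  then have zero: "alg_hom_ext C f x = \<zero>\<^bsub>C\<^esub>" if "x \<in> A_ideal q \<mu> \<nu> \<tau>" for x
    using U.alg_hom_zero_on_Idl[OF C lift(1) _ _ that[unfolded A_ideal_eq]] by simp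
  show "alg_hom AA C (\<lambda>X. the_elem (alg_hom_ext C f ` X))"
    unfolding A_alg_def by (rule U.alg_hom_the_elem_quot[OF C lift(1) ideal_A_ideal zero])
  show "the_elem (alg_hom_ext C f ` ag g) = f g" for g
    using U.the_elem_hom_coset[OF C lift(1) ideal_A_ideal zero, of "ug g"]
    by (simp add: A_proj_def lift(2))
qed

subsection \<open>Relations between \<open>X\<close>, \<open>X\<^sup>*\<close> and \<open>Z\<close>\<close>

abbreviation "X \<equiv> B_X q \<mu> \<nu> \<tau>"
abbreviation "Z \<equiv> B_Z q \<mu> \<nu> \<tau>"

definition Xs where "Xs = star AA X"

definition cX :: real where "cX = sqrt q * (inverse q - q)"

lemma cX_pos: "cX > 0"
  using q_pos q_less_1 one_less_inverse[OF q_pos q_less_1] by (simp add: cX_def)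

text \<open>The normalisation of \<open>X\<close> is chosen for this: it clears
  \<open>qlam q\<close> from the products of \<open>X\<close> and \<open>Xs\<close>, leaving
  polynomials in \<open>Z\<close> with simple coefficients.\<close>

lemma cX_qlam: "cX\<^sup>2 * (qlam q)\<^sup>2 = q"
proof -
  have "inverse q - q \<noteq> 0"
    using cX_pos by (auto simp: cX_def)
  moreover have "qlam q = - inverse (inverse q - q)"
    by (simp add: qlam_def flip: inverse_minus_eq)
  ultimately show ?thesis
    using q_pos by (simp add: cX_def power_mult_distrib power_inverse)
qed

lemma X_eq: "X = complex_of_real cX \<odot>\<^sub>A (ag UF \<otimes>\<^sub>A ag UK)"
  by (simp add: B_X_def cX_def alg_homD(2)[OF alg_hom_A_proj])

lemma Xs_eq: "Xs = complex_of_real cX \<odot>\<^sub>A (ag UK \<otimes>\<^sub>A ag UE)"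
  by (simp add: Xs_def X_eq A.star_smult A.star_mult star_ag)

lemma Z_eq: "Z = ag UK \<otimes>\<^sub>A ag UK"
  by (simp add: B_Z_def alg_homD(2)[OF alg_hom_A_proj])

lemma XZ_closed [simp, intro]: "X \<in> carrier AA" "Xs \<in> carrier AA" "Z \<in> carrier AA"
  by (simp_all add: X_eq Xs_eq Z_eq)

lemma star_XZ: "star AA X = Xs" "star AA Xs = X" "star AA Z = Z"
  by (simp_all add: Xs_def Z_eq A.star_mult star_ag)

end

text \<open>Here \<open>k\<close>, \<open>k'\<close>, \<open>e\<close>, \<open>f\<close> are the
  images of \<open>K\<close>, its inverse, \<open>E\<close>, \<open>F\<close>, and \<open>i\<close>
  is that of the unit. The Casimir relation solves for \<open>e * f\<close>, and the commutator then
  gives \<open>f * e\<close>; moving \<open>k\<close> through the products yields the quadratic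
  expressions in \<open>k * k\<close>.\<close>

lemma real_algebra_XZ:
  fixes k k' e f i :: "'a :: real_algebra" and q \<mu> \<nu> \<tau> lam :: real
  assumes unit: "i * k = k" "k * i = k" "i * e = e" "e * i = e" "i * f = f" "f * i = f" "i * k' = k'"
    "k' * i = k'" "i * i = i"
    and inv: "k' * k = i" "k * k' = i"
    and comm: "k * e = q *\<^sub>R (e * k)" "k * f = inverse q *\<^sub>R (f * k)"
    and ef: "e * f - f * e = (lam * \<mu>) *\<^sub>R (k * k) - (lam * \<nu>) *\<^sub>R (k' * k')"
    and cas: "e * f + lam\<^sup>2 *\<^sub>R ((inverse q * \<mu>) *\<^sub>R (k * k) + (q * \<nu>) *\<^sub>R (k' * k')) =
      (\<tau> * inverse q * lam\<^sup>2) *\<^sub>R i"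
    and q: "q \<noteq> 0" and lam: "lam * (q - inverse q) = 1"
  shows "(f * k) * (k * k) = q\<^sup>2 *\<^sub>R ((k * k) * (f * k))"
    and "(k * e) * (k * k) = inverse (q\<^sup>2) *\<^sub>R ((k * k) * (k * e))"
    and "(f * k) * (k * e) =
      (q * lam\<^sup>2) *\<^sub>R ((- \<nu>) *\<^sub>R i + \<tau> *\<^sub>R (k * k) - (q\<^sup>2 * \<mu>) *\<^sub>R ((k * k) * (k * k)))"
    and "(k * e) * (f * k) =
      lam\<^sup>2 *\<^sub>R ((- q * \<nu>) *\<^sub>R i + (\<tau> * inverse q) *\<^sub>R (k * k) - (inverse q * \<mu>) *\<^sub>R ((k * k) * (k * k)))"
proof -
  have comm': "k * (e * x) = q *\<^sub>R (e * (k * x))" "k * (f * x) = inverse q *\<^sub>R (f * (k * x))" for x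
    using comm by (metis mult.assoc mult_scaleR_left)+
  have unit': "i * (k * x) = k * x" for x
    using unit(1) by (metis mult.assoc)
  have qq: "q * (q * (inverse q * inverse q)) = 1"
    "inverse q * (inverse q * (q * q)) = 1"
    using q by (simp_all add: field_simps)
  have inv': "k' * (k * x) = i * x" "k * (k' * x) = i * x" for x
    using inv by (metis mult.assoc)+
  have ef_eq: "e * f = (\<tau> * inverse q * lam\<^sup>2) *\<^sub>R i -
      lam\<^sup>2 *\<^sub>R ((inverse q * \<mu>) *\<^sub>R (k * k) + (q * \<nu>) *\<^sub>R (k' * k'))"
    using cas by (simp add: algebra_simps)
  have "f * e = e * f - ((lam * \<mu>) *\<^sub>R (k * k) - (lam * \<nu>) *\<^sub>R (k' * k'))"
    using ef by (simp add: algebra_simps)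
  also have "\<dots> = (\<tau> * inverse q * lam\<^sup>2) *\<^sub>R i - (lam\<^sup>2 * inverse q * \<mu> + lam * \<mu>) *\<^sub>R (k * k)
      - (lam\<^sup>2 * q * \<nu> - lam * \<nu>) *\<^sub>R (k' * k')"
    unfolding ef_eq by (simp add: algebra_simps scaleR_right_distrib scaleR_left_distrib scaleR_left_diff_distrib)
  also have "lam\<^sup>2 * inverse q * \<mu> + lam * \<mu> = lam\<^sup>2 * inverse q * \<mu> + lam * \<mu> * (lam * (q - inverse q))"
    by (simp add: lam)
  \<comment> \<open>Inserting \<open>lam * (q - inverse q) = 1\<close> brings the commutator term to
    the same degree in \<open>lam\<close> as the Casimir term, and the two merge because
    \<open>inverse q + (q - inverse q) = q\<close>.\<close>
  also have "\<dots> = lam\<^sup>2 * q * \<mu>"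
    by (simp add: algebra_simps power2_eq_square)
  also have "lam\<^sup>2 * q * \<nu> - lam * \<nu> = lam\<^sup>2 * q * \<nu> - lam * \<nu> * (lam * (q - inverse q))"
    by (simp add: lam)
  also have "\<dots> = lam\<^sup>2 * inverse q * \<nu>"
    by (simp add: algebra_simps power2_eq_square)
  finally have fe: "f * e = (\<tau> * inverse q * lam\<^sup>2) *\<^sub>R i - (lam\<^sup>2 * q * \<mu>) *\<^sub>R (k * k)
      - (lam\<^sup>2 * inverse q * \<nu>) *\<^sub>R (k' * k')" .
  show "(f * k) * (k * k) = q\<^sup>2 *\<^sub>R ((k * k) * (f * k))"
    using q by (simp add: mult.assoc comm' power2_eq_square qq)
  show "(k * e) * (k * k) = inverse (q\<^sup>2) *\<^sub>R ((k * k) * (k * e))"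
    using q by (simp add: mult.assoc comm comm' power2_eq_square qq)
  have "(f * k) * (k * e) = q\<^sup>2 *\<^sub>R ((f * e) * (k * k))"
    by (simp add: mult.assoc comm comm' power2_eq_square)
  also have "\<dots> = (q * lam\<^sup>2) *\<^sub>R ((- \<nu>) *\<^sub>R i + \<tau> *\<^sub>R (k * k) - (q\<^sup>2 * \<mu>) *\<^sub>R ((k * k) * (k * k)))"
    unfolding fe using q
    by (simp add: algebra_simps mult.assoc inv inv' unit unit' power2_eq_square)
  finally show "(f * k) * (k * e) =
      (q * lam\<^sup>2) *\<^sub>R ((- \<nu>) *\<^sub>R i + \<tau> *\<^sub>R (k * k) - (q\<^sup>2 * \<mu>) *\<^sub>R ((k * k) * (k * k)))" .
  have "(k * e) * (f * k) = (e * f) * (k * k)"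
    using q by (simp add: mult.assoc comm comm')
  also have "\<dots> = lam\<^sup>2 *\<^sub>R ((- q * \<nu>) *\<^sub>R i + (\<tau> * inverse q) *\<^sub>R (k * k) -
      (inverse q * \<mu>) *\<^sub>R ((k * k) * (k * k)))"
    unfolding ef_eq using q
    by (simp add: algebra_simps mult.assoc inv inv' unit unit' power2_eq_square)
  finally show "(k * e) * (f * k) =
      lam\<^sup>2 *\<^sub>R ((- q * \<nu>) *\<^sub>R i + (\<tau> * inverse q) *\<^sub>R (k * k) - (inverse q * \<mu>) *\<^sub>R ((k * k) * (k * k)))" .
qed

context quantum_parameters
begin

lemma qlam_mult: "qlam q * (q - inverse q) = 1"
  using one_less_inverse[OF q_pos q_less_1] q_less_1 by (simp add: qlam_def)

lemma XZ_relations: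
  "X \<otimes>\<^sub>A Z = complex_of_real (q\<^sup>2) \<odot>\<^sub>A (Z \<otimes>\<^sub>A X)"
  "Xs \<otimes>\<^sub>A Z = complex_of_real (inverse (q\<^sup>2)) \<odot>\<^sub>A (Z \<otimes>\<^sub>A Xs)"
  "X \<otimes>\<^sub>A Xs = complex_of_real (- (q\<^sup>2) * \<nu>) \<odot>\<^sub>A \<one>\<^sub>A \<oplus>\<^sub>A
    complex_of_real (q\<^sup>2 * \<tau>) \<odot>\<^sub>A Z \<ominus>\<^sub>A complex_of_real (q^4 * \<mu>) \<odot>\<^sub>A (Z \<otimes>\<^sub>A Z)"
  "Xs \<otimes>\<^sub>A X = complex_of_real (- (q\<^sup>2) * \<nu>) \<odot>\<^sub>A \<one>\<^sub>A \<oplus>\<^sub>A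
    complex_of_real \<tau> \<odot>\<^sub>A Z \<ominus>\<^sub>A complex_of_real \<mu> \<odot>\<^sub>A (Z \<otimes>\<^sub>A Z)"
proof -
  let ?i = "in_family AA"
  note simps = A.in_family_simps
  have unit: "?i \<one>\<^sub>A * ?i x = ?i x" "?i x * ?i \<one>\<^sub>A = ?i x" if "x \<in> carrier AA" for x
    using that by (simp_all flip: simps)
  have rels': "?i (ag UKinv) * ?i (ag UK) = ?i \<one>\<^sub>A" "?i (ag UK) * ?i (ag UKinv) = ?i \<one>\<^sub>A"
    "?i (ag UK) * ?i (ag UE) = q *\<^sub>R (?i (ag UE) * ?i (ag UK))"
    "?i (ag UK) * ?i (ag UF) = inverse q *\<^sub>R (?i (ag UF) * ?i (ag UK))"
    "?i (ag UE) * ?i (ag UF) - ?i (ag UF) * ?i (ag UE) = (qlam q * \<mu>) *\<^sub>R (?i (ag UK) * ?i (ag UK))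
      - (qlam q * \<nu>) *\<^sub>R (?i (ag UKinv) * ?i (ag UKinv))"
    "?i (ag UE) * ?i (ag UF) + (qlam q)\<^sup>2 *\<^sub>R ((inverse q * \<mu>) *\<^sub>R (?i (ag UK) * ?i (ag UK)) +
      (q * \<nu>) *\<^sub>R (?i (ag UKinv) * ?i (ag UKinv))) = (\<tau> * inverse q * (qlam q)\<^sup>2) *\<^sub>R ?i \<one>\<^sub>A"
    using ag_solution ag_casimir unfolding u_solution_def casimir_value_def
    by (simp_all add: A.in_family_eq_iff flip: simps del: of_real_mult of_real_inverse of_real_power)
  note ident = real_algebra_XZ[OF unit(1)[OF ag_closed] unit(2)[OF ag_closed] unit(1)[OF ag_closed]
      unit(2)[OF ag_closed] unit(1)[OF ag_closed] unit(2)[OF ag_closed] unit(1)[OF ag_closed]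
      unit(2)[OF ag_closed] unit(1)[OF A.one_closed] rels' q_nonzero qlam_mult]
  have X: "?i X = cX *\<^sub>R (?i (ag UF) * ?i (ag UK))" "?i Xs = cX *\<^sub>R (?i (ag UK) * ?i (ag UE))"
    "?i Z = ?i (ag UK) * ?i (ag UK)"
    by (simp_all add: X_eq Xs_eq Z_eq simps del: of_real_inverse)
  show "X \<otimes>\<^sub>A Z = complex_of_real (q\<^sup>2) \<odot>\<^sub>A (Z \<otimes>\<^sub>A X)"
    by (rule A.in_family_inject) (simp_all add: simps X ident(1) del: of_real_power)
  show "Xs \<otimes>\<^sub>A Z = complex_of_real (inverse (q\<^sup>2)) \<odot>\<^sub>A (Z \<otimes>\<^sub>A Xs)"
    by (rule A.in_family_inject) (simp_all add: simps X ident(2) del: of_real_power of_real_inverse)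
  have "?i (X \<otimes>\<^sub>A Xs) = (cX\<^sup>2 * (qlam q)\<^sup>2 * q) *\<^sub>R
      ((- \<nu>) *\<^sub>R ?i \<one>\<^sub>A + \<tau> *\<^sub>R ?i Z - (q\<^sup>2 * \<mu>) *\<^sub>R (?i Z * ?i Z))"
    by (simp add: simps X ident(3) power2_eq_square)
  also have "cX\<^sup>2 * (qlam q)\<^sup>2 * q = q\<^sup>2"
    by (simp only: cX_qlam) (simp add: power2_eq_square)
  finally show "X \<otimes>\<^sub>A Xs = complex_of_real (- (q\<^sup>2) * \<nu>) \<odot>\<^sub>A \<one>\<^sub>A \<oplus>\<^sub>A
    complex_of_real (q\<^sup>2 * \<tau>) \<odot>\<^sub>A Z \<ominus>\<^sub>A complex_of_real (q^4 * \<mu>) \<odot>\<^sub>A (Z \<otimes>\<^sub>A Z)"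
    by (intro A.in_family_inject)
      (simp_all add: simps scaleR_right_distrib scaleR_right_diff_distrib power2_eq_square
        power4_eq_xxxx mult.assoc del: of_real_power of_real_mult of_real_minus)
  have qq: "q * (\<tau> * inverse q) = \<tau>" "q * (inverse q * \<mu>) = \<mu>"
    by simp_all
  have "?i (Xs \<otimes>\<^sub>A X) = (cX\<^sup>2 * (qlam q)\<^sup>2) *\<^sub>R ((- q * \<nu>) *\<^sub>R ?i \<one>\<^sub>A +
      (\<tau> * inverse q) *\<^sub>R ?i Z - (inverse q * \<mu>) *\<^sub>R (?i Z * ?i Z))"
    by (simp add: simps X ident(4) power2_eq_square)
  also have "cX\<^sup>2 * (qlam q)\<^sup>2 = q"
    by (rule cX_qlam)
  finally show "Xs \<otimes>\<^sub>A X = complex_of_real (- (q\<^sup>2) * \<nu>) \<odot>\<^sub>A \<one>\<^sub>A \<oplus>\<^sub>A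
    complex_of_real \<tau> \<odot>\<^sub>A Z \<ominus>\<^sub>A complex_of_real \<mu> \<odot>\<^sub>A (Z \<otimes>\<^sub>A Z)"
    by (intro A.in_family_inject)
      (simp_all add: simps scaleR_right_distrib scaleR_right_diff_distrib power2_eq_square
        mult.assoc qq del: of_real_power of_real_mult of_real_minus)
qed

subsection \<open>A spanning set of \<open>B\<close>\<close>

text \<open>Iterated left multiplication: the successor step peels off the leftmost factor, which
  matches operators acting from the left in both the spanning and the independence
  arguments.\<close>

definition left_pow :: "(ugen list \<Rightarrow>\<^sub>0 complex) set set \<Rightarrow> nat \<Rightarrow> (ugen list \<Rightarrow>\<^sub>0 complex) set set" where
  "left_pow x n = ((\<lambda>y. x \<otimes>\<^sub>A y) ^^ n) \<one>\<^sub>A"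

lemma left_pow_simps [simp]:
  "left_pow x 0 = \<one>\<^sub>A" "left_pow x (Suc n) = x \<otimes>\<^sub>A left_pow x n"
  by (simp_all add: left_pow_def)

lemma left_pow_closed [simp, intro]: "x \<in> carrier AA \<Longrightarrow> left_pow x n \<in> carrier AA"
  by (induction n) simp_all

text \<open>Negative exponents denote powers of the adjoint. This is only an indexing by integers:
  \<open>X\<close> and \<open>Xs\<close> are not inverse to each other, and their product is
  quadratic in \<open>Z\<close>.\<close>

definition X_pow :: "int \<Rightarrow> (ugen list \<Rightarrow>\<^sub>0 complex) set set" where
  "X_pow k = (if 0 \<le> k then left_pow X (nat k) else left_pow Xs (nat (- k)))"

definition B_mon :: "int \<times> nat \<Rightarrow> (ugen list \<Rightarrow>\<^sub>0 complex) set set" where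
  "B_mon = (\<lambda>(k, l). X_pow k \<otimes>\<^sub>A left_pow Z l)"

lemma X_pow_closed [simp, intro]: "X_pow k \<in> carrier AA"
  by (simp add: X_pow_def)

lemma B_mon_closed [simp, intro]: "B_mon m \<in> carrier AA"
  by (simp add: B_mon_def split: prod.split)

definition B_span :: "(ugen list \<Rightarrow>\<^sub>0 complex) set set set" where
  "B_span = range (lin_ext AA B_mon)"

lemma lin_ext_B_mon:
  "lin_ext AA B_mon (p + r) = lin_ext AA B_mon p \<oplus>\<^sub>A lin_ext AA B_mon r"
  "lin_ext AA B_mon (scale c p) = c \<odot>\<^sub>A lin_ext AA B_mon p"
  "lin_ext AA B_mon (single m c) = c \<odot>\<^sub>A B_mon m"
  "lin_ext AA B_mon p \<in> carrier AA"
proof -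
  have f: "B_mon \<in> UNIV \<rightarrow> carrier AA"
    by simp
  show "lin_ext AA B_mon (p + r) = lin_ext AA B_mon p \<oplus>\<^sub>A lin_ext AA B_mon r"
    by (rule A.lin_ext_add[OF _ _ f]) simp_all
  show "lin_ext AA B_mon (scale c p) = c \<odot>\<^sub>A lin_ext AA B_mon p"
    by (rule A.lin_ext_smult[OF _ f]) simp
  show "lin_ext AA B_mon (single m c) = c \<odot>\<^sub>A B_mon m"
    by (rule A.lin_ext_single) simp
  show "lin_ext AA B_mon p \<in> carrier AA"
    by (rule A.lin_ext_closed[OF _ f]) simp
qed

lemma B_span_add: "x \<in> B_span \<Longrightarrow> y \<in> B_span \<Longrightarrow> x \<oplus>\<^sub>A y \<in> B_span"
  unfolding B_span_def by (auto simp flip: lin_ext_B_mon(1))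

lemma B_span_smult: "x \<in> B_span \<Longrightarrow> c \<odot>\<^sub>A x \<in> B_span"
  unfolding B_span_def by (auto simp flip: lin_ext_B_mon(2))

lemma B_span_mon: "B_mon m \<in> B_span"
  unfolding B_span_def using lin_ext_B_mon(3)[of m 1] by (metis A.smult_one B_mon_closed rangeI)

lemma B_span_carrier: "x \<in> B_span \<Longrightarrow> x \<in> carrier AA"
  unfolding B_span_def using lin_ext_B_mon(4) by auto

lemma B_span_minus: "x \<in> B_span \<Longrightarrow> y \<in> B_span \<Longrightarrow> x \<ominus>\<^sub>A y \<in> B_span"
  by (simp add: a_minus_def A.minus_eq_smult B_span_carrier B_span_add B_span_smult)

lemma B_span_mult_left:
  assumes y: "y \<in> carrier AA" and mon: "\<And>m. y \<otimes>\<^sub>A B_mon m \<in> B_span" and x: "x \<in> B_span"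
  shows "y \<otimes>\<^sub>A x \<in> B_span"
proof -
  have "y \<otimes>\<^sub>A lin_ext AA B_mon p \<in> B_span" for p
    using subset_UNIV
  proof (induction p rule: poly_mapping_span_induct)
    case zero
    then show ?case
      using B_span_smult[OF B_span_mon, of 0] y by simp
  next
    case (single m c)
    then show ?case
      using y mon by (simp add: lin_ext_B_mon A.smult_mult_right B_span_smult)
  next
    case (add p r)
    then show ?case
      using y by (simp add: lin_ext_B_mon A.r_distr B_span_add)
  qed
  then show ?thesis
    using x by (auto simp: B_span_def)
qed

text \<open>Since \<open>Z\<close> commutes with \<open>X\<close> and \<open>Xs\<close> up to powers
  of \<open>q\<close>, it does so with every \<open>X_pow k\<close>. The scalar is left unspecified
  because only membership in a span is at stake.\<close>

lemma Z_X_pow: "\<exists>c. Z \<otimes>\<^sub>A X_pow k = c \<odot>\<^sub>A (X_pow k \<otimes>\<^sub>A Z)"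
proof -
  have pow: "\<exists>c. Z \<otimes>\<^sub>A left_pow y n = c \<odot>\<^sub>A (left_pow y n \<otimes>\<^sub>A Z)"
    if y: "y \<in> carrier AA" and yZ: "Z \<otimes>\<^sub>A y = d \<odot>\<^sub>A (y \<otimes>\<^sub>A Z)" for y d n
  proof (induction n)
    case 0
    then show ?case
      by (intro exI[of _ 1]) simp
  next
    case (Suc n)
    then obtain c where c: "Z \<otimes>\<^sub>A left_pow y n = c \<odot>\<^sub>A (left_pow y n \<otimes>\<^sub>A Z)"
      by blast
    have "Z \<otimes>\<^sub>A left_pow y (Suc n) = (Z \<otimes>\<^sub>A y) \<otimes>\<^sub>A left_pow y n"
      using y by (simp add: A.m_assoc)
    also have "\<dots> = d \<odot>\<^sub>A (y \<otimes>\<^sub>A (Z \<otimes>\<^sub>A left_pow y n))"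
      unfolding yZ using y by (simp add: A.m_assoc A.smult_mult_left)
    also have "\<dots> = (d * c) \<odot>\<^sub>A (left_pow y (Suc n) \<otimes>\<^sub>A Z)"
      unfolding c using y by (simp add: A.m_assoc A.smult_mult_right A.smult_assoc)
    finally show ?case
      by blast
  qed
  have "complex_of_real (inverse (q\<^sup>2)) * complex_of_real (q\<^sup>2) = 1"
    by (simp flip: of_real_mult del: of_real_inverse of_real_power)
  then have "Z \<otimes>\<^sub>A X = complex_of_real (inverse (q\<^sup>2)) \<odot>\<^sub>A (X \<otimes>\<^sub>A Z)"
    "Z \<otimes>\<^sub>A Xs = complex_of_real (q\<^sup>2) \<odot>\<^sub>A (Xs \<otimes>\<^sub>A Z)"
    unfolding XZ_relations(1,2)
    by (simp_all add: A.smult_assoc[symmetric] mult.commute del: of_real_inverse of_real_power)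
  then show ?thesis
    using pow by (simp add: X_pow_def)
qed

lemma B_span_Z: "x \<in> B_span \<Longrightarrow> Z \<otimes>\<^sub>A x \<in> B_span"
proof (rule B_span_mult_left)
  fix m :: "int \<times> nat"
  obtain k l where m: "m = (k, l)"
    by (cases m)
  obtain c where c: "Z \<otimes>\<^sub>A X_pow k = c \<odot>\<^sub>A (X_pow k \<otimes>\<^sub>A Z)"
    using Z_X_pow by blast
  have "Z \<otimes>\<^sub>A B_mon m = (Z \<otimes>\<^sub>A X_pow k) \<otimes>\<^sub>A left_pow Z l"
    by (simp add: m B_mon_def A.m_assoc)
  also have "\<dots> = c \<odot>\<^sub>A B_mon (k, Suc l)"
    unfolding c by (simp add: B_mon_def A.m_assoc A.smult_mult_left)
  finally show "Z \<otimes>\<^sub>A B_mon m \<in> B_span"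
    by (simp add: B_span_smult B_span_mon)
qed simp_all

text \<open>The products of \<open>X\<close> and \<open>Xs\<close> in either order have this
  shape.\<close>

lemma B_span_quadratic:
  assumes "x \<in> B_span"
  shows "(a \<odot>\<^sub>A \<one>\<^sub>A \<oplus>\<^sub>A b \<odot>\<^sub>A Z \<ominus>\<^sub>A c \<odot>\<^sub>A (Z \<otimes>\<^sub>A Z)) \<otimes>\<^sub>A x \<in> B_span"
proof -
  note x = B_span_carrier[OF assms]
  have "(a \<odot>\<^sub>A \<one>\<^sub>A \<oplus>\<^sub>A b \<odot>\<^sub>A Z \<ominus>\<^sub>A c \<odot>\<^sub>A (Z \<otimes>\<^sub>A Z)) \<otimes>\<^sub>A x =
      a \<odot>\<^sub>A x \<oplus>\<^sub>A b \<odot>\<^sub>A (Z \<otimes>\<^sub>A x) \<ominus>\<^sub>A c \<odot>\<^sub>A (Z \<otimes>\<^sub>A (Z \<otimes>\<^sub>A x))"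
    using x by (simp add: a_minus_def A.minus_eq_smult A.l_distr A.smult_mult_left A.m_assoc)
  then show ?thesis
    by (simp add: B_span_minus B_span_add B_span_smult B_span_Z assms)
qed

text \<open>On monomials with nonnegative exponent \<open>X\<close> raises the exponent. On the
  others it meets an adjoint factor, and the product of the two is a quadratic polynomial in
  \<open>Z\<close>, which preserves the span.\<close>

lemma B_span_X: "x \<in> B_span \<Longrightarrow> X \<otimes>\<^sub>A x \<in> B_span"
proof (rule B_span_mult_left)
  fix m :: "int \<times> nat"
  obtain k l where m: "m = (k, l)"
    by (cases m)
  show "X \<otimes>\<^sub>A B_mon m \<in> B_span"
  proof (cases "0 \<le> k")
    case True
    then have "X \<otimes>\<^sub>A B_mon m = B_mon (k + 1, l)"
      by (simp add: m B_mon_def X_pow_def A.m_assoc nat_add_distrib)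
    then show ?thesis
      by (simp add: B_span_mon)
  next
    case False
    then have "nat (- k) = Suc (nat (- k - 1))"
      by simp
    then have "X_pow k = Xs \<otimes>\<^sub>A X_pow (k + 1)"
      using False by (simp add: X_pow_def)
    then have "X \<otimes>\<^sub>A B_mon m = (X \<otimes>\<^sub>A Xs) \<otimes>\<^sub>A B_mon (k + 1, l)"
      by (simp add: m B_mon_def A.m_assoc)
    also have "\<dots> \<in> B_span"
      unfolding XZ_relations(3) by (rule B_span_quadratic[OF B_span_mon])
    finally show ?thesis .
  qed
qed simp_all

lemma B_span_Xs: "x \<in> B_span \<Longrightarrow> Xs \<otimes>\<^sub>A x \<in> B_span"
proof (rule B_span_mult_left)
  fix m :: "int \<times> nat"
  obtain k l where m: "m = (k, l)"
    by (cases m)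
  show "Xs \<otimes>\<^sub>A B_mon m \<in> B_span"
  proof (cases "k \<le> 0")
    case True
    then have "nat (- (k - 1)) = Suc (nat (- k))"
      by simp
    then have "X_pow (k - 1) = Xs \<otimes>\<^sub>A X_pow k"
      using True by (simp add: X_pow_def)
    then have "Xs \<otimes>\<^sub>A B_mon m = B_mon (k - 1, l)"
      by (simp add: m B_mon_def A.m_assoc)
    then show ?thesis
      by (simp add: B_span_mon)
  next
    case False
    then have "nat k = Suc (nat (k - 1))"
      by simp
    then have "X_pow k = X \<otimes>\<^sub>A X_pow (k - 1)"
      using False by (simp add: X_pow_def)
    then have "Xs \<otimes>\<^sub>A B_mon m = (Xs \<otimes>\<^sub>A X) \<otimes>\<^sub>A B_mon (k - 1, l)"
      by (simp add: m B_mon_def A.m_assoc)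
    also have "\<dots> \<in> B_span"
      unfolding XZ_relations(4) by (rule B_span_quadratic[OF B_span_mon])
    finally show ?thesis .
  qed
qed simp_all

subsection \<open>The subalgebra \<open>B\<close>\<close>

definition KE where "KE = ag UK \<otimes>\<^sub>A ag UE"

lemma KE_closed [simp, intro]: "KE \<in> carrier AA"
  by (simp add: KE_def)

lemma KE_eq: "KE = complex_of_real (inverse cX) \<odot>\<^sub>A Xs"
  using cX_pos by (simp add: KE_def Xs_eq A.smult_assoc[symmetric])

lemma carrier_B: "carrier BB = generated_star_subalgebra AA {Z, KE}"
  by (simp add: B_alg_def Z_eq KE_def alg_homD(2)[OF alg_hom_A_proj])

lemma star_subalgebra_B: "star_subalgebra (carrier BB) AA"
  and generators_B: "{Z, KE} \<subseteq> carrier BB"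
  unfolding carrier_B by (rule star_subalgebra_generated[OF A.complex_star_algebra_axioms]; simp)+

lemma B_eq: "BB = AA\<lparr>carrier := carrier BB\<rparr>"
  by (simp add: B_alg_def)

sublocale B: complex_star_algebra BB
  by (subst B_eq) (rule complex_star_algebra_subalgebra[OF A.complex_star_algebra_axioms star_subalgebra_B])

lemma B_simps:
  "x \<otimes>\<^bsub>BB\<^esub> y = x \<otimes>\<^sub>A y" "\<one>\<^bsub>BB\<^esub> = \<one>\<^sub>A" "x \<oplus>\<^bsub>BB\<^esub> y = x \<oplus>\<^sub>A y" "\<zero>\<^bsub>BB\<^esub> = \<zero>\<^bsub>AA\<^esub>"
  "c \<odot>\<^bsub>BB\<^esub> x = c \<odot>\<^sub>A x" "star BB x = star AA x"
  by (simp_all add: B_alg_def)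

lemma B_carrier_A: "x \<in> carrier BB \<Longrightarrow> x \<in> carrier AA"
  using star_subalgebra_B subringE(1) by (auto simp: star_subalgebra_def)

lemma XZ_closed_B [simp, intro]: "X \<in> carrier BB" "Xs \<in> carrier BB" "Z \<in> carrier BB"
proof -
  show "Z \<in> carrier BB"
    using generators_B by simp
  have "Xs = complex_of_real cX \<odot>\<^bsub>BB\<^esub> KE"
    by (simp add: B_simps Xs_eq KE_def)
  then show *: "Xs \<in> carrier BB"
    using generators_B B.smult_closed by simp
  then show "X \<in> carrier BB"
    using B.star_closed[OF *] by (simp add: B_simps star_XZ)
qed

lemma B_minimal: "star_subalgebra H AA \<Longrightarrow> Z \<in> H \<Longrightarrow> KE \<in> H \<Longrightarrow> carrier BB \<subseteq> H"
  unfolding carrier_B generated_star_subalgebra_def by auto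

text \<open>The elements whose left multiplication preserves the span form a subalgebra
  \<open>L\<close>, but its closure under the star is not evident. Hence \<open>H\<close> keeps
  those elements of \<open>L\<close> whose star is in \<open>L\<close> too; it contains the
  generators and so all of \<open>B\<close>. Applying an element of \<open>B\<close> to the unit
  gives the claim.\<close>

lemma B_subset_span: "carrier BB \<subseteq> B_span"
proof -
  define L where "L = {h \<in> carrier AA. \<forall>x\<in>B_span. h \<otimes>\<^sub>A x \<in> B_span}"
  have L: "h \<oplus>\<^sub>A h' \<in> L" "h \<otimes>\<^sub>A h' \<in> L" "c \<odot>\<^sub>A h \<in> L" if "h \<in> L" "h' \<in> L" for h h' c
    using that by (auto simp: L_def A.l_distr A.m_assoc A.smult_mult_left B_span_carrier
        intro: B_span_add B_span_smult)
  have one: "\<one>\<^sub>A \<in> L"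
    by (simp add: L_def B_span_carrier)
  have LA: "h \<in> carrier AA" if "h \<in> L" for h
    using that by (simp add: L_def)
  have XZ: "X \<in> L" "Xs \<in> L" "Z \<in> L"
    by (auto simp: L_def intro: B_span_X B_span_Xs B_span_Z)
  define H where "H = {h \<in> L. star AA h \<in> L}"
  have "star_subalgebra H AA"
    unfolding star_subalgebra_def
  proof (intro conjI A.subringI)
    show "\<ominus>\<^bsub>AA\<^esub> h \<in> H" if "h \<in> H" for h
      using that L(3)[of h h "- 1"] L(3)[of "star AA h" "star AA h" "- 1"] LA
      by (auto simp: H_def A.minus_eq_smult A.star_smult)
  qed (use L one LA in \<open>auto simp: H_def A.star_mult A.star_add A.star_smult\<close>)
  moreover have "Z \<in> H" "KE \<in> H"
    using XZ by (simp_all add: H_def KE_eq star_XZ A.star_smult L(3)[OF XZ(1) XZ(1)] L(3)[OF XZ(2) XZ(2)])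
  ultimately have BH: "carrier BB \<subseteq> H"
    by (rule B_minimal)
  show ?thesis
  proof
    fix x assume "x \<in> carrier BB"
    moreover have "B_mon (0, 0) = \<one>\<^sub>A"
      by (simp add: B_mon_def X_pow_def)
    then have "\<one>\<^sub>A \<in> B_span"
      using B_span_mon[of "(0, 0)"] by simp
    ultimately have "x \<otimes>\<^sub>A \<one>\<^sub>A \<in> B_span"
      using BH by (auto simp: H_def L_def)
    then show "x \<in> B_span"
      using \<open>x \<in> carrier BB\<close> by (simp add: B_carrier_A)
  qed
qed

end

section \<open>Algebras of linear operators\<close>

text \<open>The operators act on all complex functions, with no condition on support or growth: the
  limit argument has to apply them to sequences that merely converge.\<close>

definition op_alg :: "(('i \<Rightarrow> complex) \<Rightarrow> 'i \<Rightarrow> complex) star_alg" where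
  "op_alg = \<lparr>carrier = {T. (\<forall>f g. T (\<lambda>i. f i + g i) = (\<lambda>i. T f i + T g i)) \<and>
       (\<forall>c f. T (\<lambda>i. c * f i) = (\<lambda>i. c * T f i))},
     mult = (\<lambda>S T f. S (T f)), one = (\<lambda>f. f), zero = (\<lambda>f i. 0), add = (\<lambda>S T f i. S f i + T f i),
     smult = (\<lambda>c T f i. c * T f i), star = id\<rparr>"

lemma op_alg_simps:
  "T \<in> carrier op_alg \<longleftrightarrow> (\<forall>f g. T (\<lambda>i. f i + g i) = (\<lambda>i. T f i + T g i)) \<and>
     (\<forall>c f. T (\<lambda>i. c * f i) = (\<lambda>i. c * T f i))"
  "S \<otimes>\<^bsub>op_alg\<^esub> T = (\<lambda>f. S (T f))"
  "\<one>\<^bsub>op_alg\<^esub> = (\<lambda>f. f)"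
  "\<zero>\<^bsub>op_alg\<^esub> = (\<lambda>f i. 0)"
  "S \<oplus>\<^bsub>op_alg\<^esub> T = (\<lambda>f i. S f i + T f i)"
  "c \<odot>\<^bsub>op_alg\<^esub> T = (\<lambda>f i. c * T f i)"
  by (simp_all add: op_alg_def)

lemma complex_algebra_op_alg: "complex_algebra op_alg"
proof -
  have neg: "\<exists>S\<in>carrier op_alg. S \<oplus>\<^bsub>op_alg\<^esub> T = \<zero>\<^bsub>op_alg\<^esub>" if "T \<in> carrier op_alg"
    for T :: "('i \<Rightarrow> complex) \<Rightarrow> 'i \<Rightarrow> complex"
    using that by (intro bexI[of _ "\<lambda>f i. - T f i"]) (auto simp: op_alg_simps)
  have "ring (op_alg :: (('i \<Rightarrow> complex) \<Rightarrow> 'i \<Rightarrow> complex) star_alg)"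
  proof (rule ringI)
    show "abelian_group (op_alg :: (('i \<Rightarrow> complex) \<Rightarrow> 'i \<Rightarrow> complex) star_alg)"
      by (rule abelian_groupI) (use neg in \<open>auto simp: op_alg_simps algebra_simps\<close>)
    show "Group.monoid (op_alg :: (('i \<Rightarrow> complex) \<Rightarrow> 'i \<Rightarrow> complex) star_alg)"
      by (rule Group.monoidI) (auto simp: op_alg_simps)
  qed (auto simp: op_alg_simps)
  then show ?thesis
    unfolding complex_algebra_def complex_algebra_axioms_def
    by (auto simp: op_alg_simps algebra_simps)
qed

lemma op_alg_minus:
  assumes "T \<in> carrier op_alg"
  shows "S \<ominus>\<^bsub>op_alg\<^esub> T = (\<lambda>f i. S f i - T f i)"
  using assms complex_algebra.minus_eq_smult[OF complex_algebra_op_alg assms]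
  by (simp add: a_minus_def op_alg_simps)

section \<open>A character of \<open>B\<close>\<close>

context quantum_parameters
begin

text \<open>Any choice of nonvanishing weights for the shift \<open>E\<close> extends to a representation of \<open>A\<close> with
  \<open>K = diag (q\<^sup>n)\<close>.\<close>

definition EF_value :: "int \<Rightarrow> real" where
  "EF_value n = (qlam q)\<^sup>2 * (\<tau> / q - \<mu> / q * (q powi n)\<^sup>2 - q * \<nu> / (q powi n)\<^sup>2)"

fun shift_rep :: "(int \<Rightarrow> real) \<Rightarrow> ugen \<Rightarrow> (int \<Rightarrow> complex) \<Rightarrow> int \<Rightarrow> complex" where
  "shift_rep w UK f n = complex_of_real (q powi n) * f n"
| "shift_rep w UKinv f n = complex_of_real (inverse (q powi n)) * f n"
| "shift_rep w UE f n = complex_of_real (w n) * f (n - 1)"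
| "shift_rep w UF f n = complex_of_real (EF_value (n + 1) / w (n + 1)) * f (n + 1)"

lemma powi_shift: "q powi (n + 1) = q * q powi n" "q powi (n - 1) = q powi n / q" "q powi n > 0"
  using q_pos by (simp_all add: power_int_add power_int_diff)

lemma shift_rep_closed: "shift_rep w g \<in> carrier op_alg"
  by (cases g) (auto simp: op_alg_simps fun_eq_iff algebra_simps add_divide_distrib)

text \<open>The Casimir relation forces \<open>EF\<close> to be diagonal with entries
  \<open>EF_value n\<close>; \<open>FE\<close> then has entries \<open>EF_value (n + 1)\<close>. The
  commutator relation becomes the difference equation \<open>FE\<close>, in which
  \<open>qlam q * (q - inverse q) = 1\<close> adjusts the powers of \<open>qlam q\<close>.\<close>

lemma shift_representation:
  assumes w: "\<And>n. w n \<noteq> 0"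
  obtains \<theta> where "alg_hom AA op_alg \<theta>" "\<And>g. \<theta> (ag g) = shift_rep w g"
proof (rule A_lift[OF complex_algebra_op_alg])
  have lam: "qlam q * (q - inverse q) = 1"
    by (rule qlam_mult)
  have FE: "EF_value n - EF_value (n + 1) = qlam q * \<mu> * (q powi n)\<^sup>2 - qlam q * \<nu> / (q powi n)\<^sup>2" for n
  proof -
    define y where "y = (q powi n)\<^sup>2"
    have y: "y \<noteq> 0"
      using powi_shift(3)[of n] by (simp add: y_def)
    have "EF_value n - EF_value (n + 1) = (qlam q)\<^sup>2 * ((q - inverse q) * \<mu> * y - (q - inverse q) * \<nu> / y)"
      unfolding EF_value_def powi_shift(1) power_mult_distrib y_def[symmetric]
      using y by (simp add: field_simps power2_eq_square)
    also have "\<dots> = qlam q * (qlam q * (q - inverse q)) * (\<mu> * y - \<nu> / y)"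
      by (simp add: algebra_simps diff_divide_distrib power2_eq_square)
    finally show ?thesis
      unfolding lam by (simp add: y_def algebra_simps)
  qed
  have FE': "complex_of_real (EF_value n) * z - complex_of_real (EF_value (n + 1)) * z =
      complex_of_real (qlam q * \<mu>) * (complex_of_real (q powi n) * (complex_of_real (q powi n) * z)) -
      complex_of_real (qlam q * \<nu>) * (complex_of_real (inverse (q powi n)) * (complex_of_real (inverse (q powi n)) * z))"
    for n z
    using arg_cong[OF FE[of n], of "\<lambda>r. complex_of_real r * z"]
    by (simp add: algebra_simps power2_eq_square divide_inverse)
  interpret O: complex_algebra "op_alg :: ((int \<Rightarrow> complex) \<Rightarrow> int \<Rightarrow> complex) star_alg"
    by (rule complex_algebra_op_alg)
  note closed = shift_rep_closed[of w]
  have EF: "shift_rep w UE (shift_rep w UF f) n = complex_of_real (EF_value n) * f n"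
    "shift_rep w UF (shift_rep w UE f) n = complex_of_real (EF_value (n + 1)) * f n" for f n
    using w by simp_all
  show "u_solution q \<mu> \<nu> op_alg (shift_rep w)"
    unfolding u_solution_def op_alg_minus[OF O.m_closed[OF closed closed]]
      op_alg_minus[OF O.smult_closed[OF O.m_closed[OF closed closed]]]
  proof (intro conjI allI closed ext)
    fix f n
    show "(shift_rep w UE \<otimes>\<^bsub>op_alg\<^esub> shift_rep w UF) f n - (shift_rep w UF \<otimes>\<^bsub>op_alg\<^esub> shift_rep w UE) f n =
        (complex_of_real (qlam q * \<mu>) \<odot>\<^bsub>op_alg\<^esub> (shift_rep w UK \<otimes>\<^bsub>op_alg\<^esub> shift_rep w UK)) f n -
        (complex_of_real (qlam q * \<nu>) \<odot>\<^bsub>op_alg\<^esub> (shift_rep w UKinv \<otimes>\<^bsub>op_alg\<^esub> shift_rep w UKinv)) f n"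
      unfolding op_alg_simps EF shift_rep.simps(1,2) by (rule FE')
  qed (use powi_shift(3) in \<open>auto simp: op_alg_simps powi_shift(1,2) less_imp_neq[THEN not_sym] simp del: of_real_power_int\<close>)
  have cas: "EF_value n + (qlam q)\<^sup>2 * (inverse q * \<mu> * (q powi n * q powi n) +
      q * \<nu> * (inverse (q powi n) * inverse (q powi n))) = \<tau> * inverse q * (qlam q)\<^sup>2" for n
    by (simp add: EF_value_def divide_inverse power2_eq_square algebra_simps)
  show "casimir_value q \<mu> \<nu> op_alg (shift_rep w) =
      complex_of_real (\<tau> * inverse q * (qlam q)\<^sup>2) \<odot>\<^bsub>op_alg\<^esub> \<one>\<^bsub>op_alg\<^esub>"
  proof (intro ext)
    fix f n
    show "casimir_value q \<mu> \<nu> op_alg (shift_rep w) f n =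
        (complex_of_real (\<tau> * inverse q * (qlam q)\<^sup>2) \<odot>\<^bsub>op_alg\<^esub> \<one>\<^bsub>op_alg\<^esub>) f n"
      unfolding casimir_value_def op_alg_simps EF shift_rep.simps(1,2)
      using arg_cong[OF cas[of n], of "\<lambda>r. complex_of_real r * f n"]
      by (simp add: algebra_simps)
  qed
qed (rule that; assumption)

lemma X_nonzero: "X \<noteq> \<zero>\<^bsub>AA\<^esub>"
proof
  assume "X = \<zero>\<^bsub>AA\<^esub>"
  then have Xs: "Xs = \<zero>\<^bsub>AA\<^esub>"
    by (simp add: Xs_def)
  obtain \<theta> where \<theta>: "alg_hom AA op_alg \<theta>" "\<And>g. \<theta> (ag g) = shift_rep (\<lambda>_. 1) g"
    using shift_representation[of "\<lambda>_. 1"] by auto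
  \<comment> \<open>The adjoint is tested instead of \<open>X\<close>, since \<open>E\<close> has
    been given the weight 1 everywhere while the weights of \<open>F\<close> may vanish. At place 0
    the factors \<open>q powi 0\<close> are 1.\<close>
  have "\<theta> Xs (\<lambda>_. 1) 0 = complex_of_real cX"
    by (simp add: Xs_eq alg_homD[OF \<theta>(1)] \<theta>(2) op_alg_simps)
  moreover have "\<theta> Xs (\<lambda>_. 1) 0 = 0"
    by (simp add: Xs alg_hom_more(1)[OF \<theta>(1) A.complex_algebra_axioms complex_algebra_op_alg] op_alg_simps)
  ultimately show False
    using cX_pos by simp
qed

text \<open>For suitable weights the generators of \<open>B\<close> act on convergent sequences, and taking limits as
  \<open>n \<rightarrow> \<infinity>\<close>, where \<open>Z = diag (q\<^sup>2\<^sup>n)\<close> tends to \<open>0\<close>, gives a character.\<close>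

definition limit_factor :: "((int \<Rightarrow> complex) \<Rightarrow> int \<Rightarrow> complex) \<Rightarrow> complex \<Rightarrow> bool" where
  "limit_factor T z \<longleftrightarrow>
     (\<forall>f l. (\<lambda>n. f (int n)) \<longlonglongrightarrow> l \<longrightarrow> (\<lambda>n. T f (int n)) \<longlonglongrightarrow> z * l)"

text \<open>The constant sequence already determines the factor, which makes the character below
  well defined.\<close>

lemma limit_factor_unique:
  assumes "limit_factor T z" "limit_factor T z'"
  shows "z = z'"
proof -
  have "(\<lambda>n. T (\<lambda>_. 1) (int n)) \<longlonglongrightarrow> y * 1" if "limit_factor T y" for y
    using that[unfolded limit_factor_def, rule_format, of "\<lambda>_. 1" 1] by simp
  from LIMSEQ_unique[OF this[OF assms(1)] this[OF assms(2)]] show ?thesis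
    by simp
qed

lemma limit_factor_simps:
  "limit_factor (\<lambda>f. f) 1"
  "limit_factor S a \<Longrightarrow> limit_factor T b \<Longrightarrow> limit_factor (\<lambda>f. S (T f)) (a * b)"
  "limit_factor S a \<Longrightarrow> limit_factor T b \<Longrightarrow> limit_factor (\<lambda>f i. S f i + T f i) (a + b)"
  "limit_factor T b \<Longrightarrow> limit_factor (\<lambda>f i. c * T f i) (c * b)"
  unfolding limit_factor_def
  by (auto simp: mult.assoc distrib_right intro!: tendsto_add tendsto_mult_left)

lemma tendsto_int_shift:
  assumes "(\<lambda>n. f (int n)) \<longlonglongrightarrow> (l :: complex)"
  shows "(\<lambda>n. f (int n - 1)) \<longlonglongrightarrow> l" "(\<lambda>n. f (int n + 1)) \<longlonglongrightarrow> l"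
proof -
  have "(\<lambda>n. f (int (Suc n) - 1)) \<longlonglongrightarrow> l"
    using assms by simp
  then show "(\<lambda>n. f (int n - 1)) \<longlonglongrightarrow> l"
    by (rule LIMSEQ_imp_Suc)
  show "(\<lambda>n. f (int n + 1)) \<longlonglongrightarrow> l"
    using LIMSEQ_Suc[OF assms] by (simp add: add.commute)
qed

lemma limit_factor_weighted_shift:
  assumes "(\<lambda>n. v (int n)) \<longlonglongrightarrow> r"
  shows "limit_factor (\<lambda>f n. complex_of_real (v n) * f n) (complex_of_real r)"
    and "limit_factor (\<lambda>f n. complex_of_real (v n) * f (n - 1)) (complex_of_real r)"
    and "limit_factor (\<lambda>f n. complex_of_real (v n) * f (n + 1)) (complex_of_real r)"
  unfolding limit_factor_def
  by (auto intro!: tendsto_mult tendsto_of_real assms tendsto_int_shift)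

text \<open>\<open>up\<close> and \<open>down\<close> are the limits of the weights with which
  \<open>Xs\<close> and \<open>X\<close> act as shifts. That they agree and are real is the
  compatibility of the character with the star.\<close>

lemma character_exists:
  assumes w: "\<And>n. w n \<noteq> 0"
    and up: "(\<lambda>n. cX * q ^ n * w (int n)) \<longlonglongrightarrow> x"
    and down: "(\<lambda>n. cX * q ^ Suc n * EF_value (int n + 1) / w (int n + 1)) \<longlonglongrightarrow> x"
  obtains \<chi> where "star_hom BB complex_alg \<chi>" "\<chi> Z = 0" "\<chi> X = complex_of_real x"
proof -
  obtain \<theta> where \<theta>: "alg_hom AA op_alg \<theta>" "\<And>g. \<theta> (ag g) = shift_rep w g"
    using shift_representation[of w] w by auto
  note hom = alg_homD[OF \<theta>(1)]
  have X: "\<theta> X = (\<lambda>f n. complex_of_real (cX * q powi (n + 1) * EF_value (n + 1) / w (n + 1)) * f (n + 1))"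
    by (simp add: X_eq hom \<theta>(2) op_alg_simps fun_eq_iff)
  have Xs: "\<theta> Xs = (\<lambda>f n. complex_of_real (cX * q powi n * w n) * f (n - 1))"
    by (simp add: Xs_eq hom \<theta>(2) op_alg_simps fun_eq_iff)
  have Z: "\<theta> Z = (\<lambda>f n. complex_of_real (q powi n * q powi n) * f n)"
    by (simp add: Z_eq hom \<theta>(2) op_alg_simps fun_eq_iff)
  have "(\<lambda>n. q powi int n * q powi int n) \<longlonglongrightarrow> 0 * 0"
    using LIMSEQ_power_zero[of q] q_pos q_less_1 by (intro tendsto_mult) auto
  then have lZ: "limit_factor (\<theta> Z) 0"
    unfolding Z using limit_factor_weighted_shift(1)[of "\<lambda>n. q powi n * q powi n" 0] by simp
  have lXs: "limit_factor (\<theta> Xs) (complex_of_real x)"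
    unfolding Xs by (rule limit_factor_weighted_shift(2)) (use up in simp)
  have lX: "limit_factor (\<theta> X) (complex_of_real x)"
    unfolding X
  proof (rule limit_factor_weighted_shift(3))
    have "q powi (int n + 1) = q ^ Suc n" for n
      using q_pos by (simp add: power_int_add)
    then show "(\<lambda>n. cX * q powi (int n + 1) * EF_value (int n + 1) / w (int n + 1)) \<longlonglongrightarrow> x"
      using down by simp
  qed
  \<comment> \<open>The star is built into \<open>H\<close>, because \<theta> itself does not
    respect it: the adjoint must have a limit as well, and that limit must be the conjugate
    one.\<close>
  define H where "H = {h \<in> carrier AA. \<exists>z. limit_factor (\<theta> h) z \<and> limit_factor (\<theta> (star AA h)) (cnj z)}"
  have HI: "h \<in> H" if "h \<in> carrier AA" "limit_factor (\<theta> h) z" "limit_factor (\<theta> (star AA h)) (cnj z)" for h z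
    using that by (auto simp: H_def)
  have H_one: "\<one>\<^sub>A \<in> H"
    by (rule HI[of _ 1]) (simp_all add: hom op_alg_simps limit_factor_simps)
  have H_smult: "c \<odot>\<^sub>A h \<in> H" if "h \<in> H" for c h
  proof -
    from that obtain z where "h \<in> carrier AA" "limit_factor (\<theta> h) z" "limit_factor (\<theta> (star AA h)) (cnj z)"
      by (auto simp: H_def)
    then show ?thesis
      by (intro HI[of _ "c * z"]) (simp_all add: A.star_smult hom op_alg_simps limit_factor_simps)
  qed
  have H: "h \<oplus>\<^sub>A h' \<in> H" "h \<otimes>\<^sub>A h' \<in> H" if "h \<in> H" "h' \<in> H" for h h'
  proof -
    from that obtain z z' where h: "h \<in> carrier AA" "limit_factor (\<theta> h) z" "limit_factor (\<theta> (star AA h)) (cnj z)"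
      "h' \<in> carrier AA" "limit_factor (\<theta> h') z'" "limit_factor (\<theta> (star AA h')) (cnj z')"
      by (auto simp: H_def)
    from h show "h \<oplus>\<^sub>A h' \<in> H"
      by (intro HI[of _ "z + z'"]) (simp_all add: A.star_add hom op_alg_simps limit_factor_simps)
    \<comment> \<open>The star reverses the product of operators; the limits are numbers and
      commute.\<close>
    have "limit_factor (\<lambda>f. \<theta> (star AA h') (\<theta> (star AA h) f)) (cnj z * cnj z')"
      using limit_factor_simps(2)[OF h(6) h(3)] by (simp add: mult.commute)
    then show "h \<otimes>\<^sub>A h' \<in> H"
      using h limit_factor_simps(2)[OF h(2) h(5)]
      by (intro HI[of _ "z * z'"]) (simp_all add: A.star_mult hom op_alg_simps)
  qed
  have "star_subalgebra H AA"
    unfolding star_subalgebra_def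
  proof (intro conjI A.subringI)
    show "\<ominus>\<^bsub>AA\<^esub> h \<in> H" if "h \<in> H" for h
      using H_smult[OF that, of "- 1"] that by (simp add: H_def A.minus_eq_smult)
    show "\<forall>h\<in>H. star AA h \<in> H"
    proof
      fix h assume "h \<in> H"
      then obtain z where "h \<in> carrier AA" "limit_factor (\<theta> h) z" "limit_factor (\<theta> (star AA h)) (cnj z)"
        by (auto simp: H_def)
      then show "star AA h \<in> H"
        by (intro HI[of _ "cnj z"]) simp_all
    qed
  qed (use H H_one H_smult in \<open>auto simp: H_def\<close>)
  moreover have "Z \<in> H" "Xs \<in> H"
    using HI[of Z 0] lZ HI[of Xs "complex_of_real x"] lX lXs by (simp_all add: star_XZ)
  ultimately have BH: "carrier BB \<subseteq> H"
    by (intro B_minimal) (simp_all add: KE_eq H_smult)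
  define \<chi> where "\<chi> h = (THE z. limit_factor (\<theta> h) z)" for h
  have \<chi>: "\<chi> h = z" if "limit_factor (\<theta> h) z" for h z
    unfolding \<chi>_def using that limit_factor_unique by blast
  have lim: "limit_factor (\<theta> h) (\<chi> h)" "limit_factor (\<theta> (star AA h)) (cnj (\<chi> h))" if "h \<in> carrier BB" for h
  proof -
    from that BH obtain z where "limit_factor (\<theta> h) z" "limit_factor (\<theta> (star AA h)) (cnj z)"
      by (auto simp: H_def)
    then show "limit_factor (\<theta> h) (\<chi> h)" "limit_factor (\<theta> (star AA h)) (cnj (\<chi> h))"
      unfolding \<chi>[OF \<open>limit_factor (\<theta> h) z\<close>] .
  qed
  show ?thesis
  proof
    show "star_hom BB complex_alg \<chi>"
      unfolding star_hom_iff_alg_hom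
    proof (intro conjI alg_homI ballI)
      fix x y c assume x: "x \<in> carrier BB" and y: "y \<in> carrier BB"
      note xA = B_carrier_A[OF x] B_carrier_A[OF y]
      show "\<chi> (x \<otimes>\<^bsub>BB\<^esub> y) = \<chi> x \<otimes>\<^bsub>complex_alg\<^esub> \<chi> y"
        using limit_factor_simps(2)[OF lim(1)[OF x] lim(1)[OF y]] xA
        by (intro \<chi>) (simp add: complex_alg_def B_simps hom op_alg_simps)
      show "\<chi> (x \<oplus>\<^bsub>BB\<^esub> y) = \<chi> x \<oplus>\<^bsub>complex_alg\<^esub> \<chi> y"
        using limit_factor_simps(3)[OF lim(1)[OF x] lim(1)[OF y]] xA
        by (intro \<chi>) (simp add: complex_alg_def B_simps hom op_alg_simps)
      show "\<chi> (c \<odot>\<^bsub>BB\<^esub> x) = c \<odot>\<^bsub>complex_alg\<^esub> \<chi> x"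
        using limit_factor_simps(4)[OF lim(1)[OF x]] xA
        by (intro \<chi>) (simp add: complex_alg_def B_simps hom op_alg_simps)
      show "\<chi> (star BB x) = star complex_alg (\<chi> x)"
        using lim(2)[OF x] by (intro \<chi>) (simp add: complex_alg_def B_simps)
      show "\<chi> x \<in> carrier complex_alg"
        by (simp add: complex_alg_def)
    next
      show "\<chi> \<one>\<^bsub>BB\<^esub> = \<one>\<^bsub>complex_alg\<^esub>"
        using limit_factor_simps(1)
        by (intro \<chi>) (simp add: complex_alg_def B_simps hom op_alg_simps)
    qed
    show "\<chi> Z = 0" "\<chi> X = complex_of_real x"
      by (rule \<chi>[OF lZ], rule \<chi>[OF lX])
  qed
qed

lemma character_nu_minus_one:
  assumes "\<nu> = -1"
  obtains \<chi> where "star_hom BB complex_alg \<chi>" "\<chi> Z = 0" "\<chi> X = complex_of_real q"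
proof (rule character_exists)
  \<comment> \<open>The weights are solved from the condition on \<open>Xs\<close>, so that
    \<open>cX * q ^ n * w n\<close> is constantly \<open>q\<close>, the positive root of
    \<open>- (q\<^sup>2) * \<nu>\<close>. The weights of \<open>X\<close> tend to the same value,
    since the \<nu>-term of \<open>EF_value\<close> grows at exactly the rate that compensates the
    other factors.\<close>
  show "q powi (- n) * q / cX \<noteq> 0" for n
    using cX_pos by simp
  have "cX * q ^ n * (q powi (- int n) * q / cX) = q" for n
    using cX_pos by (simp add: power_int_minus field_simps)
  then show "(\<lambda>n. cX * q ^ n * (q powi (- int n) * q / cX)) \<longlonglongrightarrow> q"
    by simp
  have qn: "(\<lambda>n. q ^ Suc n) \<longlonglongrightarrow> 0"
    using LIMSEQ_power_zero[of q] q_pos q_less_1 by (intro LIMSEQ_Suc) auto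
  have "cX * q ^ Suc n * EF_value (int n + 1) / (q powi (- (int n + 1)) * q / cX) =
      \<tau> / q * (q ^ Suc n)\<^sup>2 - \<mu> / q * (q ^ Suc n)^4 + q" for n
  proof -
    define y where "y = q ^ Suc n"
    have y: "y \<noteq> 0" "q powi (int n + 1) = y"
      using q_pos by (simp_all add: y_def power_int_add)
    have y': "q powi (- (int n + 1)) = 1 / y"
      by (simp only: power_int_minus y(2) inverse_eq_divide)
    have "cX * y * EF_value (int n + 1) / (1 / y * q / cX) = (cX\<^sup>2 * (qlam q)\<^sup>2) *
        (\<tau> / q * y\<^sup>2 - \<mu> / q * y^4 + q) / q"
      unfolding EF_value_def y(2) using y(1) cX_pos
      by (simp add: assms field_simps power2_eq_square power4_eq_xxxx)
    then show ?thesis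
      unfolding cX_qlam y' y_def[symmetric] by simp
  qed
  moreover have "(\<lambda>n. \<tau> / q * (q ^ Suc n)\<^sup>2 - \<mu> / q * (q ^ Suc n)^4 + q) \<longlonglongrightarrow> \<tau> / q * 0\<^sup>2 - \<mu> / q * 0^4 + q"
    by (intro tendsto_intros qn)
  ultimately show "(\<lambda>n. cX * q ^ Suc n * EF_value (int n + 1) / (q powi (- (int n + 1)) * q / cX)) \<longlonglongrightarrow> q"
    by simp
qed (rule that; assumption)

text \<open>Without the \<nu>-term \<open>EF_value\<close> stays bounded as the index tends to
  infinity. With constant weights both shifts are therefore damped to 0 by the powers of
  \<open>q\<close> coming from \<open>K\<close>.\<close>

lemma character_nu_zero:
  assumes "\<nu> = 0"
  obtains \<chi> where "star_hom BB complex_alg \<chi>" "\<chi> Z = 0" "\<chi> X = 0"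
proof (rule character_exists[of "\<lambda>_. 1" 0])
  have q0: "(\<lambda>n. q ^ n) \<longlonglongrightarrow> 0"
    using LIMSEQ_power_zero[of q] q_pos q_less_1 by auto
  show "(\<lambda>n. cX * q ^ n * 1) \<longlonglongrightarrow> 0"
    using tendsto_mult_left[OF q0, of cX] by simp
  have qn: "(\<lambda>n. q ^ Suc n) \<longlonglongrightarrow> 0"
    by (intro LIMSEQ_Suc q0)
  have "q powi (int n + 1) = q ^ Suc n" for n
    using q_pos by (simp add: power_int_add)
  then have "EF_value (int n + 1) = (qlam q)\<^sup>2 * (\<tau> / q - \<mu> / q * (q ^ Suc n)\<^sup>2)" for n
    unfolding EF_value_def by (simp add: assms)
  moreover have "(\<lambda>n. cX * q ^ Suc n * ((qlam q)\<^sup>2 * (\<tau> / q - \<mu> / q * (q ^ Suc n)\<^sup>2)) / 1)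
      \<longlonglongrightarrow> cX * 0 * ((qlam q)\<^sup>2 * (\<tau> / q - \<mu> / q * 0\<^sup>2)) / 1"
    by (intro tendsto_intros qn) simp
  ultimately show "(\<lambda>n. cX * q ^ Suc n * EF_value (int n + 1) / 1) \<longlonglongrightarrow> 0"
    by simp
qed (auto intro: that)

end

section \<open>The Hopf algebras \<open>Pol\<^sub>q(\<mu>)\<close>\<close>

text \<open>With \<open>m = 0\<close> for \<open>\<mu> = 0\<close> and \<open>m = 1\<close> otherwise, the relations and the comultiplication of all
  three algebras take the same form.\<close>

definition pol_m :: "real \<Rightarrow> real" where
  "pol_m \<mu> = (if \<mu> = 0 then 0 else 1)"

definition p_solution :: "real \<Rightarrow> real \<Rightarrow> 'a star_alg \<Rightarrow> (pgen \<Rightarrow> 'a) \<Rightarrow> bool" where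
  "p_solution q m C f \<longleftrightarrow> (\<forall>g. f g \<in> carrier C) \<and>
     f Pa \<otimes>\<^bsub>C\<^esub> f Pb = complex_of_real q \<odot>\<^bsub>C\<^esub> (f Pb \<otimes>\<^bsub>C\<^esub> f Pa) \<and>
     f Pa \<otimes>\<^bsub>C\<^esub> f Pc = complex_of_real q \<odot>\<^bsub>C\<^esub> (f Pc \<otimes>\<^bsub>C\<^esub> f Pa) \<and>
     f Pb \<otimes>\<^bsub>C\<^esub> f Pd = complex_of_real q \<odot>\<^bsub>C\<^esub> (f Pd \<otimes>\<^bsub>C\<^esub> f Pb) \<and>
     f Pc \<otimes>\<^bsub>C\<^esub> f Pd = complex_of_real q \<odot>\<^bsub>C\<^esub> (f Pd \<otimes>\<^bsub>C\<^esub> f Pc) \<and>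
     f Pb \<otimes>\<^bsub>C\<^esub> f Pc = f Pc \<otimes>\<^bsub>C\<^esub> f Pb \<and>
     f Pd \<otimes>\<^bsub>C\<^esub> f Pa = \<one>\<^bsub>C\<^esub> \<oplus>\<^bsub>C\<^esub> complex_of_real (m * inverse q) \<odot>\<^bsub>C\<^esub> (f Pc \<otimes>\<^bsub>C\<^esub> f Pb) \<and>
     f Pa \<otimes>\<^bsub>C\<^esub> f Pd = \<one>\<^bsub>C\<^esub> \<oplus>\<^bsub>C\<^esub> complex_of_real (m * q) \<odot>\<^bsub>C\<^esub> (f Pb \<otimes>\<^bsub>C\<^esub> f Pc)"

lemma p_solution_closed: "p_solution q m C f \<Longrightarrow> f g \<in> carrier C"
  by (simp add: p_solution_def)

definition p_relations :: "real \<Rightarrow> real \<Rightarrow> 'a :: real_algebra \<Rightarrow> 'a \<Rightarrow> 'a \<Rightarrow> 'a \<Rightarrow> 'a \<Rightarrow> bool" where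
  "p_relations q m e a b c d \<longleftrightarrow> a * b = q *\<^sub>R (b * a) \<and> a * c = q *\<^sub>R (c * a) \<and>
     b * d = q *\<^sub>R (d * b) \<and> c * d = q *\<^sub>R (d * c) \<and> b * c = c * b \<and>
     d * a = e + (m * inverse q) *\<^sub>R (c * b) \<and> a * d = e + (m * q) *\<^sub>R (b * c)"

lemma p_solution_iff:
  assumes "complex_algebra S" and closed: "\<And>g. f g \<in> carrier S"
  shows "p_solution q m S f \<longleftrightarrow> p_relations q m (in_family S \<one>\<^bsub>S\<^esub>) (in_family S (f Pa))
    (in_family S (f Pb)) (in_family S (f Pc)) (in_family S (f Pd))"
proof -
  interpret S: complex_algebra S by fact
  show ?thesis
    unfolding p_solution_def p_relations_def
    by (simp add: closed S.in_family_eq_iff flip: S.in_family_simps del: of_real_mult of_real_inverse)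
qed

text \<open>Only the adjoints of the two relations with a factor \<open>q\<close> or
  \<open>inverse q\<close> are new; the other three relations are fixed by the star.\<close>

lemma zero_rels_eq:
  "zero_rels q = (let m = (\<lambda>c w. single w (complex_of_real c)) in
    {m 1 [Pd, Pa] - m 1 [], m 1 [Pa, Pd] - m 1 [], m 1 [Pa, Pb] - m q [Pb, Pa],
     m 1 [Pd, Pb] - m (inverse q) [Pb, Pd], m 1 [Pb, Pc] - m 1 [Pc, Pb],
     m 1 [Pc, Pd] - m q [Pd, Pc], m 1 [Pc, Pa] - m (inverse q) [Pa, Pc]})"
  unfolding zero_rels_def Let_def by (auto simp: free_alg_star_simps)

lemma star_zero_rels:
  assumes "r \<in> zero_rels q"
  shows "star (free_alg zero_star) r \<in> zero_rels q"
  using assms unfolding zero_rels_eq Let_def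
  by (elim insertE emptyE) (simp_all add: free_alg_star_simps)

lemma Pol_lift:
  assumes C: "complex_algebra C" and f: "p_solution q (pol_m \<mu>) C f" and "q \<noteq> 0"
  shows "alg_hom (Pol q \<mu>) C (alg_hom_ext C f)"
    and "alg_hom_ext C f (pol_gen q \<mu> g) = f g"
proof -
  interpret C: complex_algebra C by fact
  interpret P: presentation "pol_star q \<mu>" "pol_rels q \<mu>" .
  note closed = p_solution_closed[OF f]
  have cancel: "u \<oplus>\<^bsub>C\<^esub> v \<ominus>\<^bsub>C\<^esub> v \<ominus>\<^bsub>C\<^esub> u = \<zero>\<^bsub>C\<^esub>" if "u \<in> carrier C" "v \<in> carrier C" for u v
    by (rule C.in_family_inject) (simp_all add: that C.in_family_simps)
  have "lin_ext C (word_value C f) r = \<zero>\<^bsub>C\<^esub>" if r: "r \<in> pol_rels q \<mu>" for r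
  proof (cases "\<mu> = 0")
    case True
    from r have "r \<in> zero_rels q"
      by (simp add: pol_rels_def True)
    then show ?thesis
      using f \<open>q \<noteq> 0\<close> True unfolding zero_rels_eq p_solution_def Let_def
      by (elim insertE emptyE)
        (simp_all add: C.lin_ext_word_value closed pol_m_def C.smult_assoc[symmetric])
  next
    case False
    from r have "r \<in> sl_rels q"
      by (simp add: pol_rels_def False)
    then show ?thesis
      using f False unfolding sl_rels_def p_solution_def Let_def
      by (elim insertE emptyE)
        (simp_all add: C.lin_ext_word_value closed pol_m_def cancel)
  qed
  note lift = P.alg_hom_alg_hom_ext[OF C closed this]
  show "alg_hom (Pol q \<mu>) C (alg_hom_ext C f)"
    unfolding Pol_def by (rule lift)
  show "alg_hom_ext C f (pol_gen q \<mu> g) = f g"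
    unfolding pol_gen_def by (rule lift)
qed

context
  fixes q \<mu> :: real
  assumes q: "q \<noteq> 0" and \<mu>: "\<mu> \<in> {-1, 0, 1}"
begin

lemma pol_star_involution:
  "snd (pol_star q \<mu> (snd (pol_star q \<mu> g))) = g"
  "cnj (fst (pol_star q \<mu> g)) * fst (pol_star q \<mu> (snd (pol_star q \<mu> g))) = 1"
  using \<mu> q by (cases g; auto simp: pol_star_def)+

lemma p_solution_Pol: "p_solution q (pol_m \<mu>) (Pol q \<mu>) (pol_gen q \<mu>)"
  and complex_star_algebra_Pol: "complex_star_algebra (Pol q \<mu>)"
  and star_pol_gen: "star (Pol q \<mu>) (pol_gen q \<mu> g) =
    fst (pol_star q \<mu> g) \<odot>\<^bsub>Pol q \<mu>\<^esub> pol_gen q \<mu> (snd (pol_star q \<mu> g))"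
proof -
  define R where "R = pol_rels q \<mu>"
  interpret P: presentation "pol_star q \<mu>" R .
  have rel: "\<forall>r\<in>pol_rels q \<mu>. in_family P.Q (P.coset r) = 0"
  proof
    show "in_family P.Q (P.coset r) = 0" if "r \<in> pol_rels q \<mu>" for r
      using P.coset_relation[of r] that by (simp add: R_def[symmetric] P.in_family_zero)
  qed
  note iff = p_solution_iff[of P.Q P.gen, OF P.complex_algebra_axioms P.gen_closed]
  have sol: "p_solution q (pol_m \<mu>) P.Q P.gen"
  proof (cases "\<mu> = 0")
    case True
    then have "\<forall>r\<in>zero_rels q. in_family P.Q (P.coset r) = 0" and [simp]: "pol_m \<mu> = 0"
      using rel by (simp_all add: pol_rels_def pol_m_def)
    then show ?thesis
      using q unfolding iff p_relations_def by (simp add: zero_rels_eq Let_def P.coset_diff P.coset_word P.in_family_simps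
          del: of_real_inverse)
  next
    case False
    then have "\<forall>r\<in>sl_rels q. in_family P.Q (P.coset r) = 0" and [simp]: "pol_m \<mu> = 1"
      using rel by (simp_all add: pol_rels_def pol_m_def)
    then show ?thesis
      unfolding iff p_relations_def
      by (simp add: sl_rels_def Let_def P.coset_add P.coset_diff P.coset_word P.in_family_simps
          algebra_simps del: of_real_inverse)
  qed
  have "P.coset (star (free_alg (pol_star q \<mu>)) r) = \<zero>\<^bsub>P.Q\<^esub>" if "r \<in> R" for r
  proof (cases "\<mu> = 0")
    case True
    with that have "star (free_alg (pol_star q \<mu>)) r \<in> R"
      using star_zero_rels[of r q] by (simp add: R_def pol_rels_def pol_star_def)
    then show ?thesis
      by (rule P.coset_relation)
  next
    case False
    \<comment> \<open>The individual scalars depend on the sign of \<mu>, but b and c occur together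
      in the inhomogeneous relations, where only the product \<open>sb * sc = 1\<close>
      matters.\<close>
    define sb where "sb = fst (pol_star q \<mu> Pb)"
    define sc where "sc = fst (pol_star q \<mu> Pc)"
    have s: "pol_star q \<mu> Pa = (1, Pd)" "pol_star q \<mu> Pd = (1, Pa)"
      "pol_star q \<mu> Pb = (sb, Pc)" "pol_star q \<mu> Pc = (sc, Pb)" "sb * sc = 1"
      using False \<mu> q by (auto simp: sb_def sc_def pol_star_def)
    have cancel: "u \<oplus>\<^bsub>P.Q\<^esub> v \<ominus>\<^bsub>P.Q\<^esub> v \<ominus>\<^bsub>P.Q\<^esub> u = \<zero>\<^bsub>P.Q\<^esub>"
      if "u \<in> carrier P.Q" "v \<in> carrier P.Q" for u v
      by (rule P.in_family_inject) (simp_all add: that P.in_family_simps)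
    from that False have "r \<in> sl_rels q"
      by (simp add: R_def pol_rels_def)
    then show ?thesis
      using sol q False s(5) unfolding sl_rels_def p_solution_def Let_def
      by (elim insertE emptyE)
        (simp_all add: free_alg_star_simps P.coset_diff P.coset_word P.smult_assoc[symmetric]
          s(1-4) pol_m_def cancel mult_ac)
  qed
  note star = P.star_presented[OF pol_star_involution this]
  show "p_solution q (pol_m \<mu>) (Pol q \<mu>) (pol_gen q \<mu>)"
    using sol by (simp add: Pol_def pol_gen_def R_def)
  show "complex_star_algebra (Pol q \<mu>)"
    using star(1) by (simp add: Pol_def R_def)
  show "star (Pol q \<mu>) (pol_gen q \<mu> g) =
      fst (pol_star q \<mu> g) \<odot>\<^bsub>Pol q \<mu>\<^esub> pol_gen q \<mu> (snd (pol_star q \<mu> g))"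
    using star(2)[of g] by (simp add: Pol_def pol_gen_def R_def)
qed

end

lemma Pol_induct [consumes 1, case_names gen one add mult smult]:
  assumes "x \<in> carrier (Pol q \<mu>)" and "\<And>g. P (pol_gen q \<mu> g)" and "P \<one>\<^bsub>Pol q \<mu>\<^esub>"
    and "\<And>x y. x \<in> carrier (Pol q \<mu>) \<Longrightarrow> y \<in> carrier (Pol q \<mu>) \<Longrightarrow> P x \<Longrightarrow> P y \<Longrightarrow> P (x \<oplus>\<^bsub>Pol q \<mu>\<^esub> y)"
    and "\<And>x y. x \<in> carrier (Pol q \<mu>) \<Longrightarrow> y \<in> carrier (Pol q \<mu>) \<Longrightarrow> P x \<Longrightarrow> P y \<Longrightarrow> P (x \<otimes>\<^bsub>Pol q \<mu>\<^esub> y)"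
    and "\<And>c x. x \<in> carrier (Pol q \<mu>) \<Longrightarrow> P x \<Longrightarrow> P (c \<odot>\<^bsub>Pol q \<mu>\<^esub> x)"
  shows "P x"
proof -
  interpret P: presentation "pol_star q \<mu>" "pol_rels q \<mu>" .
  show ?thesis
    by (rule P.presented_induct[of x P]) (use assms in \<open>simp_all add: Pol_def pol_gen_def\<close>)
qed

subsection \<open>The comultiplication is well defined\<close>

text \<open>The letters \<open>l\<close> and \<open>r\<close> mark elements of the left and the
  right tensor leg. Leaving \<open>m\<close> as a parameter lets one computation serve all three
  algebras: the left leg is moved to the front, and the relations of each leg then rewrite both
  sides to a common normal form.\<close>

lemma p_relations_comult:
  fixes la lb lc ld ra rb rc rd e :: "'a :: real_algebra"
  assumes q: "q \<noteq> 0" and l: "p_relations q m e la lb lc ld" and r: "p_relations q m e ra rb rc rd"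
    and comm: "\<And>x y. x \<in> {la, lb, lc, ld} \<Longrightarrow> y \<in> {ra, rb, rc, rd} \<Longrightarrow> y * x = x * y"
    and unit: "\<And>x. x \<in> {e, la, lb, lc, ld, ra, rb, rc, rd} \<Longrightarrow> e * x = x \<and> x * e = x"
  shows "p_relations q m e (la * ra + m *\<^sub>R (lc * rb)) (lb * ra + ld * rb) (la * rc + lc * rd)
    (m *\<^sub>R (lb * rc) + ld * rd)"
proof -
  have comm': "y * (x * z) = x * (y * z)" if "x \<in> {la, lb, lc, ld}" "y \<in> {ra, rb, rc, rd}" for x y z
    using comm[OF that] by (metis mult.assoc)
  have cm: "ra * la = la * ra" "ra * lb = lb * ra" "ra * lc = lc * ra" "ra * ld = ld * ra"
    "rb * la = la * rb" "rb * lb = lb * rb" "rb * lc = lc * rb" "rb * ld = ld * rb"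
    "rc * la = la * rc" "rc * lb = lb * rc" "rc * lc = lc * rc" "rc * ld = ld * rc"
    "rd * la = la * rd" "rd * lb = lb * rd" "rd * lc = lc * rd" "rd * ld = ld * rd"
    by (rule comm; simp)+
  have cm': "ra * (la * z) = la * (ra * z)" "ra * (lb * z) = lb * (ra * z)"
    "ra * (lc * z) = lc * (ra * z)" "ra * (ld * z) = ld * (ra * z)"
    "rb * (la * z) = la * (rb * z)" "rb * (lb * z) = lb * (rb * z)"
    "rb * (lc * z) = lc * (rb * z)" "rb * (ld * z) = ld * (rb * z)"
    "rc * (la * z) = la * (rc * z)" "rc * (lb * z) = lb * (rc * z)"
    "rc * (lc * z) = lc * (rc * z)" "rc * (ld * z) = ld * (rc * z)"
    "rd * (la * z) = la * (rd * z)" "rd * (lb * z) = lb * (rd * z)"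
    "rd * (lc * z) = lc * (rd * z)" "rd * (ld * z) = ld * (rd * z)" for z
    by (rule comm'; simp)+
  note l = l[unfolded p_relations_def] and r = r[unfolded p_relations_def]
  have l': "la * (lb * z) = q *\<^sub>R (lb * (la * z))" "la * (lc * z) = q *\<^sub>R (lc * (la * z))"
    "lb * (ld * z) = q *\<^sub>R (ld * (lb * z))" "lc * (ld * z) = q *\<^sub>R (ld * (lc * z))"
    "lb * (lc * z) = lc * (lb * z)" "ld * (la * z) = e * z + (m * inverse q) *\<^sub>R (lc * (lb * z))"
    "la * (ld * z) = e * z + (m * q) *\<^sub>R (lb * (lc * z))" for z
    using l by (simp_all add: distrib_right flip: mult.assoc)
  have u: "e * e = e" "e * ra = ra" "e * rb = rb" "e * rc = rc" "e * rd = rd"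
    "la * e = la" "lb * e = lb" "lc * e = lc" "ld * e = ld"
    using unit by auto
  have u': "e * (ra * z) = ra * z" "e * (rb * z) = rb * z" "e * (rc * z) = rc * z" "e * (rd * z) = rd * z" for z
    using u(2-5) by (metis mult.assoc)+
  have qq: "q * (inverse q * t) = t" "inverse q * (q * t) = t" "q * inverse q = 1" "inverse q * q = 1"
    for t
    using q by simp_all
  show ?thesis
    unfolding p_relations_def
    by (intro conjI) (simp_all add: mult.assoc cm cm' l l' r u u' qq algebra_simps)
qed

locale pol_algebra =
  fixes q \<mu> :: real
  assumes q_nz: "q \<noteq> 0" and \<mu>_cases: "\<mu> \<in> {-1, 0, 1}"
begin

abbreviation "PP \<equiv> Pol q \<mu>"
abbreviation P_mult (infixl "\<otimes>\<^sub>P" 70) where "x \<otimes>\<^sub>P y \<equiv> x \<otimes>\<^bsub>PP\<^esub> y"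
abbreviation P_add (infixl "\<oplus>\<^sub>P" 65) where "x \<oplus>\<^sub>P y \<equiv> x \<oplus>\<^bsub>PP\<^esub> y"
abbreviation P_minus (infixl "\<ominus>\<^sub>P" 65) where "x \<ominus>\<^sub>P y \<equiv> x \<ominus>\<^bsub>PP\<^esub> y"
abbreviation P_smult (infixl "\<odot>\<^sub>P" 70) where "c \<odot>\<^sub>P x \<equiv> c \<odot>\<^bsub>PP\<^esub> x"
abbreviation P_one ("\<one>\<^sub>P") where "\<one>\<^sub>P \<equiv> \<one>\<^bsub>PP\<^esub>"
abbreviation "pg \<equiv> pol_gen q \<mu>"
abbreviation "pm \<equiv> pol_m \<mu>"

sublocale P: complex_star_algebra PP
  by (rule complex_star_algebra_Pol[OF q_nz \<mu>_cases])

sublocale PPT: tensor_product PP PP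
  by unfold_locales

lemmas pg_solution = p_solution_Pol[OF q_nz \<mu>_cases]
lemmas pg_closed [simp, intro] = p_solution_closed[OF pg_solution]
lemmas star_pg = star_pol_gen[OF q_nz \<mu>_cases]

lemma Pol_alg_hom_eqI:
  assumes "alg_hom PP C f" "alg_hom PP C h" "\<And>g. f (pg g) = h (pg g)" "x \<in> carrier PP"
  shows "f x = h x"
  using assms(4)
  by (induction x rule: Pol_induct)
    (simp_all add: assms(3) alg_homD[OF assms(1)] alg_homD[OF assms(2)])

text \<open>The terms absent for \<mu> = 0 receive the coefficient \<open>pm\<close>, which turns
  the case distinction into the parameter \<open>m\<close> of
  \<open>p_relations_comult\<close>.\<close>

lemma comult_gen_eq:
  "Pol_comult_gen q \<mu> Pa = PPT.pure (pg Pa) (pg Pa) \<oplus>\<^bsub>PPT.T\<^esub> complex_of_real pm \<odot>\<^bsub>PPT.T\<^esub> PPT.pure (pg Pc) (pg Pb)"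
  "Pol_comult_gen q \<mu> Pb = PPT.pure (pg Pb) (pg Pa) \<oplus>\<^bsub>PPT.T\<^esub> PPT.pure (pg Pd) (pg Pb)"
  "Pol_comult_gen q \<mu> Pc = PPT.pure (pg Pa) (pg Pc) \<oplus>\<^bsub>PPT.T\<^esub> PPT.pure (pg Pc) (pg Pd)"
  "Pol_comult_gen q \<mu> Pd = complex_of_real pm \<odot>\<^bsub>PPT.T\<^esub> PPT.pure (pg Pb) (pg Pc) \<oplus>\<^bsub>PPT.T\<^esub> PPT.pure (pg Pd) (pg Pd)"
proof -
  have eq: "Pol_comult_gen q \<mu> Pa = (if \<mu> = 0 then PPT.pure (pg Pa) (pg Pa) else
      PPT.pure (pg Pa) (pg Pa) \<oplus>\<^bsub>PPT.T\<^esub> PPT.pure (pg Pc) (pg Pb))"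
    "Pol_comult_gen q \<mu> Pb = PPT.pure (pg Pb) (pg Pa) \<oplus>\<^bsub>PPT.T\<^esub> PPT.pure (pg Pd) (pg Pb)"
    "Pol_comult_gen q \<mu> Pc = (if \<mu> = 0 then PPT.pure (pg Pc) (pg Pd) \<oplus>\<^bsub>PPT.T\<^esub> PPT.pure (pg Pa) (pg Pc) else
      PPT.pure (pg Pa) (pg Pc) \<oplus>\<^bsub>PPT.T\<^esub> PPT.pure (pg Pc) (pg Pd))"
    "Pol_comult_gen q \<mu> Pd = (if \<mu> = 0 then PPT.pure (pg Pd) (pg Pd) else
      PPT.pure (pg Pb) (pg Pc) \<oplus>\<^bsub>PPT.T\<^esub> PPT.pure (pg Pd) (pg Pd))"
    by (simp_all add: Pol_comult_gen_def Let_def)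
  have comm: "PPT.pure (pg Pc) (pg Pd) \<oplus>\<^bsub>PPT.T\<^esub> PPT.pure (pg Pa) (pg Pc) =
      PPT.pure (pg Pa) (pg Pc) \<oplus>\<^bsub>PPT.T\<^esub> PPT.pure (pg Pc) (pg Pd)"
    by (rule PPT.a_comm) simp_all
  show "Pol_comult_gen q \<mu> Pb = PPT.pure (pg Pb) (pg Pa) \<oplus>\<^bsub>PPT.T\<^esub> PPT.pure (pg Pd) (pg Pb)"
    by (rule eq)
  show "Pol_comult_gen q \<mu> Pc = PPT.pure (pg Pa) (pg Pc) \<oplus>\<^bsub>PPT.T\<^esub> PPT.pure (pg Pc) (pg Pd)"
    unfolding eq comm by simp
  have pm: "complex_of_real pm = (if \<mu> = 0 then 0 else 1)"
    by (simp add: pol_m_def)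
  have smult: "(if b then 0 else 1) \<odot>\<^bsub>PPT.T\<^esub> y = (if b then \<zero>\<^bsub>PPT.T\<^esub> else y)"
    if "y \<in> carrier PPT.T" for y b
    using that by (cases b) simp_all
  show "Pol_comult_gen q \<mu> Pa = PPT.pure (pg Pa) (pg Pa) \<oplus>\<^bsub>PPT.T\<^esub> complex_of_real pm \<odot>\<^bsub>PPT.T\<^esub> PPT.pure (pg Pc) (pg Pb)"
    unfolding eq pm smult[OF PPT.pure_closed[OF pg_closed pg_closed]]
      if_distrib[of "\<lambda>t. _ \<oplus>\<^bsub>PPT.T\<^esub> t"] PPT.r_zero[OF PPT.pure_closed[OF pg_closed pg_closed]] ..
  show "Pol_comult_gen q \<mu> Pd = complex_of_real pm \<odot>\<^bsub>PPT.T\<^esub> PPT.pure (pg Pb) (pg Pc) \<oplus>\<^bsub>PPT.T\<^esub> PPT.pure (pg Pd) (pg Pd)"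
    unfolding eq pm smult[OF PPT.pure_closed[OF pg_closed pg_closed]]
      if_distrib[of "\<lambda>t. t \<oplus>\<^bsub>PPT.T\<^esub> _"] PPT.l_zero[OF PPT.pure_closed[OF pg_closed pg_closed]] ..
qed

lemma comult_solution: "p_solution q pm PPT.T (Pol_comult_gen q \<mu>)"
proof -
  let ?i = "in_family PPT.T"
  let ?l = "\<lambda>g. PPT.pure (pg g) \<one>\<^sub>P" and ?r = "\<lambda>g. PPT.pure \<one>\<^sub>P (pg g)"
  note T = PPT.complex_algebra_axioms and simps = PPT.in_family_simps
  have closed: "Pol_comult_gen q \<mu> g \<in> carrier PPT.T" for g
    by (cases g) (simp_all add: comult_gen_eq)
  have l: "p_solution q pm PPT.T ?l" and r: "p_solution q pm PPT.T ?r"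
    using pg_solution unfolding p_solution_def
    by (simp_all add: PPT.pure_mult PPT.pure_linear PPT.one_eq_pure del: of_real_mult of_real_inverse)
  have comm: "?i (?r h) * ?i (?l g) = ?i (?l g) * ?i (?r h)" for g h
    by (simp add: PPT.pure_mult flip: simps)
  have unit: "?i \<one>\<^bsub>PPT.T\<^esub> * ?i t = ?i t \<and> ?i t * ?i \<one>\<^bsub>PPT.T\<^esub> = ?i t" if "t \<in> carrier PPT.T" for t
    using that by (simp flip: simps)
  have gens: "?i (Pol_comult_gen q \<mu> Pa) = ?i (?l Pa) * ?i (?r Pa) + pm *\<^sub>R (?i (?l Pc) * ?i (?r Pb))"
    "?i (Pol_comult_gen q \<mu> Pb) = ?i (?l Pb) * ?i (?r Pa) + ?i (?l Pd) * ?i (?r Pb)"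
    "?i (Pol_comult_gen q \<mu> Pc) = ?i (?l Pa) * ?i (?r Pc) + ?i (?l Pc) * ?i (?r Pd)"
    "?i (Pol_comult_gen q \<mu> Pd) = pm *\<^sub>R (?i (?l Pb) * ?i (?r Pc)) + ?i (?l Pd) * ?i (?r Pd)"
    by (simp_all add: comult_gen_eq PPT.pure_mult flip: simps)
  show ?thesis
    unfolding p_solution_iff[OF T closed] gens
  proof (rule p_relations_comult[OF q_nz])
    show "p_relations q pm (?i \<one>\<^bsub>PPT.T\<^esub>) (?i (?l Pa)) (?i (?l Pb)) (?i (?l Pc)) (?i (?l Pd))"
      using p_solution_iff[OF T, of ?l] l by simp
    show "p_relations q pm (?i \<one>\<^bsub>PPT.T\<^esub>) (?i (?r Pa)) (?i (?r Pb)) (?i (?r Pc)) (?i (?r Pd))"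
      using p_solution_iff[OF T, of ?r] r by simp
  qed (use comm unit in auto)
qed

abbreviation "\<Delta> \<equiv> Pol_comult q \<mu>"

lemma alg_hom_comult: "alg_hom PP PPT.T \<Delta>"
  and comult_gen: "\<Delta> (pg g) = Pol_comult_gen q \<mu> g"
  unfolding Pol_comult_def
  by (rule Pol_lift[OF PPT.complex_algebra_axioms comult_solution q_nz])+

lemma star_hom_counit: "star_hom PP complex_alg Pol_counit"
  and counit_gen: "Pol_counit (pg g) = (if g \<in> {Pa, Pd} then 1 else 0)"
proof -
  interpret C: complex_star_algebra complex_alg
    by (rule complex_star_algebra_complex_alg)
  have "p_solution q pm complex_alg (\<lambda>g. if g \<in> {Pa, Pd} then 1 else 0)"
    by (simp add: p_solution_def complex_alg_def)
  note lift = Pol_lift[OF C.complex_algebra_axioms this q_nz, folded Pol_counit_def]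
  show gens: "Pol_counit (pg g) = (if g \<in> {Pa, Pd} then 1 else 0)" for g
    by (rule lift(2))
  have "Pol_counit (star PP x) = cnj (Pol_counit x)" if "x \<in> carrier PP" for x
    using that
  proof (induction x rule: Pol_induct)
    case (gen g)
    show ?case
      by (cases g) (simp_all add: star_pg pol_star_def alg_homD[OF lift(1)] gens complex_alg_def)
  qed (simp_all add: alg_homD[OF lift(1)] P.star_add P.star_mult P.star_smult,
      simp_all add: complex_alg_def mult.commute)
  then show "star_hom PP complex_alg Pol_counit"
    by (simp add: star_hom_iff_alg_hom lift(1)) (simp add: complex_alg_def)
qed

definition "counit_tensor = coset_ext PP (\<lambda>(x, y). Pol_counit x \<odot>\<^sub>P y)"

lemma alg_hom_counit: "alg_hom PP complex_alg Pol_counit"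
  using star_hom_counit by (simp add: star_hom_iff_alg_hom)

lemmas counit_tensor = alg_hom_character_tensor[OF P.complex_algebra_axioms P.complex_algebra_axioms
  alg_hom_counit, folded counit_tensor_def]

text \<open>The left counit law. It is what recovers an equivariant map from its composition with
  the counit.\<close>

lemma counit_comult: "x \<in> carrier PP \<Longrightarrow> counit_tensor (\<Delta> x) = x"
proof (rule Pol_alg_hom_eqI[OF alg_hom_comp[OF alg_hom_comult counit_tensor(1)] alg_hom_id])
  show "counit_tensor (\<Delta> (pg g)) = pg g" for g
    by (cases g) (simp_all add: comult_gen comult_gen_eq alg_homD[OF counit_tensor(1)] counit_tensor(2) counit_gen)
qed

subsection \<open>Representations on formal Laurent series\<close>

text \<open>Left multiplication on series \<open>\<Sum> f (i, j) a\<^sup>i b\<^sup>j\<close> with \<open>ab = qba\<close> and \<open>c = \<kappa>b\<close>.\<close>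

fun series_rep :: "real \<Rightarrow> pgen \<Rightarrow> (int \<times> int \<Rightarrow> complex) \<Rightarrow> int \<times> int \<Rightarrow> complex" where
  "series_rep \<kappa> Pa f (i, j) = f (i - 1, j)"
| "series_rep \<kappa> Pb f (i, j) = complex_of_real (inverse (q powi i)) * f (i, j - 1)"
| "series_rep \<kappa> Pc f (i, j) = complex_of_real (\<kappa> * inverse (q powi i)) * f (i, j - 1)"
| "series_rep \<kappa> Pd f (i, j) = f (i + 1, j) +
     complex_of_real (pm * \<kappa> * inverse q * (inverse (q powi i))\<^sup>2) * f (i + 1, j - 2)"

text \<open>On Laurent series \<open>a\<close> is invertible, so the relation for \<open>ad\<close>
  forces \<open>d\<close> to be the inverse of \<open>a\<close> applied after
  \<open>1 + pm q b c\<close>; this is the formula for \<open>Pd\<close>. The parameter \<kappa>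
  stays free because the two sufficiency cases call for different values.\<close>

lemma series_representation:
  obtains \<rho> where "alg_hom PP op_alg \<rho>" "\<And>g. \<rho> (pg g) = series_rep \<kappa> g"
proof
  have powi: "q powi (i + 1) = q * q powi i" "q powi (i - 1) = q powi i / q" for i
    using q_nz by (simp_all add: power_int_add power_int_diff)
  have closed: "series_rep \<kappa> g \<in> carrier op_alg" for g
    by (cases g) (auto simp: op_alg_simps fun_eq_iff algebra_simps)
  have "p_solution q pm op_alg (series_rep \<kappa>)"
    unfolding p_solution_def
  proof (intro conjI allI closed)
  qed (use q_nz in \<open>auto simp: op_alg_simps(2-) fun_eq_iff powi field_simps power2_eq_square
    simp del: of_real_power_int\<close>)
  note lift = Pol_lift[OF complex_algebra_op_alg this q_nz]
  show "alg_hom PP op_alg (alg_hom_ext op_alg (series_rep \<kappa>))"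
    by (rule lift)
  show "alg_hom_ext op_alg (series_rep \<kappa>) (pg g) = series_rep \<kappa> g" for g
    by (rule lift)
qed

end

section \<open>Characters and equivariant maps\<close>

lemma alg_hom_id': "alg_hom A A id"
  using alg_hom_id by (simp add: id_def)

locale podles_coaction = quantum_parameters q \<mu> \<nu> \<tau> + pol_algebra q \<mu>
  for q \<mu> \<nu> \<tau> :: real +
  fixes \<gamma>
  assumes \<nu>_cases: "\<nu> \<in> {-1, 0, 1}" and gamma: "is_gamma q \<mu> \<nu> \<tau> \<gamma>"
begin

sublocale BPT: tensor_product BB PP
  by unfold_locales

lemma star_hom_gamma: "star_hom BB BPT.T \<gamma>"
  and coassociative: "x \<in> carrier BB \<Longrightarrow>
    tensor_assoc BB PP PP (tensor_map BPT.T PP \<gamma> id (\<gamma> x)) = tensor_map BB PPT.T id \<Delta> (\<gamma> x)"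
  using gamma by (auto simp: is_gamma_def right_coaction_def)

lemma alg_hom_gamma: "alg_hom BB BPT.T \<gamma>"
  using star_hom_gamma by (simp add: star_hom_iff_alg_hom)

lemma gamma_X: "\<gamma> X =
    complex_of_real (- q * \<mu>) \<odot>\<^bsub>BPT.T\<^esub> BPT.pure Xs (pg Pb \<otimes>\<^sub>P pg Pb) \<oplus>\<^bsub>BPT.T\<^esub>
    complex_of_real (- q * (1 + q\<^sup>2) * \<mu>) \<odot>\<^bsub>BPT.T\<^esub> BPT.pure Z (pg Pb \<otimes>\<^sub>P pg Pa) \<oplus>\<^bsub>BPT.T\<^esub>
    BPT.pure X (pg Pa \<otimes>\<^sub>P pg Pa) \<oplus>\<^bsub>BPT.T\<^esub>
    complex_of_real (q * \<tau>) \<odot>\<^bsub>BPT.T\<^esub> BPT.pure \<one>\<^bsub>BB\<^esub> (pg Pb \<otimes>\<^sub>P pg Pa)"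
  using gamma by (simp add: is_gamma_def gamma_X_value_def Let_def B_simps(6) star_XZ)

lemma gamma_Z: "\<gamma> Z =
    BPT.pure Xs (star PP (pg Pa) \<otimes>\<^sub>P pg Pb) \<oplus>\<^bsub>BPT.T\<^esub>
    BPT.pure Z (\<one>\<^sub>P \<ominus>\<^sub>P complex_of_real ((1 + q\<^sup>2) * \<mu>) \<odot>\<^sub>P (star PP (pg Pb) \<otimes>\<^sub>P pg Pb)) \<oplus>\<^bsub>BPT.T\<^esub>
    BPT.pure X (star PP (pg Pb) \<otimes>\<^sub>P pg Pa) \<oplus>\<^bsub>BPT.T\<^esub>
    complex_of_real \<tau> \<odot>\<^bsub>BPT.T\<^esub> BPT.pure \<one>\<^bsub>BB\<^esub> (star PP (pg Pb) \<otimes>\<^sub>P pg Pb)"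
  using gamma by (simp add: is_gamma_def gamma_Z_value_def Let_def B_simps(6) star_XZ)

lemma character_relations:
  assumes "star_hom BB complex_alg \<chi>"
  shows "\<chi> Xs = cnj (\<chi> X)" and "cnj (\<chi> Z) = \<chi> Z"
    and "\<chi> X * \<chi> Z = complex_of_real (q\<^sup>2) * (\<chi> Z * \<chi> X)"
    and "\<chi> X * cnj (\<chi> X) = complex_of_real (- (q\<^sup>2) * \<nu>) + complex_of_real (q\<^sup>2 * \<tau>) * \<chi> Z
      - complex_of_real (q^4 * \<mu>) * (\<chi> Z * \<chi> Z)"
    and "cnj (\<chi> X) * \<chi> X = complex_of_real (- (q\<^sup>2) * \<nu>) + complex_of_real \<tau> * \<chi> Z
      - complex_of_real \<mu> * (\<chi> Z * \<chi> Z)"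
proof -
  interpret C: complex_star_algebra complex_alg
    by (rule complex_star_algebra_complex_alg)
  have \<chi>: "alg_hom BB complex_alg \<chi>" and star: "\<And>x. x \<in> carrier BB \<Longrightarrow> \<chi> (star AA x) = cnj (\<chi> x)"
    using assms by (auto simp: star_hom_iff_alg_hom B_simps complex_alg_def)
  have minus: "x \<ominus>\<^bsub>BB\<^esub> y = x \<ominus>\<^sub>A y" if "x \<in> carrier BB" "y \<in> carrier BB" for x y
    using that B_carrier_A[OF that(2)] by (simp add: a_minus_def B.minus_eq_smult A.minus_eq_smult B_simps)
  have cminus: "x \<ominus>\<^bsub>complex_alg\<^esub> y = x - y" for x y
    using C.minus_eq_smult[of y] by (simp add: a_minus_def complex_alg_def)
  note hom = alg_homD[OF \<chi>] alg_hom_more(3)[OF \<chi> B.complex_algebra_axioms C.complex_algebra_axioms]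
  show Xs: "\<chi> Xs = cnj (\<chi> X)"
    using star[of X] by (simp add: star_XZ)
  show "cnj (\<chi> Z) = \<chi> Z"
    using star[of Z] by (simp add: star_XZ)
  have rel: "X \<otimes>\<^bsub>BB\<^esub> Z = complex_of_real (q\<^sup>2) \<odot>\<^bsub>BB\<^esub> (Z \<otimes>\<^bsub>BB\<^esub> X)"
    "X \<otimes>\<^bsub>BB\<^esub> Xs = complex_of_real (- (q\<^sup>2) * \<nu>) \<odot>\<^bsub>BB\<^esub> \<one>\<^bsub>BB\<^esub> \<oplus>\<^bsub>BB\<^esub>
      complex_of_real (q\<^sup>2 * \<tau>) \<odot>\<^bsub>BB\<^esub> Z \<ominus>\<^bsub>BB\<^esub> complex_of_real (q^4 * \<mu>) \<odot>\<^bsub>BB\<^esub> (Z \<otimes>\<^bsub>BB\<^esub> Z)"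
    "Xs \<otimes>\<^bsub>BB\<^esub> X = complex_of_real (- (q\<^sup>2) * \<nu>) \<odot>\<^bsub>BB\<^esub> \<one>\<^bsub>BB\<^esub> \<oplus>\<^bsub>BB\<^esub>
      complex_of_real \<tau> \<odot>\<^bsub>BB\<^esub> Z \<ominus>\<^bsub>BB\<^esub> complex_of_real \<mu> \<odot>\<^bsub>BB\<^esub> (Z \<otimes>\<^bsub>BB\<^esub> Z)"
    using XZ_relations(1,3,4) minus by (simp_all add: B_simps[symmetric])
  note vals = rel[THEN arg_cong[of _ _ \<chi>]]
  show "\<chi> X * \<chi> Z = complex_of_real (q\<^sup>2) * (\<chi> Z * \<chi> X)"
    using vals(1) by (simp add: hom) (simp add: complex_alg_def)
  show "\<chi> X * cnj (\<chi> X) = complex_of_real (- (q\<^sup>2) * \<nu>) + complex_of_real (q\<^sup>2 * \<tau>) * \<chi> Z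
      - complex_of_real (q^4 * \<mu>) * (\<chi> Z * \<chi> Z)"
    using vals(2) by (simp add: hom Xs cminus) (simp add: complex_alg_def)
  show "cnj (\<chi> X) * \<chi> X = complex_of_real (- (q\<^sup>2) * \<nu>) + complex_of_real \<tau> * \<chi> Z
      - complex_of_real \<mu> * (\<chi> Z * \<chi> Z)"
    using vals(3) by (simp add: hom Xs cminus) (simp add: complex_alg_def)
qed

text \<open>Stated for any \<open>F\<close> that acts as a slice map on pure tensors, so that it
  covers both the map obtained from a given isomorphism and the one built from a given character.
  Both contributions to \<open>b a\<close> are collected, since it is their sum that vanishes in the
  necessity proof.\<close>

lemma value_gamma_X:
  assumes F: "alg_hom BPT.T PP F"
    and pure: "\<And>y p. y \<in> carrier BB \<Longrightarrow> p \<in> carrier PP \<Longrightarrow> F (BPT.pure y p) = \<chi> y \<odot>\<^sub>P p"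
    and \<chi>: "alg_hom BB complex_alg \<chi>"
  shows "F (\<gamma> X) = (complex_of_real (- q * \<mu>) * \<chi> Xs) \<odot>\<^sub>P (pg Pb \<otimes>\<^sub>P pg Pb) \<oplus>\<^sub>P
    \<chi> X \<odot>\<^sub>P (pg Pa \<otimes>\<^sub>P pg Pa) \<oplus>\<^sub>P
    (complex_of_real q * (complex_of_real \<tau> - complex_of_real ((1 + q\<^sup>2) * \<mu>) * \<chi> Z)) \<odot>\<^sub>P (pg Pb \<otimes>\<^sub>P pg Pa)"
proof -
  have one: "\<chi> \<one>\<^bsub>BB\<^esub> = 1"
    using alg_homD(4)[OF \<chi>] by (simp add: complex_alg_def)
  let ?bb = "pg Pb \<otimes>\<^sub>P pg Pb" and ?ba = "pg Pb \<otimes>\<^sub>P pg Pa" and ?aa = "pg Pa \<otimes>\<^sub>P pg Pa"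
  have "F (\<gamma> X) = (complex_of_real (- q * \<mu>) * \<chi> Xs) \<odot>\<^sub>P ?bb \<oplus>\<^sub>P
      (complex_of_real (- q * (1 + q\<^sup>2) * \<mu>) * \<chi> Z) \<odot>\<^sub>P ?ba \<oplus>\<^sub>P \<chi> X \<odot>\<^sub>P ?aa \<oplus>\<^sub>P
      complex_of_real (q * \<tau>) \<odot>\<^sub>P ?ba"
    unfolding gamma_X
    by (simp add: alg_homD[OF F] pure one P.smult_assoc[symmetric] del: of_real_mult of_real_minus)
  also have "\<dots> = (complex_of_real (- q * \<mu>) * \<chi> Xs) \<odot>\<^sub>P ?bb \<oplus>\<^sub>P \<chi> X \<odot>\<^sub>P ?aa \<oplus>\<^sub>P
      (complex_of_real (- q * (1 + q\<^sup>2) * \<mu>) * \<chi> Z + complex_of_real (q * \<tau>)) \<odot>\<^sub>P ?ba"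
    by (simp add: P.smult_l_distr P.a_ac del: of_real_mult of_real_minus)
  also have "complex_of_real (- q * (1 + q\<^sup>2) * \<mu>) * \<chi> Z + complex_of_real (q * \<tau>) =
      complex_of_real q * (complex_of_real \<tau> - complex_of_real ((1 + q\<^sup>2) * \<mu>) * \<chi> Z)"
    by (simp add: algebra_simps)
  finally show ?thesis .
qed

lemma value_gamma_Z:
  assumes F: "alg_hom BPT.T PP F"
    and pure: "\<And>y p. y \<in> carrier BB \<Longrightarrow> p \<in> carrier PP \<Longrightarrow> F (BPT.pure y p) = \<chi> y \<odot>\<^sub>P p"
    and \<chi>: "alg_hom BB complex_alg \<chi>" and "\<chi> Z = 0"
  shows "F (\<gamma> Z) = \<chi> Xs \<odot>\<^sub>P (star PP (pg Pa) \<otimes>\<^sub>P pg Pb) \<oplus>\<^sub>P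
    \<chi> X \<odot>\<^sub>P (star PP (pg Pb) \<otimes>\<^sub>P pg Pa) \<oplus>\<^sub>P
    complex_of_real \<tau> \<odot>\<^sub>P (star PP (pg Pb) \<otimes>\<^sub>P pg Pb)"
proof -
  have one: "\<chi> \<one>\<^bsub>BB\<^esub> = 1"
    using alg_homD(4)[OF \<chi>] by (simp add: complex_alg_def)
  show ?thesis
    unfolding gamma_Z by (simp add: alg_homD[OF F] pure one assms(4))
qed

subsection \<open>Necessity\<close>

lemma coideal_necessary:
  assumes I: "right_star_coideal PP \<Delta> I" and iso: "equivariantly_star_iso_to_coideal BB PP \<Delta> \<gamma> I"
  shows "\<nu> = -1 \<or> \<nu> = 0 \<and> \<tau> \<noteq> 0"
proof (rule ccontr)
  assume contr: "\<not> ?thesis"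
  obtain \<pi> where \<pi>: "star_hom BB (PP\<lparr>carrier := I\<rparr>) \<pi>" "bij_betw \<pi> (carrier BB) I"
    and equi: "\<And>x. x \<in> carrier BB \<Longrightarrow> tensor_map PP PP \<pi> id (\<gamma> x) = \<Delta> (\<pi> x)"
    using iso by (auto simp: equivariantly_star_iso_to_coideal_def)
  have "I \<subseteq> carrier PP"
    using I subringE(1) by (auto simp: right_star_coideal_def star_subalgebra_def)
  with \<pi>(1) have \<pi>P: "star_hom BB PP \<pi>"
    by (auto simp: star_hom_def ring_hom_def)
  then have \<pi>A: "alg_hom BB PP \<pi>"
    by (simp add: star_hom_iff_alg_hom)
  define \<chi> where "\<chi> x = Pol_counit (\<pi> x)" for x
  have \<chi>: "star_hom BB complex_alg \<chi>"
    using \<pi>P star_hom_counit alg_hom_comp[OF \<pi>A alg_hom_counit]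
    by (auto simp: star_hom_iff_alg_hom \<chi>_def[abs_def] alg_homD(1)[OF \<pi>A])
  then have \<chi>A: "alg_hom BB complex_alg \<chi>"
    by (simp add: star_hom_iff_alg_hom)
  note tm = alg_hom_tensor_map[OF B.complex_algebra_axioms P.complex_algebra_axioms
      P.complex_algebra_axioms P.complex_algebra_axioms \<pi>A alg_hom_id']
  \<comment> \<open>Equivariance and the counit law give \<open>\<pi> X = F (\<gamma> X)\<close>,
    while on pure tensors \<open>F\<close> is the slice map of \<chi>.\<close>
  define F where "F t = counit_tensor (tensor_map PP PP \<pi> id t)" for t
  have F: "alg_hom BPT.T PP F"
    unfolding F_def by (rule alg_hom_comp[OF tm(1) counit_tensor(1)])
  have pure: "F (BPT.pure y p) = \<chi> y \<odot>\<^sub>P p" if "y \<in> carrier BB" "p \<in> carrier PP" for y p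
    using that by (simp add: F_def tm(2) counit_tensor(2) \<chi>_def alg_homD(1)[OF \<pi>A])
  have piX: "\<pi> X = F (\<gamma> X)"
    by (simp add: F_def equi counit_comult alg_homD(1)[OF \<pi>A])
  note rel = character_relations[OF \<chi>]
  \<comment> \<open>These are the coefficients in \<open>F (\<gamma> X)\<close>, as
    \<open>\<chi> Xs\<close> is the conjugate of \<open>\<chi> X\<close>. If
    \<open>\<chi> Z = 0\<close>, positivity of the modulus excludes \<nu> = 1, and the assumption to
    be refuted leaves only \<nu> = \<tau> = 0.\<close>
  have "\<chi> X = 0 \<and> complex_of_real \<tau> - complex_of_real ((1 + q\<^sup>2) * \<mu>) * \<chi> Z = 0"
  proof (cases "\<chi> Z = 0")
    case True
    then have "complex_of_real ((cmod (\<chi> X))\<^sup>2) = complex_of_real (- (q\<^sup>2) * \<nu>)"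
      using rel(4) complex_norm_square[of "\<chi> X"] by simp
    then have "(cmod (\<chi> X))\<^sup>2 = - (q\<^sup>2) * \<nu>"
      by (simp only: of_real_eq_iff)
    moreover from this have "\<nu> \<le> 0"
      using q_pos by (smt (verit) mult_minus_left mult_pos_pos zero_le_power2 zero_less_power)
    ultimately show ?thesis
      using contr \<nu>_cases True by auto
  next
    case False
    have q2: "complex_of_real (q\<^sup>2) \<noteq> 1"
      using q_pos q_less_1 by (simp add: power2_eq_1_iff del: of_real_power)
    have "(1 - complex_of_real (q\<^sup>2)) * (\<chi> X * \<chi> Z) = 0"
      using rel(3) by (simp add: algebra_simps)
    then have X0: "\<chi> X = 0"
      using False q2 by simp
    have cancel: "x - y = u - v" if "0 = a + x - y" "0 = a + u - v" for a x y u v :: complex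
      using that by (metis add_diff_eq add_left_cancel)
    have "complex_of_real (q\<^sup>2 * \<tau>) * \<chi> Z - complex_of_real (q^4 * \<mu>) * (\<chi> Z * \<chi> Z) =
        complex_of_real \<tau> * \<chi> Z - complex_of_real \<mu> * (\<chi> Z * \<chi> Z)"
      by (rule cancel[of "complex_of_real (- (q\<^sup>2) * \<nu>)"]; use rel(4,5) X0 in simp)
    \<comment> \<open>The difference of the two expressions for the modulus, factored by means of
      \<open>1 - q^4 = (1 - q\<^sup>2) * (1 + q\<^sup>2)\<close>.\<close>
    then have "(1 - complex_of_real (q\<^sup>2)) * \<chi> Z *
        (complex_of_real \<tau> - complex_of_real ((1 + q\<^sup>2) * \<mu>) * \<chi> Z) = 0"
      by (simp add: algebra_simps power2_eq_square power4_eq_xxxx)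
    then show ?thesis
      using False q2 X0 by simp
  qed
  then have "\<pi> X = \<zero>\<^bsub>PP\<^esub>"
    using rel(1) value_gamma_X[OF F pure \<chi>A] by (simp add: piX)
  also have "\<dots> = \<pi> \<zero>\<^bsub>BB\<^esub>"
    using alg_hom_more(1)[OF \<pi>A B.complex_algebra_axioms P.complex_algebra_axioms] by simp
  finally have "X = \<zero>\<^bsub>BB\<^esub>"
    using \<pi>(2) by (auto simp: bij_betw_def dest: inj_onD)
  then show False
    using X_nonzero by (simp add: B_simps)
qed

subsection \<open>Sufficiency\<close>

context
  fixes \<chi>
  assumes \<chi>: "star_hom BB complex_alg \<chi>"
begin

lemma \<chi>_alg_hom: "alg_hom BB complex_alg \<chi>"
  using \<chi> by (simp add: star_hom_iff_alg_hom)

definition chi_tensor where "chi_tensor = coset_ext PP (\<lambda>(x, y). \<chi> x \<odot>\<^sub>P y)"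

lemmas chi_tensor = alg_hom_character_tensor[OF B.complex_algebra_axioms P.complex_algebra_axioms
  \<chi>_alg_hom, folded chi_tensor_def]

definition chi_map where "chi_map x = chi_tensor (\<gamma> x)"

lemma alg_hom_chi_map: "alg_hom BB PP chi_map"
  unfolding chi_map_def by (rule alg_hom_comp[OF alg_hom_gamma chi_tensor(1)])

lemma star_hom_chi_map: "star_hom BB PP chi_map"
proof -
  have "chi_tensor (star BPT.T t) = star PP (chi_tensor t)" if "t \<in> carrier BPT.T" for t
    using that
  proof (induction t rule: BPT.tensor_induct)
    case (pure x y)
    have "\<chi> (star BB x) = cnj (\<chi> x)"
      using \<chi> pure(1) by (simp add: star_hom_def) (simp add: complex_alg_def)
    then show ?case
      using pure
      by (simp add: complex_star_algebra_tensor(2)[OF B.complex_star_algebra_axioms P.complex_star_algebra_axioms]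
          chi_tensor(2) P.star_smult)
  next
    case (add s t)
    interpret T: complex_star_algebra BPT.T
      by (rule complex_star_algebra_tensor[OF B.complex_star_algebra_axioms P.complex_star_algebra_axioms])
    show ?case
      using add by (simp add: T.star_add alg_homD[OF chi_tensor(1)] P.star_add)
  next
    case (smult c t)
    interpret T: complex_star_algebra BPT.T
      by (rule complex_star_algebra_tensor[OF B.complex_star_algebra_axioms P.complex_star_algebra_axioms])
    show ?case
      using smult by (simp add: T.star_smult alg_homD[OF chi_tensor(1)] P.star_smult)
  qed
  then show ?thesis
    using star_hom_gamma alg_hom_chi_map
    by (simp add: star_hom_iff_alg_hom chi_map_def alg_homD(1)[OF alg_hom_gamma])
qed

text \<open>Equivariance is \<open>\<chi> \<otimes> \<iota> \<otimes> \<iota>\<close> applied to coassociativity.\<close>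

lemma chi_map_equivariant:
  assumes "x \<in> carrier BB"
  shows "tensor_map PP PP chi_map id (\<gamma> x) = \<Delta> (chi_map x)"
proof -
  interpret B_PPT: tensor_product BB PPT.T
    by unfold_locales
  interpret BPT_P: tensor_product BPT.T PP
    by unfold_locales
  note BA = B.complex_algebra_axioms and PA = P.complex_algebra_axioms
    and PPA = PPT.complex_algebra_axioms and BPA = BPT.complex_algebra_axioms
  define N where "N = coset_ext PPT.T (\<lambda>(x, y). \<chi> x \<odot>\<^bsub>PPT.T\<^esub> y)"
  note N = alg_hom_character_tensor[OF BA PPA \<chi>_alg_hom, folded N_def]
  note assoc = alg_hom_tensor_assoc[OF BA PA PA]
  note tm_gamma = alg_hom_tensor_map[OF BA PA BPA PA alg_hom_gamma alg_hom_id']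
  note tm_Delta = alg_hom_tensor_map[OF BA PA BA PPA alg_hom_id' alg_hom_comult]
  note tm_chi = alg_hom_tensor_map[OF BA PA PA PA alg_hom_chi_map alg_hom_id']
  note hom_N_assoc = alg_hom_comp[OF assoc(1) N(1)]
  \<comment> \<open>The first leg \<open>s\<close> is arbitrary, not a pure tensor, because the
    statement is applied to \<open>\<gamma> y\<close>.\<close>
  have NA: "N (tensor_assoc BB PP PP (BPT_P.pure s p)) = PPT.pure (chi_tensor s) p"
    if "s \<in> carrier BPT.T" and p: "p \<in> carrier PP" for s p
    using that(1)
  proof (induction s rule: BPT.tensor_induct)
    case (pure y r)
    then show ?case
      using p by (simp add: assoc(2) N(2) chi_tensor(2) PPT.pure_smult_left)
  next
    case (add s t)
    then show ?case
      using p alg_homD(3)[OF hom_N_assoc, of "BPT_P.pure s p" "BPT_P.pure t p"]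
      by (simp add: BPT_P.pure_add_left alg_homD[OF chi_tensor(1)] PPT.pure_add_left)
  next
    case (smult c t)
    then show ?case
      using p alg_homD(5)[OF hom_N_assoc, of "BPT_P.pure t p" c]
      by (simp add: BPT_P.pure_smult_left alg_homD[OF chi_tensor(1)] PPT.pure_smult_left)
  qed
  have left: "N (tensor_assoc BB PP PP (tensor_map BPT.T PP \<gamma> id t)) = tensor_map PP PP chi_map id t"
    if "t \<in> carrier BPT.T" for t
  proof (rule BPT.alg_hom_tensor_eqI[OF alg_hom_comp[OF tm_gamma(1) hom_N_assoc] tm_chi(1) _ that])
    fix y p assume yp: "y \<in> carrier BB" "p \<in> carrier PP"
    then show "N (tensor_assoc BB PP PP (tensor_map BPT.T PP \<gamma> id (BPT.pure y p))) =
        tensor_map PP PP chi_map id (BPT.pure y p)"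
      using NA[of "\<gamma> y" p] by (simp add: tm_gamma(2) tm_chi(2) alg_homD(1)[OF alg_hom_gamma] chi_map_def)
  qed
  have right: "N (tensor_map BB PPT.T id \<Delta> t) = \<Delta> (chi_tensor t)" if "t \<in> carrier BPT.T" for t
  proof (rule BPT.alg_hom_tensor_eqI[OF alg_hom_comp[OF tm_Delta(1) N(1)]
        alg_hom_comp[OF chi_tensor(1) alg_hom_comult] _ that])
    fix y p assume yp: "y \<in> carrier BB" "p \<in> carrier PP"
    then show "N (tensor_map BB PPT.T id \<Delta> (BPT.pure y p)) = \<Delta> (chi_tensor (BPT.pure y p))"
      by (simp add: tm_Delta(2) N(2) chi_tensor(2) alg_homD[OF alg_hom_comult])
  qed
  note gx = alg_homD(1)[OF alg_hom_gamma assms]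
  show ?thesis
    unfolding left[OF gx, symmetric] coassociative[OF assms] right[OF gx] chi_map_def ..
qed

text \<open>The image of \<open>chi_map\<close> is a *-subalgebra, and by equivariance the
  comultiplication maps it into the image of \<open>chi_map\<close> tensored with the
  identity.\<close>

lemma coideal_of_injective:
  assumes inj: "inj_on chi_map (carrier BB)"
  shows "\<exists>I. right_star_coideal PP \<Delta> I \<and> equivariantly_star_iso_to_coideal BB PP \<Delta> \<gamma> I"
proof -
  define I where "I = chi_map ` carrier BB"
  have mem_I: "chi_map y \<in> I" if "y \<in> carrier BB" for y
    using that by (simp add: I_def)
  note hom = alg_homD[OF alg_hom_chi_map]
  have star: "star PP (chi_map x) = chi_map (star BB x)" if "x \<in> carrier BB" for x
    using star_hom_chi_map that by (simp add: star_hom_def)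
  have I: "star_subalgebra I PP"
    unfolding star_subalgebra_def
  proof (intro conjI P.subringI)
    show "\<one>\<^sub>P \<in> I"
      unfolding I_def using hom(4) B.one_closed by (metis imageI)
  next
    fix h assume "h \<in> I"
    then show "\<ominus>\<^bsub>PP\<^esub> h \<in> I"
      using alg_hom_more(2)[OF alg_hom_chi_map B.complex_algebra_axioms P.complex_algebra_axioms]
      by (auto simp: I_def intro!: image_eqI[of _ _ "\<ominus>\<^bsub>BB\<^esub> x" for x])
  qed (auto simp: I_def hom star simp flip: hom(2,3,5))
  have PI: "complex_star_algebra (PP\<lparr>carrier := I\<rparr>)"
    by (rule complex_star_algebra_subalgebra[OF P.complex_star_algebra_axioms I])
  then have PIA: "complex_algebra (PP\<lparr>carrier := I\<rparr>)"
    by (rule complex_star_algebra.axioms)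
  have star_hom_I: "star_hom BB (PP\<lparr>carrier := I\<rparr>) chi_map"
    using star_hom_chi_map by (auto simp: star_hom_def ring_hom_def I_def)
  then have hom_I: "alg_hom BB (PP\<lparr>carrier := I\<rparr>) chi_map"
    by (simp add: star_hom_iff_alg_hom)
  have incl: "alg_hom (PP\<lparr>carrier := I\<rparr>) PP id"
    by (rule alg_homI) (auto simp: I_def hom(1))
  note tm_I = alg_hom_tensor_map[OF B.complex_algebra_axioms P.complex_algebra_axioms PIA
      P.complex_algebra_axioms hom_I alg_hom_id']
  note tm_incl = alg_hom_tensor_map[OF PIA P.complex_algebra_axioms P.complex_algebra_axioms
      P.complex_algebra_axioms incl alg_hom_id']
  note tm_chi = alg_hom_tensor_map[OF B.complex_algebra_axioms P.complex_algebra_axioms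
      P.complex_algebra_axioms P.complex_algebra_axioms alg_hom_chi_map alg_hom_id']
  \<comment> \<open>The coideal condition asks for preimages in the tensor product over
    \<open>I\<close> itself, so the map is factored through the inclusion of
    \<open>I\<close>.\<close>
  have factor: "tensor_map PP PP chi_map id t =
      tensor_map PP PP id id (tensor_map (PP\<lparr>carrier := I\<rparr>) PP chi_map id t)"
    if "t \<in> carrier BPT.T" for t
  proof (rule BPT.alg_hom_tensor_eqI[OF tm_chi(1) alg_hom_comp[OF tm_I(1) tm_incl(1)] _ that])
    fix y p assume "y \<in> carrier BB" "p \<in> carrier PP"
    then show "tensor_map PP PP chi_map id (BPT.pure y p) =
        tensor_map PP PP id id (tensor_map (PP\<lparr>carrier := I\<rparr>) PP chi_map id (BPT.pure y p))"
      by (simp add: tm_chi(2) tm_I(2) tm_incl(2) mem_I)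
  qed
  have "\<Delta> (chi_map x) \<in> tensor_map PP PP id id ` carrier (tensor (PP\<lparr>carrier := I\<rparr>) PP)"
    if "x \<in> carrier BB" for x
    using chi_map_equivariant[OF that] factor[OF alg_homD(1)[OF alg_hom_gamma that]]
      alg_homD(1)[OF tm_I(1) alg_homD(1)[OF alg_hom_gamma that]]
    by (intro image_eqI) simp_all
  then have "right_star_coideal PP \<Delta> I"
    using I by (auto simp: right_star_coideal_def I_def)
  moreover have "equivariantly_star_iso_to_coideal BB PP \<Delta> \<gamma> I"
    unfolding equivariantly_star_iso_to_coideal_def
    using star_hom_I inj chi_map_equivariant by (intro exI[of _ chi_map]) (auto simp: bij_betw_def I_def)
  ultimately show ?thesis
    by blast
qed

end

text \<open>Injectivity is read off from the terms of lowest order in \<open>b\<close> in the series representations.\<close>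

definition lowest_term :: "(int \<times> int \<Rightarrow> complex) \<Rightarrow> int \<times> int \<Rightarrow> bool" where
  "lowest_term g P \<longleftrightarrow> g P \<noteq> 0 \<and>
     (\<forall>i j. j < snd P \<or> j = snd P \<and> i \<noteq> fst P \<longrightarrow> g (i, j) = 0)"

text \<open>Among the indices with nonzero coefficient take one whose place has the least exponent
  of \<open>b\<close>. There every other series vanishes: either the place lies below its lowest
  row, or it lies in that row but at a different position. Higher rows are not controlled at
  all.\<close>

lemma lowest_terms_independent:
  fixes G :: "'m \<Rightarrow> int \<times> int \<Rightarrow> complex"
  assumes G: "\<And>m. lowest_term (G m) (P m)" and P: "inj P"
    and zero: "\<And>t. (\<Sum>m\<in>keys p. lookup p m * G m t) = 0"
  shows "p = 0"
proof (rule ccontr)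
  assume "p \<noteq> 0"
  then have "keys p \<noteq> {}"
    by simp
  then obtain m0 where m0: "m0 \<in> keys p"
    "\<And>m. m \<in> keys p \<Longrightarrow> snd (P m0) \<le> snd (P m)"
    using ex_is_arg_min_if_finite[OF finite_keys, of p "\<lambda>m. snd (P m)"]
    by (auto simp: is_arg_min_linorder)
  have "G m (P m0) = 0" if "m \<in> keys p" "m \<noteq> m0" for m
  proof -
    have "P m \<noteq> P m0"
      using P that(2) by (auto dest: injD)
    then have "G m (fst (P m0), snd (P m0)) = 0"
      using G[of m] m0(2)[OF that(1)] unfolding lowest_term_def prod_eq_iff
      by (metis order_le_imp_less_or_eq)
    then show ?thesis
      by simp
  qed
  then have "(\<Sum>m\<in>keys p. lookup p m * G m (P m0)) =
      lookup p m0 * G m0 (P m0)"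
    using m0(1) by (subst sum.remove[OF finite_keys m0(1)]) simp
  then show False
    using zero[of "P m0"] m0(1) G[of m0] by (simp add: in_keys_iff lowest_term_def)
qed

section \<open>Injectivity from leading terms\<close>

lemma left_pow_closed_B: "x \<in> carrier BB \<Longrightarrow> left_pow x n \<in> carrier BB"
  by (induction n) (use B.one_closed B.m_closed in \<open>simp_all add: B_simps\<close>)

lemma X_pow_closed_B: "X_pow k \<in> carrier BB"
  by (simp add: X_pow_def left_pow_closed_B)

lemma B_mon_closed_B: "B_mon m \<in> carrier BB"
  using B.m_closed[OF X_pow_closed_B left_pow_closed_B] by (simp add: B_mon_def B_simps split: prod.split)

text \<open>Each factor shifts the place of the lowest term by a fixed vector, so the image of
  \<open>B_mon (k, l)\<close> applied to one fixed series has its lowest term at the place listed in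
  \<open>inj\<close>. The modulus of \<open>k\<close> appears because \<open>X\<close> and
  \<open>Xs\<close> raise the exponent of \<open>b\<close> by the same amount \<beta>.\<close>

lemma injective_by_lowest_terms:
  assumes h: "alg_hom BB PP h" and \<rho>: "alg_hom PP op_alg \<rho>"
    and X: "\<And>g i j. lowest_term g (i, j) \<Longrightarrow> lowest_term (\<rho> (h X) g) (i + \<alpha>, j + \<beta>)"
    and Xs: "\<And>g i j. lowest_term g (i, j) \<Longrightarrow> lowest_term (\<rho> (h Xs) g) (i - \<alpha>, j + \<beta>)"
    and Z: "\<And>g i j. lowest_term g (i, j) \<Longrightarrow> lowest_term (\<rho> (h Z) g) (i + \<alpha>', j + \<beta>')"
    and inj: "inj (\<lambda>(k, l :: nat). (\<alpha> * k + \<alpha>' * int l, \<beta> * \<bar>k\<bar> + \<beta>' * int l))"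
  shows "inj_on h (carrier BB)"
proof -
  \<comment> \<open>The series 1, that is, the monomial with both exponents 0.\<close>
  define \<delta> :: "int \<times> int \<Rightarrow> complex" where "\<delta> = (\<lambda>t. if t = (0, 0) then 1 else 0)"
  define V where "V y = \<rho> (h y) \<delta>" for y
  note hom = alg_homD[OF alg_hom_comp[OF h \<rho>], unfolded B_simps]
  have mult: "V (y \<otimes>\<^sub>A z) = \<rho> (h y) (V z)" if "y \<in> carrier BB" "z \<in> carrier BB" for y z
    using that by (simp add: V_def hom op_alg_simps)
  have pow: "lowest_term (V (left_pow y n \<otimes>\<^sub>A z)) (i + a * int n, j + b * int n)"
    if y: "y \<in> carrier BB" and z: "z \<in> carrier BB" and lt: "lowest_term (V z) (i, j)"
      and step: "\<And>g i j. lowest_term g (i, j) \<Longrightarrow> lowest_term (\<rho> (h y) g) (i + a, j + b)"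
    for y z n i j a b
  proof (induction n)
    case 0
    then show ?case
      using lt B_carrier_A[OF z] by simp
  next
    case (Suc n)
    have "left_pow y (Suc n) \<otimes>\<^sub>A z = y \<otimes>\<^sub>A (left_pow y n \<otimes>\<^sub>A z)"
      using B_carrier_A[OF y] B_carrier_A[OF z] by (simp add: A.m_assoc)
    moreover have "left_pow y n \<otimes>\<^sub>A z \<in> carrier BB"
      using B.m_closed[OF left_pow_closed_B[OF y] z] by (simp add: B_simps)
    ultimately show ?case
      using step[OF Suc] mult[OF y] by (simp add: algebra_simps)
  qed
  define P where "P = (\<lambda>(k, l :: nat). (\<alpha> * k + \<alpha>' * int l, \<beta> * \<bar>k\<bar> + \<beta>' * int l))"
  have lt: "lowest_term (V (B_mon m)) (P m)" for m
  proof -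
    obtain k l where m: "m = (k, l)"
      by (cases m)
    have "lowest_term (V \<one>\<^sub>A) (0, 0)"
      by (simp add: V_def hom(4) op_alg_simps \<delta>_def lowest_term_def)
    then have "lowest_term (V (left_pow Z l)) (\<alpha>' * int l, \<beta>' * int l)"
      using pow[of Z "\<one>\<^sub>A" 0 0 \<alpha>' \<beta>' l] Z B.one_closed by (simp add: B_simps)
    note Zl = this
    show ?thesis
    proof (cases "0 \<le> k")
      case True
      then show ?thesis
        using pow[OF _ _ Zl X, of "nat k"] left_pow_closed_B[of Z l]
        by (simp add: m B_mon_def X_pow_def P_def algebra_simps)
    next
      case False
      then show ?thesis
        using pow[OF _ _ Zl, of Xs "- \<alpha>" \<beta> "nat (- k)"] Xs left_pow_closed_B[of Z l]
        by (simp add: m B_mon_def X_pow_def P_def algebra_simps)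
    qed
  qed
  have sum: "(\<Oplus>\<^bsub>AA\<^esub>m\<in>S. c m \<odot>\<^sub>A B_mon m) \<in> carrier BB \<and>
      V (\<Oplus>\<^bsub>AA\<^esub>m\<in>S. c m \<odot>\<^sub>A B_mon m) t = (\<Sum>m\<in>S. c m * V (B_mon m) t)"
    if "finite S" for S c t
    using that
  proof (induction S rule: finite_induct)
    case empty
    then show ?case
      using B.zero_closed alg_hom_more(1)[OF alg_hom_comp[OF h \<rho>] B.complex_algebra_axioms complex_algebra_op_alg]
      by (simp add: V_def B_simps op_alg_simps)
  next
    case (insert m S)
    have closed: "c m \<odot>\<^sub>A B_mon m \<in> carrier BB"
      using B.smult_closed[OF B_mon_closed_B] by (simp add: B_simps)
    have "(\<Oplus>\<^bsub>AA\<^esub>m\<in>insert m S. c m \<odot>\<^sub>A B_mon m) =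
        c m \<odot>\<^sub>A B_mon m \<oplus>\<^sub>A (\<Oplus>\<^bsub>AA\<^esub>m\<in>S. c m \<odot>\<^sub>A B_mon m)"
      using insert.hyps by (simp add: A.finsum_insert)
    then show ?case
      using insert.IH insert.hyps closed B.a_closed[OF closed]
      by (simp add: V_def hom op_alg_simps B_simps B_mon_closed_B)
  qed
  show ?thesis
  proof (rule inj_onI)
    fix x y assume x: "x \<in> carrier BB" and y: "y \<in> carrier BB" and eq: "h x = h y"
    have xy: "x \<ominus>\<^bsub>BB\<^esub> y \<in> carrier BB"
      using x y by simp
    then have "x \<ominus>\<^bsub>BB\<^esub> y \<in> B_span"
      using B_subset_span by blast
    then obtain p where p: "x \<ominus>\<^bsub>BB\<^esub> y = lin_ext AA B_mon p"
      by (auto simp: B_span_def)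
    have "h (x \<ominus>\<^bsub>BB\<^esub> y) = \<zero>\<^bsub>PP\<^esub>"
      using x y by (simp add: alg_hom_more(3)[OF h B.complex_algebra_axioms P.complex_algebra_axioms] eq alg_homD(1)[OF h])
    then have "V (x \<ominus>\<^bsub>BB\<^esub> y) t = 0" for t
      by (simp add: V_def alg_hom_more(1)[OF \<rho> P.complex_algebra_axioms complex_algebra_op_alg] op_alg_simps)
    then have "(\<Sum>m\<in>keys p. lookup p m * V (B_mon m) t) = 0" for t
      using sum[OF finite_keys[of p], of "lookup p" t] by (simp add: p lin_ext_def)
    from lowest_terms_independent[OF lt inj[folded P_def] this] have "x \<ominus>\<^bsub>BB\<^esub> y = \<zero>\<^bsub>BB\<^esub>"
      by (simp add: p B_simps)
    then show "x = y"
      using x y by simp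
  qed
qed

text \<open>The scalar \<open>s\<close> differs among the three algebras; for leading terms only
  \<open>s \<noteq> 0\<close> counts, so it is kept abstract.\<close>

lemma star_pg_ab: "star PP (pg Pa) = pg Pd" "\<exists>s. s \<noteq> 0 \<and> star PP (pg Pb) = s \<odot>\<^sub>P pg Pc"
proof -
  have "pol_star q \<mu> Pa = (1, Pd)" "snd (pol_star q \<mu> Pb) = Pc" "fst (pol_star q \<mu> Pb) \<noteq> 0"
    by (auto simp: pol_star_def)
  then show "star PP (pg Pa) = pg Pd"
    "\<exists>s. s \<noteq> 0 \<and> star PP (pg Pb) = s \<odot>\<^sub>P pg Pc"
    using star_pg[of Pa] star_pg[of Pb] by auto
qed

section \<open>The coideals for \<nu> = -1 and for \<nu> = 0 with nonzero \<tau>\<close>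

lemma coideal_nu_minus_one:
  assumes "\<nu> = -1"
  shows "\<exists>I. right_star_coideal PP \<Delta> I \<and> equivariantly_star_iso_to_coideal BB PP \<Delta> \<gamma> I"
proof -
  obtain \<chi> where \<chi>: "star_hom BB complex_alg \<chi>" "\<chi> Z = 0" "\<chi> X = complex_of_real q"
    using character_nu_minus_one[OF assms] by blast
  have Xs: "\<chi> Xs = complex_of_real q"
    using character_relations(1)[OF \<chi>(1)] \<chi>(3) by simp
  note c = chi_tensor[OF \<chi>(1)] and cA = \<chi>_alg_hom[OF \<chi>(1)] and hom = alg_hom_chi_map[OF \<chi>(1)]
  obtain s where s: "s \<noteq> 0" "star PP (pg Pb) = s \<odot>\<^sub>P pg Pc"
    using star_pg_ab(2) by blast
  \<comment> \<open>With \<kappa> = 0 the generator c acts as zero and \<open>a\<close>,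
    \<open>d\<close> are inverse shifts. This loses nothing essential, because the leading terms of
    \<open>X\<close> and \<open>Xs\<close> come from \<open>a a\<close> and \<open>d d\<close>, and
    that of \<open>Z\<close> from \<open>d b\<close>.\<close>
  obtain \<rho> where \<rho>: "alg_hom PP op_alg \<rho>" "\<And>g. \<rho> (pg g) = series_rep 0 g"
    using series_representation[of 0] by blast
  note r = alg_homD[OF \<rho>(1)]
  have powi: "q powi i \<noteq> 0" for i
    by simp
  have hX: "chi_map \<chi> X = (complex_of_real (- q * \<mu>) * complex_of_real q) \<odot>\<^sub>P (pg Pb \<otimes>\<^sub>P pg Pb) \<oplus>\<^sub>P
      complex_of_real q \<odot>\<^sub>P (pg Pa \<otimes>\<^sub>P pg Pa) \<oplus>\<^sub>P
      complex_of_real (q * \<tau>) \<odot>\<^sub>P (pg Pb \<otimes>\<^sub>P pg Pa)"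
    using value_gamma_X[OF c cA] by (simp add: chi_map_def[OF \<chi>(1)] \<chi>(2,3) Xs)
  have "chi_map \<chi> (star BB X) = star PP (chi_map \<chi> X)"
    using star_hom_chi_map[OF \<chi>(1)] by (simp add: star_hom_def)
  then have hXs: "chi_map \<chi> Xs = star PP (chi_map \<chi> X)"
    by (simp add: B_simps star_XZ)
  have hZ: "chi_map \<chi> Z = complex_of_real q \<odot>\<^sub>P (star PP (pg Pa) \<otimes>\<^sub>P pg Pb) \<oplus>\<^sub>P
    complex_of_real q \<odot>\<^sub>P (star PP (pg Pb) \<otimes>\<^sub>P pg Pa) \<oplus>\<^sub>P
    complex_of_real \<tau> \<odot>\<^sub>P (star PP (pg Pb) \<otimes>\<^sub>P pg Pb)"
    using value_gamma_Z[OF c cA \<chi>(2)] by (simp add: chi_map_def[OF \<chi>(1)] \<chi>(3) Xs)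
  have X_op: "\<rho> (chi_map \<chi> X) g (i, j) =
      - complex_of_real (q * \<mu> * q * (inverse (q powi i))\<^sup>2) * g (i, j - 2) +
      complex_of_real q * g (i - 2, j) + complex_of_real (q * \<tau> * inverse (q powi i)) * g (i - 1, j - 1)" for g i j
    by (simp add: hX r \<rho>(2) op_alg_simps power2_eq_square)
  have Xs_op: "\<rho> (chi_map \<chi> Xs) g (i, j) = complex_of_real q * g (i + 2, j)" for g i j
    by (simp add: hXs hX P.star_add P.star_smult P.star_mult s star_pg_ab(1) r \<rho>(2) op_alg_simps add.commute)
  have Z_op: "\<rho> (chi_map \<chi> Z) g (i, j) = complex_of_real (q * inverse (q powi (i + 1))) * g (i + 1, j - 1)" for g i j
    by (simp add: hZ s star_pg_ab(1) r \<rho>(2) op_alg_simps)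
  have "inj_on (chi_map \<chi>) (carrier BB)"
  \<comment> \<open>The shifts are (2, 0) for \<open>X\<close>, (-2, 0) for \<open>Xs\<close> and
    (-1, 1) for \<open>Z\<close>. The second coordinate of a place recovers \<open>l\<close>, and
    the first one then recovers \<open>k\<close>.\<close>
  proof (rule injective_by_lowest_terms[OF hom \<rho>(1), of 2 0 "-1" 1])
    show "inj (\<lambda>(k, l). (2 * k + - 1 * int l, 0 * \<bar>k\<bar> + 1 * int l))"
      by (auto simp: inj_def)
  qed (auto simp: lowest_term_def X_op Xs_op Z_op powi)
  then show ?thesis
    by (rule coideal_of_injective[OF \<chi>(1)])
qed

lemma coideal_nu_zero:
  assumes "\<nu> = 0" "\<tau> \<noteq> 0"
  shows "\<exists>I. right_star_coideal PP \<Delta> I \<and> equivariantly_star_iso_to_coideal BB PP \<Delta> \<gamma> I"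
proof -
  obtain \<chi> where \<chi>: "star_hom BB complex_alg \<chi>" "\<chi> Z = 0" "\<chi> X = 0"
    using character_nu_zero[OF assms(1)] by blast
  have Xs: "\<chi> Xs = 0"
    using character_relations(1)[OF \<chi>(1)] \<chi>(3) by simp
  note c = chi_tensor[OF \<chi>(1)] and cA = \<chi>_alg_hom[OF \<chi>(1)] and hom = alg_hom_chi_map[OF \<chi>(1)]
  obtain s where s: "s \<noteq> 0" "star PP (pg Pb) = s \<odot>\<^sub>P pg Pc"
    using star_pg_ab(2) by blast
  \<comment> \<open>The image of \<open>Xs\<close> is a multiple of \<open>d c\<close> and that of
    \<open>Z\<close> a multiple of \<open>c b\<close>. Hence \<kappa> must be nonzero here, or both
    would act as zero.\<close>
  obtain \<rho> where \<rho>: "alg_hom PP op_alg \<rho>" "\<And>g. \<rho> (pg g) = series_rep 1 g"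
    using series_representation[of 1] by blast
  note r = alg_homD[OF \<rho>(1)]
  have powi: "q powi i \<noteq> 0" for i
    by simp
  have hX: "chi_map \<chi> X = complex_of_real (q * \<tau>) \<odot>\<^sub>P (pg Pb \<otimes>\<^sub>P pg Pa)"
    using value_gamma_X[OF c cA] by (simp add: chi_map_def[OF \<chi>(1)] \<chi>(2,3) Xs)
  have "chi_map \<chi> (star BB X) = star PP (chi_map \<chi> X)"
    using star_hom_chi_map[OF \<chi>(1)] by (simp add: star_hom_def)
  then have hXs: "chi_map \<chi> Xs = star PP (chi_map \<chi> X)"
    by (simp add: B_simps star_XZ)
  have hZ: "chi_map \<chi> Z = complex_of_real \<tau> \<odot>\<^sub>P (star PP (pg Pb) \<otimes>\<^sub>P pg Pb)"
    using value_gamma_Z[OF c cA \<chi>(2)] by (simp add: chi_map_def[OF \<chi>(1)] \<chi>(3) Xs)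
  have X_op: "\<rho> (chi_map \<chi> X) g (i, j) = complex_of_real (q * \<tau> * inverse (q powi i)) * g (i - 1, j - 1)" for g i j
    by (simp add: hX r \<rho>(2) op_alg_simps)
  have Xs_op: "\<rho> (chi_map \<chi> Xs) g (i, j) = complex_of_real (q * \<tau>) * s *
      (complex_of_real (inverse (q powi (i + 1))) * g (i + 1, j - 1) +
       complex_of_real (pm * inverse q * (inverse (q powi i))\<^sup>2 * inverse (q powi (i + 1))) * g (i + 1, j - 3))" for g i j
    by (simp add: hXs hX P.star_smult P.star_mult s star_pg_ab(1) r \<rho>(2) op_alg_simps algebra_simps)
  have Z_op: "\<rho> (chi_map \<chi> Z) g (i, j) =
      complex_of_real \<tau> * s * complex_of_real ((inverse (q powi i))\<^sup>2) * g (i, j - 2)" for g i j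
    by (simp add: hZ s star_pg_ab(1) r \<rho>(2) op_alg_simps power2_eq_square)
  have "inj_on (chi_map \<chi>) (carrier BB)"
  \<comment> \<open>The shifts are (1, 1), (-1, 1) and (0, 2) for \<open>X\<close>,
    \<open>Xs\<close> and \<open>Z\<close>. The first coordinate recovers \<open>k\<close>, the
    second then \<open>l\<close>. The leading coefficients are nonzero because \<tau> and
    \<open>s\<close> are.\<close>
  proof (rule injective_by_lowest_terms[OF hom \<rho>(1), of 1 1 0 2])
    show "inj (\<lambda>(k, l). (1 * k + 0 * int l, 1 * \<bar>k\<bar> + 2 * int l))"
      by (auto simp: inj_def)
  qed (auto simp: lowest_term_def X_op Xs_op Z_op powi s assms(2))
  then show ?thesis
    by (rule coideal_of_injective[OF \<chi>(1)])
qed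

end

theorem proposition2p12:
  fixes q \<mu> \<nu> \<tau> :: real
    and \<gamma> :: "(ugen list \<Rightarrow>\<^sub>0 complex) set set \<Rightarrow>
      (((ugen list \<Rightarrow>\<^sub>0 complex) set set \<times> (pgen list \<Rightarrow>\<^sub>0 complex) set) \<Rightarrow>\<^sub>0 complex) set"
  assumes "0 < q" and "q < 1"
    and "\<mu> \<in> {-1, 0, 1}" and "\<nu> \<in> {-1, 0, 1}"
    and "is_gamma q \<mu> \<nu> \<tau> \<gamma>"
  shows "(\<tau> \<noteq> 0 \<longrightarrow>
      ((\<exists>I. right_star_coideal (Pol q \<mu>) (Pol_comult q \<mu>) I \<and>
          equivariantly_star_iso_to_coideal (B_alg q \<mu> \<nu> \<tau>) (Pol q \<mu>) (Pol_comult q \<mu>) \<gamma> I)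
        \<longleftrightarrow> \<nu> \<le> 0)) \<and>
    (\<tau> = 0 \<longrightarrow>
      ((\<exists>I. right_star_coideal (Pol q \<mu>) (Pol_comult q \<mu>) I \<and>
          equivariantly_star_iso_to_coideal (B_alg q \<mu> \<nu> \<tau>) (Pol q \<mu>) (Pol_comult q \<mu>) \<gamma> I)
        \<longleftrightarrow> \<nu> = -1))"
proof -
  interpret podles_coaction q \<mu> \<nu> \<tau> \<gamma>
    using assms by unfold_locales auto
  have "(\<exists>I. right_star_coideal (Pol q \<mu>) (Pol_comult q \<mu>) I \<and>
      equivariantly_star_iso_to_coideal (B_alg q \<mu> \<nu> \<tau>) (Pol q \<mu>) (Pol_comult q \<mu>) \<gamma> I)
      \<longleftrightarrow> \<nu> = -1 \<or> \<nu> = 0 \<and> \<tau> \<noteq> 0"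
    using coideal_necessary coideal_nu_minus_one coideal_nu_zero by blast
  then show ?thesis
    using assms(4) by auto
qed

end
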